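(* For each covering of the plane by oriented complete folding t-curves, the local isomorphism property implies (P), and (P) implies the strong local isomorphism property. Any two coverings of the plane by oriented complete folding t-curves with these properties are locally isomorphic if and only if they are associated to the same sequence $\Lambda\in\{-1,+1\}^{\mathbb{N}^*}$ and have the same orientation.
   Context: $\mathbb{N}=\{0,1,2,\dots\}$, $\mathbb{N}^*=\mathbb{N}\setminus\{0\}$. Fix a regular tiling $\mathcal{P}$ of $\mathbb{R}^2$ by equilateral triangles. T-curves. A bounded t-curve (resp. half t-curve, complete t-curve) is a sequence $(A_k)_{0\le k\le n}$ (resp. $(A_k)_{k\in\mathbb{N}}$, $(A_k)_{k\in\mathbb{Z}}$) of oriented sides of triangles of $\mathcal{P}$ such that, for any consecutive $A_k,A_{k+1}$, the terminal point of $A_k$ is the initial point of $A_{k+1}$ and the two segments form an angle $\pm\pi/3$ at that point (so they are two distinct sides of one triangle). The associated sequence is $(a_k)_{1\le k\le n}$ (resp. $(a_k)_{k\in\mathbb{N}^*}$, $(a_k)_{k\in\mathbb{Z}}$), where $a_k=+1$ (resp. $-1$) if one turns left (resp. right) when passing from $A_{k-1}$ to $A_k$. Folding curves. Let $T$ be the empty sequence and, inductively, $T_{\lambda_1\cdots\lambda_{n+1}}=(T_{\lambda_1\cdots\lambda_n},\lambda_{n+1},T_{\lambda_1\cdots\lambda_n},-\lambda_{n+1},T_{\lambda_1\cdots\lambda_n})$ for $\lambda_1,\dots,\lambda_{n+1}\in\{-1,+1\}$. An $n$-folding t-curve is a bounded t-curve associated to some $T_{\lambda_1\cdots\lambda_n}$.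 A complete folding t-curve is a complete t-curve which is an inductive limit of $n$-folding t-curves, i.e. $C=\bigcup_n C_n$ with $C_n$ an $n$-folding t-curve which is a subcurve of $C_{n+1}$ for each $n\in\mathbb{N}$. For each complete folding t-curve $C$ there is a unique sequence $\Lambda=(\lambda_n)_{n\in\mathbb{N}^*}\in\{-1,+1\}^{\mathbb{N}^*}$, not depending on the orientation of $C$, such that each bounded subcurve of $C$ is contained in a t-curve associated to some $T_{\lambda_1\cdots\lambda_n}$; $C$ is said to be associated to $\Lambda$. Coverings. A set $\mathcal{C}$ of t-curves is a covering of the plane if each side of a triangle of $\mathcal{P}$ is the support of exactly one segment of exactly one curve of $\mathcal{C}$. All the curves of a covering by complete folding t-curves are associated to the same sequence $\Lambda$; the covering is then said to be associated to $\Lambda$. A set $E$ of oriented sides of triangles of $\mathcal{P}$ satisfies (P) if, whenever $A,B\in E$ are sides of the same triangle, they define the same direction of rotation around its center. There are exactly two sets $E_1,E_2$ satisfying (P) in which each nonoriented side of a triangle of $\mathcal{P}$ is the support of exactly one element; they are opposite to each other. A covering by oriented curves satisfies (P) if the set of segments of its curves satisfies (P), equivalently is equal to $E_1$ or $E_2$. Two coverings satisfying (P) have the same orientation if their sets of segments are both equal to $E_1$ or both equal to $E_2$. Local isomorphism. Curves are drawn with slightly rounded angles (in a uniform way), so that the curves of a covering do not pass through the vertices of the triangles and are pairwise disjoint. A covering by oriented curves is identified with the union $E\subset\mathbb{R}^2$ of its curves together with their orientations. $B(x,r)$ is the closed ball of center $x$ and radius $r$, and $(B(x,r)\cap E,x)\cong(B(y,r)\cap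 F,y)$ means that the translation taking $x$ to $y$ maps $B(x,r)\cap E$ onto $B(y,r)\cap F$, respecting orientations. $E$ and $F$ are locally isomorphic if, for each $x\in\mathbb{R}^2$ (resp. $y\in\mathbb{R}^2$) and each positive real $r$, there exists $y\in\mathbb{R}^2$ (resp. $x\in\mathbb{R}^2$) such that $(B(x,r)\cap E,x)\cong(B(y,r)\cap F,y)$. $E$ satisfies the local isomorphism property if, for each $x\in\mathbb{R}^2$ and each positive real $r$, there exists a positive real $s$ such that each ball $B(y,s)$ contains some $z$ with $(B(z,r)\cap E,z)\cong(B(x,r)\cap E,x)$. $E$ satisfies the strong local isomorphism property if there exist positive reals $s,t$ such that, for each $x\in\mathbb{R}^2$ and each positive real $r$, each ball $B(y,rs+t)$ contains some $z$ with $(B(z,r)\cap E,z)\cong(B(x,r)\cap E,x)$. *)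

theory Defs
  imports "HOL-Analysis.Analysis" "HOL-Library.Sublist"
begin

text \<open>The plane is \<^typ>\<open>complex\<close>. A triangle is given by the set of its three vertices, a
  nonoriented side by the set of its two endpoints, an oriented side by the pair (initial point,
  terminal point).\<close>

type_synonym side = "complex \<times> complex"

definition lattice_point :: "complex \<Rightarrow> complex \<Rightarrow> int \<Rightarrow> int \<Rightarrow> complex" where
  "lattice_point z0 d m n = z0 + d * (of_int m + of_int n * cis (pi / 3))"

definition regular_tiling :: "complex set set \<Rightarrow> bool" where
  "regular_tiling P \<longleftrightarrow> (\<exists>z0 d. d \<noteq> 0 \<and>
     P = (\<Union>m n. {{lattice_point z0 d m n, lattice_point z0 d (m + 1) n,
                   lattice_point z0 d m (n + 1)},
                  {lattice_point z0 d (m + 1) (n + 1), lattice_point z0 d (m + 1) n,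
                   lattice_point z0 d m (n + 1)}}))"

definition oriented_sides :: "complex set set \<Rightarrow> side set" where
  "oriented_sides P = {(a, b). a \<noteq> b \<and> (\<exists>t\<in>P. a \<in> t \<and> b \<in> t)}"

definition support :: "side \<Rightarrow> complex set" where
  "support A = {fst A, snd A}"

definition dir :: "side \<Rightarrow> complex" where
  "dir A = snd A - fst A"


subsection \<open>T-curves\<close>

text \<open>The angle is taken at the common point, between the vectors pointing to the other endpoints
  of the two segments; hence the direction of travel changes by \<open>\<plusminus>2\<pi>/3\<close>.\<close>

definition joined :: "side \<Rightarrow> side \<Rightarrow> bool" where
  "joined A B \<longleftrightarrow> snd A = fst B \<and>
     (snd B - fst B = cis (pi / 3) * (fst A - snd A) \<or>
      snd B - fst B = cis (- (pi / 3)) * (fst A - snd A))"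

definition turn :: "side \<Rightarrow> side \<Rightarrow> int" where
  "turn A B = (if Im (cnj (dir A) * dir B) > 0 then 1 else - 1)"

definition bounded_tcurve :: "complex set set \<Rightarrow> side list \<Rightarrow> bool" where
  "bounded_tcurve P As \<longleftrightarrow> As \<noteq> [] \<and> set As \<subseteq> oriented_sides P \<and> successively joined As"

definition turns :: "side list \<Rightarrow> int list" where
  "turns As = map2 turn As (tl As)"

definition complete_tcurve :: "complex set set \<Rightarrow> (int \<Rightarrow> side) \<Rightarrow> bool" where
  "complete_tcurve P c \<longleftrightarrow> (\<forall>k. c k \<in> oriented_sides P \<and> joined (c k) (c (k + 1)))"

definition subcurve :: "(int \<Rightarrow> side) \<Rightarrow> int \<Rightarrow> int \<Rightarrow> side list" where
  "subcurve c p q = map c [p..q]"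


subsection \<open>Folding curves\<close>

text \<open>Sign sequences are indexed by the positive integers; the value at 0 is never used.\<close>

definition sign_sequence :: "(nat \<Rightarrow> int) \<Rightarrow> bool" where
  "sign_sequence \<Lambda> \<longleftrightarrow> (\<forall>n\<ge>1. \<Lambda> n \<in> {- 1, 1})"

fun folding_word :: "(nat \<Rightarrow> int) \<Rightarrow> nat \<Rightarrow> int list" where
  "folding_word \<Lambda> 0 = []"
| "folding_word \<Lambda> (Suc n) =
     folding_word \<Lambda> n @ [\<Lambda> (Suc n)] @ folding_word \<Lambda> n @ [- \<Lambda> (Suc n)] @ folding_word \<Lambda> n"

definition n_folding_tcurve :: "complex set set \<Rightarrow> nat \<Rightarrow> side list \<Rightarrow> bool" where
  "n_folding_tcurve P n As \<longleftrightarrow> bounded_tcurve P As \<and>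
     (\<exists>\<Lambda>. sign_sequence \<Lambda> \<and> turns As = folding_word \<Lambda> n)"

definition complete_folding_tcurve :: "complex set set \<Rightarrow> (int \<Rightarrow> side) \<Rightarrow> bool" where
  "complete_folding_tcurve P c \<longleftrightarrow> complete_tcurve P c \<and>
     (\<exists>p q :: nat \<Rightarrow> int.
        (\<forall>n. n_folding_tcurve P n (subcurve c (p n) (q n))) \<and>
        (\<forall>n. p (Suc n) \<le> p n \<and> q n \<le> q (Suc n)) \<and>
        (\<Union>n. {p n..q n}) = UNIV)"

definition curve_associated :: "complex set set \<Rightarrow> (nat \<Rightarrow> int) \<Rightarrow> (int \<Rightarrow> side) \<Rightarrow> bool" where
  "curve_associated P \<Lambda> c \<longleftrightarrow>
     (\<forall>p q. \<exists>n As. bounded_tcurve P As \<and> turns As = folding_word \<Lambda> n \<and>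
                   sublist (subcurve c p q) As)"


subsection \<open>Coverings\<close>

text \<open>Two parametrizations of the same curve (up to a shift of the index or a reversal) have the same
  supports, so the uniqueness below lets a covering contain only one of them.\<close>

definition covering :: "complex set set \<Rightarrow> (int \<Rightarrow> side) set \<Rightarrow> bool" where
  "covering P C \<longleftrightarrow> (\<forall>c\<in>C. complete_tcurve P c) \<and>
     (\<forall>A\<in>oriented_sides P. \<exists>!(c, k). c \<in> C \<and> support (c k) = support A)"

definition folding_covering :: "complex set set \<Rightarrow> (int \<Rightarrow> side) set \<Rightarrow> bool" where
  "folding_covering P C \<longleftrightarrow> covering P C \<and> (\<forall>c\<in>C. complete_folding_tcurve P c)"

definition covering_associated :: "complex set set \<Rightarrow> (nat \<Rightarrow> int) \<Rightarrow> (int \<Rightarrow> side) set \<Rightarrow> bool" where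
  "covering_associated P \<Lambda> C \<longleftrightarrow> (\<forall>c\<in>C. curve_associated P \<Lambda> c)"

definition segments :: "(int \<Rightarrow> side) set \<Rightarrow> side set" where
  "segments C = (\<Union>c\<in>C. range c)"

definition center :: "complex set \<Rightarrow> complex" where
  "center t = (\<Sum>v\<in>t. v) / 3"

text \<open>The value is 1 for a counterclockwise rotation around \<open>g\<close> and -1 for a clockwise one.\<close>

definition rotation_direction :: "complex \<Rightarrow> side \<Rightarrow> real" where
  "rotation_direction g A = sgn (Im (cnj (fst A - g) * (snd A - g)))"

definition property_P :: "complex set set \<Rightarrow> side set \<Rightarrow> bool" where
  "property_P P E \<longleftrightarrow> (\<forall>t\<in>P. \<forall>A\<in>E. \<forall>B\<in>E. support A \<subseteq> t \<longrightarrow> support B \<subseteq> t \<longrightarrow>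
     rotation_direction (center t) A = rotation_direction (center t) B)"

definition coherent_orientations :: "complex set set \<Rightarrow> side set set" where
  "coherent_orientations P = {E. E \<subseteq> oriented_sides P \<and> property_P P E \<and>
     (\<forall>A\<in>oriented_sides P. \<exists>!B. B \<in> E \<and> support B = support A)}"

definition same_orientation ::
  "complex set set \<Rightarrow> (int \<Rightarrow> side) set \<Rightarrow> (int \<Rightarrow> side) set \<Rightarrow> bool" where
  "same_orientation P C D \<longleftrightarrow> (\<exists>E\<in>coherent_orientations P. segments C = E \<and> segments D = E)"


subsection \<open>Drawing with rounded angles\<close>

text \<open>An oriented drawing is recorded as the set of pairs (point of the curve, unit tangent vector in
  the direction of travel). For a parameter \<open>0 < \<delta> < 1/2\<close>, the part of each side within
  \<open>\<delta>\<close> times the side length of its endpoints is removed, and consecutive sides are reconnected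
  by the circular arc tangent to both. With \<open>u = dir A\<close>, \<open>v = snd A\<close> and \<open>\<sigma>\<close> the turn from \<open>A\<close> to
  \<open>B\<close>, this arc has radius \<open>\<delta> \<bar>u\<bar> tan (\<pi>/6)\<close>, starts at \<open>v - \<delta> u\<close>, and its center lies on the
  side towards which the curve turns.\<close>

type_synonym drawing = "(complex \<times> complex) set"

definition straight_part :: "real \<Rightarrow> side \<Rightarrow> drawing" where
  "straight_part \<delta> A =
     (\<lambda>s. (fst A + of_real s * dir A, sgn (dir A))) ` {\<delta>..1 - \<delta>}"

definition corner_arc :: "real \<Rightarrow> side \<Rightarrow> side \<Rightarrow> drawing" where
  "corner_arc \<delta> A B =
     (let u = dir A; \<sigma> = real_of_int (turn A B);
          w = \<i> * of_real (\<sigma> * \<delta> * tan (pi / 6)) * u;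
          c = snd A - of_real \<delta> * u + w
      in (\<lambda>\<theta>. (c - w * cis (\<sigma> * \<theta>), sgn u * cis (\<sigma> * \<theta>))) ` {0..2 * pi / 3})"

definition drawing :: "real \<Rightarrow> (int \<Rightarrow> side) set \<Rightarrow> drawing" where
  "drawing \<delta> C = (\<Union>c\<in>C. \<Union>k. straight_part \<delta> (c k) \<union> corner_arc \<delta> (c k) (c (k + 1)))"


subsection \<open>Local isomorphism\<close>

definition patch :: "drawing \<Rightarrow> complex \<Rightarrow> real \<Rightarrow> drawing" where
  "patch E x r = {(p, \<tau>) \<in> E. p \<in> cball x r}"

definition patch_iso :: "real \<Rightarrow> drawing \<Rightarrow> complex \<Rightarrow> drawing \<Rightarrow> complex \<Rightarrow> bool" where
  "patch_iso r E x F y \<longleftrightarrow> (\<lambda>(p, \<tau>). (p + (y - x), \<tau>)) ` patch E x r = patch F y r"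

definition locally_isomorphic :: "drawing \<Rightarrow> drawing \<Rightarrow> bool" where
  "locally_isomorphic E F \<longleftrightarrow>
     (\<forall>x. \<forall>r>0. \<exists>y. patch_iso r E x F y) \<and> (\<forall>y. \<forall>r>0. \<exists>x. patch_iso r E x F y)"

definition local_isomorphism_property :: "drawing \<Rightarrow> bool" where
  "local_isomorphism_property E \<longleftrightarrow>
     (\<forall>x. \<forall>r>0. \<exists>s>0. \<forall>y. \<exists>z\<in>cball y s. patch_iso r E z E x)"

definition strong_local_isomorphism_property :: "drawing \<Rightarrow> bool" where
  "strong_local_isomorphism_property E \<longleftrightarrow>
     (\<exists>s>0. \<exists>t>0. \<forall>x. \<forall>r>0. \<forall>y. \<exists>z\<in>cball y (r * s + t). patch_iso r E z E x)"

end

theory Submission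
  imports Defs
begin

text \<open>Vertices are Eisenstein integers. A covering in which every curve runs in the directions
  \<open>d\<close>, \<open>d\<omega>\<close>, \<open>d\<omega>\<^sup>2\<close> is determined by a sign at each vertex: the common turn of the three
  passages through it. On a folding curve, the turns outside one residue class modulo 3 are
  alternately \<open>\<lambda>\<^sub>1\<close> and \<open>-\<lambda>\<^sub>1\<close>, and those in the class are again the turns of a folding curve, on the
  sublattice \<open>(2 + \<omega>)L\<close> or \<open>(1 - \<omega>)L\<close> according to \<open>\<lambda>\<^sub>1\<close>. The heart of the proof is that all curves
  of the covering select the same coset of this sublattice. Where curves of different types meet, the
  regions swept out by the types have a common boundary; the branching pattern along the boundary of
  each region obeys a paperfolding law, and a finite search shows that these laws cannot hold on both
  sides of a boundary unless the cosets agree. Hence the sign is a Toeplitz pattern on the lattice: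
  up to one undetermined vertex in each patch it is periodic, which gives the strong local isomorphism
  property and local isomorphism for equal \<open>\<Lambda>\<close> and orientation.

  Conversely, a point of an arc with tangent opposite to a given side direction is isolated and
  determines its vertex and the sign there, so an isomorphism of patches transports the signs. Finally,
  a single folding curve contains all sides meeting arbitrarily large balls: a vertex all of whose sides
  lie on the curve inflates to a larger ball at each level. If a covering contained segments of both
  orientations, local isomorphism would copy a segment of the other orientation into such a ball, where
  its tangent direction does not occur along an interval.\<close>


section \<open>A finite search for boundaries between regions\<close>

text \<open>The obstacle is that the folding of a single curve says nothing about how neighbouring
  curves are placed: each could use a coset of its own. Boundaries are traced only through vertices
  where all passages turn right; conjugation supplies the rest. At such a vertex the passages leave
  the corners of the three counterclockwise triangles open, and two types touch across a triangle
  with exactly two such corners. These triangles are the edges of a graph with vertices of degree 2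
  or 3. Along one region its vertices lie alternately on and off the selected coset, and dividing
  those on the coset by the factor of norm 3 gives a walk of the same kind on the sublattice; this
  halving at every level is the origin of the paperfolding law. The search uses the law to depth
  six, which takes seven signs of each curve. Types are therefore finite lists, and agreement on
  \<open>n\<close> signs is derived from \<open>n + 7\<close>. The second orientation never gets a
  proof of its own: replacing \<open>d\<close> by \<open>- d\<close> gives the same tiling.\<close>

fun evens :: "'a list \<Rightarrow> 'a list" where
  "evens [] = []"
| "evens [x] = [x]"
| "evens (x # y # xs) = x # evens xs"

definition odds :: "'a list \<Rightarrow> 'a list" where
  "odds xs = evens (tl xs)"

text \<open>The factors of words satisfying the paperfolding law down to depth \<open>n\<close>; the flag tells whether the
  alternating letters start at the first position.\<close>

fun fold_word_ok :: "nat \<Rightarrow> bool \<Rightarrow> bool list \<Rightarrow> bool" where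
  "fold_word_ok 0 f w = True"
| "fold_word_ok (Suc n) f w =
     (let a = (if f then evens w else odds w); b = (if f then odds w else evens w)
      in successively (\<noteq>) a \<and> (fold_word_ok n True b \<or> fold_word_ok n False b))"

text \<open>A configuration is a partially explored boundary: for each region touched so far a word of
  branchings read along it, and the pairs \<open>(a, b)\<close> of regions where the word of \<open>a\<close> and the word of \<open>b\<close>
  (read backwards) can be continued along a common edge. One step of exploration either lets a third
  region end on one of the two sides or separates the two regions by a new one.\<close>

type_synonym face = "bool \<times> bool list"
type_synonym config = "face list \<times> (nat \<times> nat) list"

fun children :: "(bool \<Rightarrow> bool \<Rightarrow> bool \<Rightarrow> bool) \<Rightarrow> config \<Rightarrow> nat \<times> nat \<Rightarrow> config list" where
  "children al (fs, ds) (a, b) =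
     (if a = b \<or> length fs \<le> a \<or> length fs \<le> b \<or> (a, b) \<notin> set ds then [(fs, ds)] else
      let fa = fst (fs ! a); wa = snd (fs ! a); fb = fst (fs ! b); wb = snd (fs ! b);
          na = (fa = even (length wa)); nb = (\<not> fb); c = length fs;
          ok = (\<lambda>x y. fold_word_ok 6 fa (wa @ [x]) \<and> fold_word_ok 6 nb (y # wb));
          ext = (\<lambda>x y. fs[a := (fa, wa @ [x]), b := (nb, y # wb)]);
          rest = filter (\<lambda>(p, q). p \<noteq> a \<and> q \<noteq> b \<and> p < length fs \<and> q < length fs) ds
      in (if ok False True then [(ext False True, (a, b) # rest)] else []) @
         (if ok True False then [(ext True False, (a, b) # rest)] else []) @
         (if ok True True then
            (if al na True nb then [(ext True True @ [(True, [True])], (a, c) # (c, b) # rest)] else []) @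
            (if al na False nb then [(ext True True @ [(False, [True])], (a, c) # (c, b) # rest)] else [])
          else []))"

declare children.simps [simp del]

text \<open>A depth-first search: \<open>cs\<close> is the stack of open configurations and each
  pair of the certificate names the edge along which the top one is expanded. Only an empty stack
  counts as success, so a faulty certificate can make the check fail but cannot make it
  unsound.\<close>

fun excludes :: "(bool \<Rightarrow> bool \<Rightarrow> bool \<Rightarrow> bool) \<Rightarrow> config list \<Rightarrow> (nat \<times> nat) list \<Rightarrow> bool" where
  "excludes al [] ds = True"
| "excludes al (c # cs) [] = False"
| "excludes al (c # cs) (d # ds) = excludes al (children al c d @ cs) ds"

text \<open>Boundary graphs in the abstract: \<open>\<phi>\<close> and \<open>\<psi>\<close> lead to
  the next and previous dart of the same region, \<open>opp\<close> crosses the edge. At a vertex of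
  degree 2 the third passage belongs to one of the two sides, so exactly one of the labels read
  there is true; at degree 3 both are, and a third region \<open>z\<close> lies between.\<close>

locale spine =
  fixes Dt :: "'d set" and \<phi> \<psi> opp :: "'d \<Rightarrow> 'd" and lab flag :: "'d \<Rightarrow> bool"
  assumes phi_in: "d \<in> Dt \<Longrightarrow> \<phi> d \<in> Dt" and psi_in: "d \<in> Dt \<Longrightarrow> \<psi> d \<in> Dt"
    and opp_in: "d \<in> Dt \<Longrightarrow> opp d \<in> Dt"
    and phi_psi: "d \<in> Dt \<Longrightarrow> \<phi> (\<psi> d) = d" and psi_phi: "d \<in> Dt \<Longrightarrow> \<psi> (\<phi> d) = d"
    and opp_opp: "d \<in> Dt \<Longrightarrow> opp (opp d) = d"
    and flag_phi: "d \<in> Dt \<Longrightarrow> flag (\<phi> d) = (\<not> flag d)"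
    and law: "d \<in> Dt \<Longrightarrow> fold_word_ok 6 (flag d) (map (\<lambda>i. lab ((\<phi> ^^ i) d)) [0..<m])"
    and next_vertex: "d \<in> Dt \<Longrightarrow>
      \<not> lab (\<phi> d) \<and> lab (opp d) \<and> opp (\<phi> d) = \<psi> (opp d) \<or>
      lab (\<phi> d) \<and> \<not> lab (opp d) \<and> opp (\<phi> d) = \<psi> (opp d) \<or>
      lab (\<phi> d) \<and> lab (opp d) \<and>
        (\<exists>z\<in>Dt. lab z \<and> opp (\<phi> d) = \<psi> z \<and> opp z = \<psi> (opp d))"
begin

text \<open>The darts at a vertex of degree 3, in cyclic order.\<close>

definition triple :: "'d \<Rightarrow> 'd \<Rightarrow> 'd \<Rightarrow> bool" where
  "triple x z y \<longleftrightarrow> x \<in> Dt \<and> z \<in> Dt \<and> y \<in> Dt \<and> lab x \<and> lab z \<and> lab y \<and>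
     opp x = \<psi> z \<and> opp z = \<psi> y \<and> opp y = \<psi> x"

text \<open>\<open>e\<close> sends the index of a region to the first dart of its word. A pair
  \<open>(a, b)\<close> stands for an edge with the last dart read on \<open>a\<close> on one side
  and the dart before the first one read on \<open>b\<close> on the other.\<close>

definition realizes :: "(nat \<Rightarrow> 'd) \<Rightarrow> config \<Rightarrow> bool" where
  "realizes e c \<longleftrightarrow>
     (\<forall>f < length (fst c). e f \<in> Dt \<and> flag (e f) = fst (fst c ! f) \<and> snd (fst c ! f) \<noteq> [] \<and>
        map (\<lambda>i. lab ((\<phi> ^^ i) (e f))) [0..<length (snd (fst c ! f))] = snd (fst c ! f)) \<and>
     (\<forall>(a, b) \<in> set (snd c). a < length (fst c) \<and> b < length (fst c) \<longrightarrow>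
        opp ((\<phi> ^^ (length (snd (fst c ! a)) - 1)) (e a)) = \<psi> (e b))"

lemma phi_pow_in: "d \<in> Dt \<Longrightarrow> (\<phi> ^^ i) d \<in> Dt"
  by (induction i) (auto simp: phi_in)

lemma flag_phi_pow: "d \<in> Dt \<Longrightarrow> flag ((\<phi> ^^ i) d) = (flag d = even i)"
  by (induction i) (auto simp: flag_phi phi_pow_in)

lemma phi_pow_psi: "d \<in> Dt \<Longrightarrow> (\<phi> ^^ Suc i) (\<psi> d) = (\<phi> ^^ i) d"
  by (simp add: funpow_Suc_right phi_psi del: funpow.simps)

lemma word_front:
  assumes "e \<in> Dt" "map (\<lambda>i. lab ((\<phi> ^^ i) e)) [0..<length w] = w" "lab ((\<phi> ^^ length w) e) = x"
  shows "map (\<lambda>i. lab ((\<phi> ^^ i) e)) [0..<length (w @ [x])] = w @ [x]"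
  using assms by simp

lemma word_back:
  assumes "e \<in> Dt" "map (\<lambda>i. lab ((\<phi> ^^ i) e)) [0..<length w] = w" "lab (\<psi> e) = x"
  shows "map (\<lambda>i. lab ((\<phi> ^^ i) (\<psi> e))) [0..<length (x # w)] = x # w"
proof -
  have "map (\<lambda>i. lab ((\<phi> ^^ i) (\<psi> e))) [0..<length (x # w)]
      = lab (\<psi> e) # map (\<lambda>i. lab ((\<phi> ^^ Suc i) (\<psi> e))) [0..<length w]"
    by (simp add: map_upt_Suc del: upt_Suc)
  also have "\<dots> = x # w"
    using assms by (simp add: phi_pow_psi del: funpow.simps)
  finally show ?thesis by simp
qed

text \<open>Crossing to the far end of an edge prolongs the word of \<open>a\<close> at its end and
  that of \<open>b\<close> at its front. \<open>law\<close> makes both new words admissible, and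
  \<open>next_vertex\<close> tells which alternative of \<open>children\<close> occurs.\<close>

lemma realizes_children:
  assumes re: "realizes e c"
    and al: "\<And>x z y. triple x z y \<Longrightarrow> al (flag x) (flag z) (flag y)"
  shows "\<exists>e' c'. c' \<in> set (children al c d) \<and> realizes e' c'"
proof -
  obtain fs ds where c: "c = (fs, ds)" by (cases c)
  obtain a b where d: "d = (a, b)" by (cases d)
  show ?thesis
  proof (cases "a = b \<or> length fs \<le> a \<or> length fs \<le> b \<or> (a, b) \<notin> set ds")
    case True
    then show ?thesis using re by (auto simp: c d children.simps)
  next
    case False
    then have ab: "a \<noteq> b" "a < length fs" "b < length fs" "(a, b) \<in> set ds" by auto
    obtain fa wa where fa: "fs ! a = (fa, wa)" by (cases "fs ! a")
    obtain fb wb where fb: "fs ! b = (fb, wb)" by (cases "fs ! b")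
    have faces: "e f \<in> Dt" "flag (e f) = fst (fs ! f)" "snd (fs ! f) \<noteq> []"
       "map (\<lambda>i. lab ((\<phi> ^^ i) (e f))) [0..<length (snd (fs ! f))] = snd (fs ! f)"
      if "f < length fs" for f
      using re that by (auto simp: realizes_def c)
    have darts: "opp ((\<phi> ^^ (length (snd (fs ! a)) - 1)) (e a)) = \<psi> (e b)"
      if "(a, b) \<in> set ds" "a < length fs" "b < length fs" for a b
      using re that by (auto simp: realizes_def c)
    have A: "e a \<in> Dt" "flag (e a) = fa" "wa \<noteq> []"
        "map (\<lambda>i. lab ((\<phi> ^^ i) (e a))) [0..<length wa] = wa"
      using faces[OF ab(2)] by (simp_all add: fa)
    have B: "e b \<in> Dt" "flag (e b) = fb" "wb \<noteq> []"
        "map (\<lambda>i. lab ((\<phi> ^^ i) (e b))) [0..<length wb] = wb"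
      using faces[OF ab(3)] by (simp_all add: fb)
    define t where "t = (\<phi> ^^ (length wa - 1)) (e a)"
    have t: "t \<in> Dt" by (simp add: t_def phi_pow_in A)
    have opt: "opp t = \<psi> (e b)" using darts[OF ab(4,2,3)] by (simp add: t_def fa)
    have pt: "\<phi> t = (\<phi> ^^ length wa) (e a)"
      using A(3) by (cases wa) (simp_all add: t_def)
    let ?x = "\<phi> t" and ?y = "\<psi> (e b)"
    have xin: "?x \<in> Dt" and yin: "?y \<in> Dt" using t B(1) by (auto simp: phi_in psi_in)
    have fx: "flag ?x = (fa = even (length wa))"
      using flag_phi_pow[OF A(1), of "length wa"] A(2) by (simp add: pt)
    have fy: "flag ?y = (\<not> fb)"
      using flag_phi[OF yin] B by (auto simp: phi_psi)
    have wa': "map (\<lambda>i. lab ((\<phi> ^^ i) (e a))) [0..<length (wa @ [lab ?x])] = wa @ [lab ?x]"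
      by (rule word_front[OF A(1,4)]) (simp add: pt)
    have wb': "map (\<lambda>i. lab ((\<phi> ^^ i) ?y)) [0..<length (lab ?y # wb)] = lab ?y # wb"
      by (rule word_back[OF B(1,4)]) simp
    have oka: "fold_word_ok 6 fa (wa @ [lab ?x])"
      using law[OF A(1), of "length (wa @ [lab ?x])"] unfolding wa' A(2) .
    have okb: "fold_word_ok 6 (\<not> fb) (lab ?y # wb)"
      using law[OF yin, of "length (lab ?y # wb)"] unfolding wb' fy .
    define e1 where "e1 = e(b := ?y)"
    define fs1 where "fs1 = fs[a := (fa, wa @ [lab ?x]), b := (\<not> fb, lab ?y # wb)]"
    have fs1: "length fs1 = length fs" "fs1 ! a = (fa, wa @ [lab ?x])" "fs1 ! b = (\<not> fb, lab ?y # wb)"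
       "\<And>f. f \<noteq> a \<Longrightarrow> f \<noteq> b \<Longrightarrow> fs1 ! f = fs ! f"
      using ab by (auto simp: fs1_def nth_list_update)
    have faces1: "e1 f \<in> Dt \<and> flag (e1 f) = fst (fs1 ! f) \<and> snd (fs1 ! f) \<noteq> [] \<and>
       map (\<lambda>i. lab ((\<phi> ^^ i) (e1 f))) [0..<length (snd (fs1 ! f))] = snd (fs1 ! f)"
      if "f < length fs" for f
    proof -
      consider "f = a" | "f = b" | "f \<noteq> a" "f \<noteq> b" by blast
      then show ?thesis
      proof cases
        case 1
        then show ?thesis using ab A wa' by (simp add: fs1 e1_def)
      next
        case 2
        then show ?thesis using ab yin fy wb' by (simp add: fs1 e1_def)
      next
        case 3
        then show ?thesis using faces[OF that] by (simp add: fs1 e1_def)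
      qed
    qed
    have last1: "(\<phi> ^^ (length (snd (fs1 ! f)) - 1)) (e1 f) =
        (if f = a then ?x else (\<phi> ^^ (length (snd (fs ! f)) - 1)) (e f))" if "f < length fs" for f
    proof -
      consider "f = a" | "f = b" | "f \<noteq> a" "f \<noteq> b" by blast
      then show ?thesis
      proof cases
        case 1
        then show ?thesis using ab by (simp add: fs1 e1_def pt)
      next
        case 2
        then show ?thesis
          using ab B phi_pow_psi[OF B(1), of "length wb - 1"] by (simp add: fs1 e1_def fb)
      next
        case 3
        then show ?thesis by (simp add: fs1 e1_def)
      qed
    qed
    define rest where "rest = filter (\<lambda>(p, q). p \<noteq> a \<and> q \<noteq> b \<and> p < length fs \<and> q < length fs) ds"
    have rest1: "opp ((\<phi> ^^ (length (snd (fs1 ! p)) - 1)) (e1 p)) = \<psi> (e1 q)"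
      if "(p, q) \<in> set rest" "p < length fs" "q < length fs" for p q
      using that darts[of p q] last1[of p] by (auto simp: rest_def e1_def)
    have ext: "fs[a := (fa, wa @ [u]), b := (\<not> fb, v # wb)] = fs1" if "u = lab ?x" "v = lab ?y" for u v
      by (simp add: fs1_def that)
    have ch: "children al c d =
      (let ok = (\<lambda>x y. fold_word_ok 6 fa (wa @ [x]) \<and> fold_word_ok 6 (\<not> fb) (y # wb));
          ext = (\<lambda>x y. fs[a := (fa, wa @ [x]), b := (\<not> fb, y # wb)]); c = length fs; na = (fa = even (length wa))
      in (if ok False True then [(ext False True, (a, b) # rest)] else []) @
         (if ok True False then [(ext True False, (a, b) # rest)] else []) @
         (if ok True True then
            (if al na True (\<not> fb) then [(ext True True @ [(True, [True])], (a, c) # (c, b) # rest)] else []) @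
            (if al na False (\<not> fb) then [(ext True True @ [(False, [True])], (a, c) # (c, b) # rest)] else [])
          else []))"
      using ab by (simp add: c d children.simps fa fb Let_def rest_def)
    consider (two) "lab ?x \<noteq> lab ?y" "opp ?x = \<psi> ?y"
      | (three) z where "lab ?x" "lab ?y" "z \<in> Dt" "lab z" "opp ?x = \<psi> z" "opp z = \<psi> ?y"
      using next_vertex[OF t] by (auto simp: opt)
    then show ?thesis
    proof cases
      case two
      have "(fs1, (a, b) # rest) \<in> set (children al c d)"
        unfolding ch Let_def using two(1) oka okb ext by (cases "lab ?x"; cases "lab ?y") auto
      moreover have "realizes e1 (fs1, (a, b) # rest)"
        unfolding realizes_def using faces1 rest1 last1[OF ab(2)] two(2) ab
        by (auto simp: fs1(1)) (simp add: e1_def)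
      ultimately show ?thesis by blast
    next
      case three
      \<comment> \<open>The third region gets the next free index and the one-letter word of its
        dart \<open>z\<close>.\<close>
      define e2 where "e2 = e1(length fs := z)"
      let ?fs2 = "fs1 @ [(flag z, [True])]" and ?ds2 = "(a, length fs) # (length fs, b) # rest"
      have tr: "triple ?x z ?y"
        unfolding triple_def using three xin yin opp_opp[OF t] opt psi_phi[OF t]
        by (metis opp_in opp_opp)
      have al2: "al (fa = even (length wa)) (flag z) (\<not> fb)"
        using al[OF tr] unfolding fx fy .
      have "(?fs2, ?ds2) \<in> set (children al c d)"
        unfolding ch Let_def using three(1,2) oka okb ext al2 by (cases "flag z") auto
      moreover have "realizes e2 (?fs2, ?ds2)"
      proof -
        have f2: "e2 f \<in> Dt \<and> flag (e2 f) = fst (?fs2 ! f) \<and> snd (?fs2 ! f) \<noteq> [] \<and>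
          map (\<lambda>i. lab ((\<phi> ^^ i) (e2 f))) [0..<length (snd (?fs2 ! f))] = snd (?fs2 ! f)"
          if "f < length ?fs2" for f
        proof (cases "f = length fs")
          case True
          then show ?thesis using three by (simp add: e2_def fs1(1) nth_append)
        next
          case False
          then have "f < length fs" using that by (simp add: fs1(1))
          then show ?thesis using faces1[of f] by (simp add: e2_def nth_append fs1(1))
        qed
        have d2: "opp ((\<phi> ^^ (length (snd (?fs2 ! p)) - 1)) (e2 p)) = \<psi> (e2 q)"
          if "(p, q) \<in> set ?ds2" "p < length ?fs2" "q < length ?fs2" for p q
        proof -
          consider "p = a" "q = length fs" | "p = length fs" "q = b" | "(p, q) \<in> set rest"
            using \<open>(p, q) \<in> set ?ds2\<close> by auto
          then show ?thesis
          proof cases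
            case 1
            then show ?thesis using three last1[OF ab(2)] ab
              by (simp add: e2_def nth_append fs1(1))
          next
            case 2
            then show ?thesis using three ab
              by (simp add: e2_def nth_append fs1(1)) (simp add: e1_def)
          next
            case 3
            then have "p < length fs" "q < length fs" by (auto simp: rest_def)
            then show ?thesis using rest1[OF 3] by (simp add: e2_def nth_append fs1(1))
          qed
        qed
        show ?thesis unfolding realizes_def using f2 d2 by auto
      qed
      ultimately show ?thesis by blast
    qed
  qed
qed

text \<open>By \<open>realizes_children\<close> a realized configuration on the stack always leaves
  a realized one behind, so the stack could never become empty.\<close>

lemma excludes_sound:
  assumes "excludes al cs ds"
    and al: "\<And>x z y. triple x z y \<Longrightarrow> al (flag x) (flag z) (flag y)"
  shows "c \<in> set cs \<Longrightarrow> \<not> realizes e c"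
  using assms
proof (induction al cs ds arbitrary: c e rule: excludes.induct)
  case (3 al c' cs d ds)
  have IH: "\<not> realizes e c" if "c \<in> set (children al c' d @ cs)" for c e
    using 3 that by simp
  note al = "3.prems"(3)
  show ?case
  proof (cases "c = c'")
    case True
    show ?thesis
    proof
      assume "realizes e c"
      from realizes_children[OF this, where al = al, OF al] IH True show False
        by (metis in_set_conv_decomp append_Cons append_assoc UnCI set_append)
    qed
  next
    case False
    then show ?thesis using 3 IH by auto
  qed
qed simp_all

lemma realizes_triple:
  assumes "triple x z y"
  shows "realizes ((\<lambda>_. x)(1 := z, 2 := y))
    ([(flag x, [True]), (flag z, [True]), (flag y, [True])], [(0, 1), (1, 2), (2, 0)])"
  using assms by (auto simp: realizes_def triple_def less_Suc_eq)

lemma triple_rotate: "triple x z y \<Longrightarrow> triple z y x"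
  by (auto simp: triple_def)

text \<open>The lists of pairs below are certificates found by a computer search: at each step they name the
  common edge along which the current configuration is explored.\<close>

lemma not_triple_3: "triple x z y \<Longrightarrow> \<not> (flag x \<and> flag z \<and> flag y)"
proof
  assume tr: "triple x z y" and f: "flag x \<and> flag z \<and> flag y"
  have "excludes (\<lambda>_ _ _. True) [([(True, [True]), (True, [True]), (True, [True])], [(0, 1), (1, 2), (2, 0)])]
     [(0,1), (0,1), (0,1), (0,3), (3,1), (0,3), (3,1), (1,2), (1,2), (1,2), (1,4), (4,2), (1,4),
     (1,4), (4,2), (0,3), (3,1)]"
    by code_simp
  from excludes_sound[OF this] realizes_triple[OF tr] f show False by simp
qed

text \<open>What has already been excluded enters through \<open>al\<close> and cuts every branch of
  the search that would create such a vertex.\<close>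

lemma not_triple_2: "triple x z y \<Longrightarrow> \<not> (flag x \<and> flag z \<and> \<not> flag y)"
proof
  assume tr: "triple x z y" and f: "flag x \<and> flag z \<and> \<not> flag y"
  have "excludes (\<lambda>p q r. \<not> (p \<and> q \<and> r))
     [([(True, [True]), (True, [True]), (False, [True])], [(0, 1), (1, 2), (2, 0)])]
     [(0,1), (0,1), (0,1), (0,3), (3,1), (0,3), (3,1), (1,2), (2,0), (1,2), (2,0), (1,2), (2,0),
     (1,2), (2,0), (2,0), (2,0), (0,3), (0,3), (0,3), (0,3), (3,1), (0,4), (0,4), (3,1), (0,4),
     (4,3), (0,4), (4,3), (0,4), (1,2), (1,2), (2,0), (2,0), (1,2), (2,0), (1,2), (2,0), (1,2),
     (3,1), (3,1), (3,1), (3,1), (0,3), (4,1), (4,1), (0,3), (4,1), (3,4), (4,1), (3,4), (4,1),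
     (4,0), (4,0), (4,0), (2,4), (1,2), (4,0), (2,4), (1,2), (4,0), (2,4), (1,2), (4,0), (2,4),
     (4,0), (2,4), (2,0), (1,4), (2,0), (1,4), (2,0), (1,4), (4,2), (2,0), (1,4), (4,2), (2,0),
     (1,4), (4,2), (2,0), (1,4), (4,2), (2,0), (1,4), (4,2), (2,0), (0,3), (3,1)]"
    by code_simp
  from excludes_sound[OF this] realizes_triple[OF tr] f not_triple_3 show False by simp
qed

lemma not_triple_1: "triple x z y \<Longrightarrow> \<not> (flag x \<and> \<not> flag z \<and> \<not> flag y)"
proof
  assume tr: "triple x z y" and f: "flag x \<and> \<not> flag z \<and> \<not> flag y"
  \<comment> \<open>Rotating a triple, the two earlier results exclude every triple with at least
    two true flags.\<close>
  have al: "\<not> (p \<and> q \<or> q \<and> r \<or> r \<and> p)"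
    if "triple x z y" "p = flag x" "q = flag z" "r = flag y" for x y z p q r
    using that not_triple_3[of x z y] not_triple_2[of x z y] not_triple_2[of z y x]
      not_triple_2[of y x z] triple_rotate by metis
  have "excludes (\<lambda>p q r. \<not> (p \<and> q \<or> q \<and> r \<or> r \<and> p))
     [([(True, [True]), (False, [True]), (False, [True])], [(0, 1), (1, 2), (2, 0)])]
     [(1,2), (2,0), (2,0), (0,1), (0,1), (0,1), (2,0), (3,0), (0,1), (0,1), (0,4), (4,1), (4,1),
     (4,1), (5,1), (1,2), (2,3), (1,2), (2,3), (1,2), (1,2), (1,2), (1,2), (1,2), (1,2), (2,3),
     (2,3), (2,3), (1,2), (2,6), (6,3), (1,2), (2,6), (6,3), (2,6), (2,6), (2,3), (6,2), (2,3),
     (6,2), (2,3), (1,6), (6,2), (2,3), (1,6), (6,2), (2,3), (1,6), (6,2), (1,6), (1,2), (2,3),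
     (4,1), (0,4), (1,2), (2,3), (4,1), (0,5), (5,4), (1,2), (2,3), (4,1), (5,4), (1,2), (4,1),
     (0,3), (3,1), (3,1), (3,1), (3,1), (3,1), (3,1), (3,1), (4,1), (3,4), (1,2), (1,2), (1,2),
     (1,2), (1,2), (1,2), (1,2), (1,2), (0,3), (0,3), (0,3), (0,3), (0,3), (0,3), (2,0), (2,0),
     (2,0), (1,2), (2,6), (6,0), (0,3), (6,0), (6,0), (6,0), (6,0), (6,0), (6,0), (2,6), (2,6),
     (1,2), (2,7), (7,6), (2,0), (0,3), (0,3), (2,0), (6,3), (6,3), (2,0), (0,6), (6,3), (0,6),
     (6,3), (0,6), (6,3), (0,6), (6,3), (6,2), (6,2), (1,6), (6,2), (1,6), (6,2), (1,6), (6,2),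
     (1,6), (0,3), (2,0), (3,4), (4,1), (0,3), (3,4), (4,1), (0,3), (3,4), (4,1), (0,3), (3,4),
     (1,2), (4,1), (1,2), (4,1), (1,2), (4,1), (1,2), (4,1), (4,1), (3,4), (3,4), (0,3), (2,0),
     (3,5), (5,4), (0,1), (0,1), (2,0), (2,0), (2,0), (0,1), (0,3), (2,0), (2,0), (4,0), (2,4),
     (2,4), (2,4), (2,5), (0,3), (0,3), (0,3), (0,3), (0,3), (3,1), (3,1), (1,2), (3,6), (6,1),
     (4,0), (5,4), (0,3), (4,0), (0,3), (4,0), (4,0), (5,4), (0,6), (4,0), (0,6), (4,0), (5,4),
     (0,6), (6,3), (4,0), (0,6), (4,0), (1,2), (3,1), (2,4), (4,0), (1,2), (3,1), (2,4), (5,0),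
     (4,5), (1,2), (3,1), (2,4), (4,5), (1,2), (2,4), (3,0), (2,3), (2,3), (2,3), (2,3), (2,3),
     (2,3), (2,3), (2,4), (4,3), (1,2), (1,2), (1,2), (1,2), (1,2), (1,2), (3,0), (0,1), (3,0),
     (3,0), (3,0), (3,0), (3,0), (3,0), (3,0), (0,1), (0,1), (0,1), (1,2), (0,6), (6,1), (3,0),
     (0,6), (0,6), (0,6), (0,6), (0,6), (0,6), (6,1), (6,1), (1,2), (6,7), (7,1), (0,1), (3,6),
     (3,6), (0,1), (3,6), (6,0), (3,6), (6,0), (3,6), (6,0), (3,6), (1,2), (1,2), (1,6), (1,6),
     (1,6), (6,2), (1,6), (6,2), (1,6), (6,2), (1,6), (6,2), (3,0), (0,1), (4,3), (2,4), (3,0),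
     (4,3), (2,4), (3,0), (4,3), (2,4), (3,0), (4,3), (1,2), (2,4), (1,2), (2,4), (1,2), (2,4),
     (1,2), (2,4), (2,4), (4,3), (4,3), (3,0), (0,1), (4,5), (5,3)]"
    by code_simp
  from excludes_sound[OF this] realizes_triple[OF tr] f al show False by simp
qed

lemma triple_flags: "triple x z y \<Longrightarrow> \<not> flag x \<and> \<not> flag z \<and> \<not> flag y"
  using not_triple_3[of x z y] not_triple_2[of x z y] not_triple_2[of z y x] not_triple_2[of y x z]
    not_triple_1[of x z y] not_triple_1[of z y x] not_triple_1[of y x z] triple_rotate
  by metis

text \<open>If the flags on the two sides of an edge differ, they differ all along the boundary, so
  no vertex of degree 3 is compatible with \<open>triple_flags\<close>. The two words, read in
  opposite directions, are then complementary but have opposite parity, and the law does not allow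
  this for long.\<close>

lemma flag_across:
  assumes d: "d \<in> Dt" "b \<in> Dt" "opp d = \<psi> b"
  shows "flag d = flag b"
proof -
  \<comment> \<open>No third region can appear, so \<open>(0, 1)\<close> is the only edge to
    explore; 200 bounds the search steps for the eight starting configurations together.\<close>
  have *: "excludes (\<lambda>p q r. \<not> p \<and> \<not> q \<and> \<not> r)
     [([(f, [x]), (\<not> f, [y])], [(0, 1)]). f \<leftarrow> [True, False], x \<leftarrow> [True, False], y \<leftarrow> [True, False]]
     (replicate 200 (0, 1))"
    by code_simp
  have "realizes ((\<lambda>_. d)(1 := b)) ([(flag d, [lab d]), (flag b, [lab b])], [(0, 1)])"
    using d by (auto simp: realizes_def less_Suc_eq)
  with excludes_sound[OF *] triple_flags show ?thesis
    by (cases "flag d"; cases "flag b"; cases "lab d"; cases "lab b") auto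
qed

end

section \<open>Eisenstein integers\<close>

type_synonym point = "int \<times> int"

text \<open>A pair (a, b) stands for a + b\<omega> with \<omega> a primitive cube root of unity;
  this is multiplication by \<omega>.\<close>

definition rot :: "point \<Rightarrow> point" where
  "rot x = (- snd x, fst x - snd x)"

definition units :: "point set" where
  "units = {(1, 0), (0, 1), (- 1, - 1)}"

text \<open>The residue modulo 1 - \<omega>, with values in the field of three elements. Every step
  of a positively oriented curve raises it by one.\<close>

definition cls :: "point \<Rightarrow> int" where
  "cls x = (fst x + snd x) mod 3"

text \<open>Multiplication by 2 + \<omega> or 1 - \<omega>: the total displacement, relative to the
  initial direction, of three steps separated by the turns \<open>l\<close> and
  \<open>\<not> l\<close>. Both numbers have norm 3 and generate the ideal of class 0.\<close>

definition scale :: "bool \<Rightarrow> point \<Rightarrow> point" where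
  "scale l x = (if l then (2 * fst x - snd x, fst x + snd x) else (fst x + snd x, 2 * snd x - fst x))"

text \<open>Multiplication by the conjugate of the factor of \<open>scale l\<close>, followed by
  division by 3; exact on class 0.\<close>

definition unscale :: "bool \<Rightarrow> point \<Rightarrow> point" where
  "unscale l x = (if l then ((fst x + snd x) div 3, (2 * snd x - fst x) div 3)
     else ((2 * fst x - snd x) div 3, (fst x + snd x) div 3))"

text \<open>The sign forced at \<open>x\<close> by the first levels of a folding pattern whose undetermined class passes
  through 0.\<close>

fun level_sign :: "bool list \<Rightarrow> point \<Rightarrow> bool option" where
  "level_sign [] x = None"
| "level_sign (l # ls) x =
     (if cls x = 1 then Some l else if cls x = 2 then Some (\<not> l) else level_sign ls (unscale l x))"

lemma rot_rot_rot [simp]: "rot (rot (rot x)) = x"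
  by (simp add: rot_def prod_eq_iff)

lemma rot_rot: "rot (rot x) = - x - rot x"
  by (simp add: rot_def prod_eq_iff)

lemma rot_neq: "x \<in> units \<Longrightarrow> rot x \<noteq> x"
  by (auto simp: units_def rot_def)

lemma rot_units [simp]: "rot x \<in> units \<longleftrightarrow> x \<in> units"
  by (cases x) (auto simp: units_def rot_def)

lemma units_cases: "u \<in> units \<Longrightarrow> v \<in> units \<Longrightarrow> v = u \<or> v = rot u \<or> v = rot (rot u)"
  by (auto simp: units_def rot_def)

lemma rot_diff: "rot (x - y) = rot x - rot y"
  and rot_minus: "rot (- x) = - rot x"
  by (simp_all add: rot_def prod_eq_iff)

lemma cls_range: "cls x = 0 \<or> cls x = 1 \<or> cls x = 2"
  unfolding cls_def by presburger

lemma cls_unit [simp]: "u \<in> units \<Longrightarrow> cls u = 1"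
  by (auto simp: units_def cls_def)

lemma cls_add: "cls (x + y) = (cls x + cls y) mod 3"
  unfolding cls_def by (simp add: mod_simps) (simp add: algebra_simps)

lemma cls_diff: "cls (x - y) = (cls x - cls y) mod 3"
  unfolding cls_def by (simp add: mod_simps) (simp add: algebra_simps)

lemma cls_minus: "cls (- x) = (- cls x) mod 3"
  using cls_diff[of 0 x] by (simp add: cls_def)

lemma cls_zero [simp]: "cls 0 = 0"
  by (simp add: cls_def)

lemma cls_mod [simp]: "cls x mod 3 = cls x"
  by (simp add: cls_def)

lemma cls_scale [simp]: "cls (scale l x) = 0"
  unfolding cls_def scale_def by (cases l; simp; presburger)

lemma scale_add: "scale l (x + y) = scale l x + scale l y"
  and scale_diff: "scale l (x - y) = scale l x - scale l y"
  and scale_minus: "scale l (- x) = - scale l x"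
  by (simp_all add: scale_def prod_eq_iff)

lemma unscale_scale [simp]: "unscale l (scale l x) = x"
  by (auto simp: scale_def unscale_def prod_eq_iff)

lemma scale_unscale: "cls x = 0 \<Longrightarrow> scale l (unscale l x) = x"
proof -
  assume "cls x = 0"
  then obtain k where k: "snd x = 3 * k - fst x" unfolding cls_def
    by (metis add_diff_cancel_left' mod_0_imp_dvd dvdE)
  have *: "fst x + snd x = 3 * k" "2 * snd x - fst x = 3 * (2 * k - fst x)"
     "2 * fst x - snd x = 3 * (fst x - k)" using k by auto
  show ?thesis
    unfolding scale_def unscale_def * by (auto simp: prod_eq_iff k)
qed

lemma unscale_diff: "cls x = 0 \<Longrightarrow> cls y = 0 \<Longrightarrow> unscale l (x - y) = unscale l x - unscale l y"
  by (metis scale_diff scale_unscale unscale_scale)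

lemma scale_unit:
  "scale True u = u + u + rot u" "scale False u = u - rot u"
  by (simp_all add: scale_def rot_def prod_eq_iff)

lemma level_sign_Cons_scale [simp]: "level_sign (l # ls) (scale l x) = level_sign ls x"
  by simp

text \<open>The paperfolding law for two-sided sequences: the letters at the parity of
  \<open>p\<close> alternate, the others form such a sequence again.\<close>

fun fold_law :: "nat \<Rightarrow> int \<Rightarrow> (int \<Rightarrow> bool) \<Rightarrow> bool" where
  "fold_law 0 p w = True"
| "fold_law (Suc n) p w =
     ((\<forall>i. w (p + 2 * i + 2) \<noteq> w (p + 2 * i)) \<and> (\<exists>q. fold_law n q (\<lambda>i. w (p + 2 * i + 1))))"

lemma evens_map_upt: "evens (map f [0..<m]) = map (\<lambda>i. f (2 * i)) [0..<(m + 1) div 2]"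
proof (induction m arbitrary: f rule: less_induct)
  case (less m)
  consider "m = 0" | "m = 1" | k where "m = Suc (Suc k)"
    by (metis One_nat_def not0_implies_Suc)
  then show ?case
  proof cases
    case (3 k)
    have "map f [0..<m] = f 0 # f 1 # map (\<lambda>i. f (Suc (Suc i))) [0..<k]"
      by (simp add: 3 map_upt_Suc del: upt_Suc)
    moreover have "evens (map (\<lambda>i. f (Suc (Suc i))) [0..<k]) = map (\<lambda>i. f (Suc (Suc (2 * i)))) [0..<(k + 1) div 2]"
      using less[of k "\<lambda>i. f (Suc (Suc i))"] 3 by simp
    moreover have "(m + 1) div 2 = Suc ((k + 1) div 2)" by (simp add: 3)
    ultimately show ?thesis
      by (simp add: map_upt_Suc del: upt_Suc)
  qed auto
qed

lemma odds_map_upt: "odds (map f [0..<m]) = map (\<lambda>i. f (2 * i + 1)) [0..<m div 2]"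
proof (cases m)
  case (Suc k)
  then have "odds (map f [0..<m]) = evens (map (\<lambda>i. f (Suc i)) [0..<k])"
    by (simp add: odds_def map_upt_Suc del: upt_Suc)
  then show ?thesis by (simp add: evens_map_upt Suc)
qed (simp add: odds_def)

lemma successively_map_upt:
  "(\<And>i. Suc i < m \<Longrightarrow> P (f i) (f (Suc i))) \<Longrightarrow> successively P (map f [0..<m])"
  by (auto simp: successively_conv_nth)

text \<open>The flag of a window tells whether its first position has the parity of
  \<open>p\<close>.\<close>

lemma fold_law_word:
  "fold_law n p w \<Longrightarrow> fold_word_ok n (even (p - a)) (map (\<lambda>i. w (a + int i)) [0..<m])"
proof (induction n arbitrary: p w a m)
  case (Suc n)
  obtain q where alt: "\<And>i. w (p + 2 * i + 2) \<noteq> w (p + 2 * i)"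
    and q: "fold_law n q (\<lambda>i. w (p + 2 * i + 1))" using Suc.prems unfolding fold_law.simps by blast
  have alt': "w (p + 2 * i) \<noteq> w (p + 2 * i + 2)" for i
    using alt[of i] by simp
  show ?case
  proof (cases "even (p - a)")
    case True
    define k where "k = (a - p) div 2"
    have k: "a = p + 2 * k" using True unfolding k_def by presburger
    have "successively (\<noteq>) (evens (map (\<lambda>i. w (a + int i)) [0..<m]))"
      unfolding evens_map_upt
      by (rule successively_map_upt) (use alt'[of "k + int i" for i] in \<open>simp add: k algebra_simps\<close>)
    moreover have "odds (map (\<lambda>i. w (a + int i)) [0..<m]) = map (\<lambda>i. w (p + 2 * (k + int i) + 1)) [0..<m div 2]"
      unfolding odds_map_upt by (simp add: k algebra_simps)
    moreover have "fold_word_ok n (even (q - k)) (map (\<lambda>i. w (p + 2 * (k + int i) + 1)) [0..<m div 2])"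
      using Suc.IH[OF q, of k "m div 2"] by simp
    ultimately show ?thesis using True by (cases "even (q - k)") (simp_all add: Let_def)
  next
    case False
    define k where "k = (a - p) div 2"
    have k: "a = p + 2 * k + 1" using False unfolding k_def by presburger
    have "successively (\<noteq>) (odds (map (\<lambda>i. w (a + int i)) [0..<m]))"
      unfolding odds_map_upt
      by (rule successively_map_upt) (use alt'[of "k + 1 + int i" for i] in \<open>simp add: k algebra_simps\<close>)
    moreover have "evens (map (\<lambda>i. w (a + int i)) [0..<m]) = map (\<lambda>i. w (p + 2 * (k + int i) + 1)) [0..<(m + 1) div 2]"
      unfolding evens_map_upt by (simp add: k algebra_simps)
    moreover have "fold_word_ok n (even (q - k)) (map (\<lambda>i. w (p + 2 * (k + int i) + 1)) [0..<(m + 1) div 2])"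
      using Suc.IH[OF q, of k "(m + 1) div 2"] by simp
    ultimately show ?thesis using False by (cases "even (q - k)") (simp_all add: Let_def)
  qed
qed simp

text \<open>The walk along the boundary of a region, stated without coverings: \<open>u\<close> is
  the direction of the dart and \<open>l\<close> its label. The two alternatives are the two
  possible places of the other negative corner of a triangle.\<close>

definition zigzag :: "(int \<Rightarrow> point) \<Rightarrow> (int \<Rightarrow> point) \<Rightarrow> (int \<Rightarrow> bool) \<Rightarrow> bool" where
  "zigzag v u l \<longleftrightarrow> (\<forall>i. u i \<in> units \<and>
     (v (i + 1) = v i + rot (u i) \<and> u (i + 1) = (if l (i + 1) then rot (rot (u i)) else u i) \<or>
      v (i + 1) = v i - u i \<and> u (i + 1) = (if l (i + 1) then u i else rot (u i))))"

text \<open>The walk avoids the sign \<open>True\<close>, so only class 0 and one further class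
  \<open>N\<close> occur, and they alternate because every step changes the class by one. Two steps
  between consecutive vertices of class 0 are one step of a zigzag on the sublattice, and the label
  at the vertex skipped tells which alternative that step takes. By the next sign of the list these
  alternatives alternate, hence so do the skipped labels; this is why \<open>n\<close> levels take
  \<open>Suc n\<close> signs.\<close>

lemma zigzag_law:
  assumes "zigzag v u l" "length ls = Suc n" "\<And>i. level_sign ls (v i - b) \<noteq> Some True"
    "cls (v p - b) \<noteq> 0"
  shows "fold_law n p l"
  using assms
proof (induction n arbitrary: v u l ls b p)
  case 0
  show ?case by (simp only: fold_law.simps)
next
  case (Suc n)
  obtain l0 ls' where ls: "ls = l0 # ls'" and len: "length ls' = Suc n"
    using Suc.prems(2) by (cases ls) auto
  obtain l1 ls'' where ls': "ls' = l1 # ls''" using len by (cases ls') auto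
  have u: "u i \<in> units" for i using Suc.prems(1) by (simp add: zigzag_def)
  have step: "v (i + 1) = v i + rot (u i) \<and> u (i + 1) = (if l (i + 1) then rot (rot (u i)) else u i) \<or>
      v (i + 1) = v i - u i \<and> u (i + 1) = (if l (i + 1) then u i else rot (u i))" for i
    using Suc.prems(1) unfolding zigzag_def by blast
  define c where "c = (\<lambda>i. cls (v i - b))"
  define N :: int where "N = (if l0 then 2 else 1)"
  have c_range: "c i = 0 \<or> c i = N" for i
    using Suc.prems(3)[of i] cls_range[of "v i - b"] by (auto simp: c_def N_def ls split: if_splits)
  have c_step: "c (i + 1) = (c i + 1) mod 3 \<and> v (i + 1) = v i + rot (u i) \<and>
        u (i + 1) = (if l (i + 1) then rot (rot (u i)) else u i) \<or>
      c (i + 1) = (c i - 1) mod 3 \<and> v (i + 1) = v i - u i \<and>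
        u (i + 1) = (if l (i + 1) then u i else rot (u i))" for i
  proof -
    have "cls (v i + rot (u i) - b) = (c i + 1) mod 3" "cls (v i - u i - b) = (c i - 1) mod 3"
      using u[of i] cls_add[of "v i - b" "rot (u i)"] cls_diff[of "v i - b" "u i"]
      by (simp_all add: c_def algebra_simps)
    then show ?thesis using step[of i] unfolding c_def by metis
  qed
  have c_alt: "c (i + 1) = 0 \<longleftrightarrow> c i \<noteq> 0" for i
  proof -
    have "c (i + 1) = (c i + 1) mod 3 \<or> c (i + 1) = (c i - 1) mod 3" using c_step[of i] by blast
    then show ?thesis using c_range[of i] c_range[of "i + 1"]
      by (elim disjE) (simp_all add: N_def split: if_splits)
  qed
  have c_par: "c (p + 2 * i) \<noteq> 0" for i
  proof (induction i rule: int_induct[where k = 0])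
    case base
    then show ?case using Suc.prems(4) by (simp add: c_def)
  next
    case (step1 i)
    then show ?case using c_alt[of "p + 2 * i"] c_alt[of "p + 2 * i + 1"] by (simp add: algebra_simps)
  next
    case (step2 i)
    then show ?case using c_alt[of "p + 2 * i - 1"] c_alt[of "p + 2 * i - 2"] by (simp add: algebra_simps)
  qed
  have cB: "c (p + 2 * i + 1) = 0" for i using c_alt[of "p + 2 * i"] c_par[of i] by simp
  have cN: "c (p + 2 * i) = N" for i using c_par[of i] c_range[of "p + 2 * i"] by simp
  define v' where "v' = (\<lambda>i. unscale l0 (v (p + 2 * i + 1) - b))"
  define u' where "u' = (\<lambda>i. u (p + 2 * i + 1))"
  define l' where "l' = (\<lambda>i. l (p + 2 * i + 1))"
  have sv': "v (p + 2 * i + 1) - b = scale l0 (v' i)" for i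
    unfolding v'_def by (rule scale_unscale[symmetric]) (use cB[of i] in \<open>simp add: c_def\<close>)
  \<comment> \<open>From one vertex of class 0 to the next: the label in between decides whether the
    displacement is the scaled \<open>rot u\<close> or the scaled \<open>- u\<close>.\<close>
  have two: "(l (p + 2 * i + 2) \<and> v (p + 2 * i + 3) = v (p + 2 * i + 1) + scale l0 (rot (u' i)) \<and>
        u' (i + 1) = (if l' (i + 1) then rot (rot (u' i)) else u' i)) \<or>
      (\<not> l (p + 2 * i + 2) \<and> v (p + 2 * i + 3) = v (p + 2 * i + 1) - scale l0 (u' i) \<and>
        u' (i + 1) = (if l' (i + 1) then u' i else rot (u' i)))" for i
  proof -
    define q where "q = p + 2 * i + 1"
    have q: "p + 2 * i + 2 = q + 1" "p + 2 * i + 3 = q + 2" "p + 2 * (i + 1) + 1 = q + 2"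
      by (simp_all add: q_def)
    have cq: "c q = 0" "c (q + 1) = N" "c (q + 2) = 0"
      using cB[of i] cN[of "i + 1"] cB[of "i + 1"] by (simp_all add: q_def algebra_simps)
    have q2: "q + 1 + 1 = q + 2" by simp
    show ?thesis
    proof (cases l0)
      case True
      then have "v (q + 1) = v q - u q" "u (q + 1) = (if l (q + 1) then u q else rot (u q))"
        "v (q + 2) = v (q + 1) + rot (u (q + 1))"
        "u (q + 2) = (if l (q + 2) then rot (rot (u (q + 1))) else u (q + 1))"
        using c_step[of q] c_step[of "q + 1"] unfolding q2 cq by (auto simp: N_def)
      then show ?thesis
        unfolding u'_def l'_def q q_def[symmetric] using True
        by (cases "l (q + 1)") (simp_all add: scale_unit, simp_all add: rot_rot)
    next
      case False
      then have "v (q + 1) = v q + rot (u q)" "u (q + 1) = (if l (q + 1) then rot (rot (u q)) else u q)"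
        "v (q + 2) = v (q + 1) - u (q + 1)"
        "u (q + 2) = (if l (q + 2) then u (q + 1) else rot (u (q + 1)))"
        using c_step[of q] c_step[of "q + 1"] unfolding q2 cq by (auto simp: N_def)
      then show ?thesis
        unfolding u'_def l'_def q q_def[symmetric] using False
        by (cases "l (q + 1)") (simp_all add: scale_unit)
    qed
  qed
  have *: "v' (i + 1) = v' i + y" if "v (p + 2 * i + 3) = v (p + 2 * i + 1) + scale l0 y" for i y
  proof -
    have "scale l0 (v' (i + 1)) = scale l0 (v' i + y)"
      using that sv'[of i] sv'[of "i + 1"] by (simp add: scale_add algebra_simps)
    then show ?thesis by (metis unscale_scale)
  qed
  have dstep: "(l (p + 2 * i + 2) \<and> v' (i + 1) = v' i + rot (u' i) \<and>
        u' (i + 1) = (if l' (i + 1) then rot (rot (u' i)) else u' i)) \<or>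
      (\<not> l (p + 2 * i + 2) \<and> v' (i + 1) = v' i - u' i \<and>
        u' (i + 1) = (if l' (i + 1) then u' i else rot (u' i)))" for i
    using two[of i] *[of i "rot (u' i)"] *[of i "- u' i"] by (auto simp: scale_minus)
  have zz: "zigzag v' u' l'"
    unfolding zigzag_def using dstep u u'_def by blast
  have av: "level_sign ls' (v' i - 0) \<noteq> Some True" for i
    using Suc.prems(3)[of "p + 2 * i + 1"] cB[of i] by (simp add: ls sv' c_def)
  define c' where "c' = (\<lambda>i. cls (v' i))"
  define N' :: int where "N' = (if l1 then 2 else 1)"
  have c'_range: "c' i = 0 \<or> c' i = N'" for i
    using av[of i] cls_range[of "v' i"] by (auto simp: c'_def N'_def ls' split: if_splits)
  have u'u: "u' i \<in> units" for i using u by (simp add: u'_def)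
  have c'_step: "l (p + 2 * i + 2) \<and> c' (i + 1) = (c' i + 1) mod 3 \<or>
      \<not> l (p + 2 * i + 2) \<and> c' (i + 1) = (c' i - 1) mod 3" for i
    using dstep[of i] u'u[of i] cls_add[of "v' i" "rot (u' i)"] cls_diff[of "v' i" "u' i"]
    by (auto simp: c'_def)
  \<comment> \<open>Two sublattice steps of the same kind would meet three classes, but only 0 and
    \<open>N'\<close> occur.\<close>
  have alt': "l (p + 2 * i + 4) \<noteq> l (p + 2 * i + 2)" for i
  proof -
    have e: "p + 2 * (i + 1) + 2 = p + 2 * i + 4" "i + 1 + 1 = i + 2" by simp_all
    have N': "N' = 1 \<or> N' = 2" by (simp add: N'_def)
    note s = c'_step[of i] c'_step[of "i + 1", unfolded e]
    show ?thesis
    proof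
      assume eq: "l (p + 2 * i + 4) = l (p + 2 * i + 2)"
      show False
        using N' c'_range[of i] c'_range[of "i + 1"] c'_range[of "i + 2"] s eq
        by (cases "l (p + 2 * i + 2)") (elim disjE; simp)+
    qed
  qed
  have alt: "l (p + 2 * i + 2) \<noteq> l (p + 2 * i)" for i
    using alt'[of "i - 1"] by (simp add: algebra_simps)
  obtain q where q: "cls (v' q - 0) \<noteq> 0"
  proof -
    have "c' 0 \<noteq> 0 \<or> c' 1 \<noteq> 0"
      using c'_step[of 0] by (cases "c' 0 = 0") auto
    then show ?thesis using that unfolding c'_def by fastforce
  qed
  have "fold_law n q l'"
    by (rule Suc.IH[OF zz len av q])
  then have "\<exists>q. fold_law n q (\<lambda>i. l (p + 2 * i + 1))"
    unfolding l'_def by (rule exI)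
  then show ?case
    using alt by (simp only: fold_law.simps simp_thms)
qed

section \<open>All curves of a covering have the same type\<close>

text \<open>The passage of a curve through \<open>v\<close> is denoted by its incoming direction \<open>u\<close>. A type records the
  base point and the signs of the first levels of the curve.\<close>

definition new_dir :: "(point \<Rightarrow> bool) \<Rightarrow> point \<Rightarrow> point \<Rightarrow> point" where
  "new_dir \<sigma> v u = (if \<sigma> v then rot u else rot (rot u))"

text \<open>Passages are compared by type only, not by the curve they lie on. \<open>ty_sign\<close>
  merely forbids contradictions: vertices left open by the listed levels may have either
  sign.\<close>

locale typed_covering =
  fixes \<sigma> :: "point \<Rightarrow> bool" and ty :: "point \<Rightarrow> point \<Rightarrow> point \<times> bool list" and n :: nat
  assumes ty_step: "u \<in> units \<Longrightarrow> ty (v + new_dir \<sigma> v u) (new_dir \<sigma> v u) = ty v u"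
    and ty_sign: "u \<in> units \<Longrightarrow> level_sign (snd (ty v u)) (v - fst (ty v u)) \<noteq> Some (\<not> \<sigma> v)"
    and ty_len: "u \<in> units \<Longrightarrow> length (snd (ty v u)) = Suc n"
begin

lemma ty_plus: "u \<in> units \<Longrightarrow> \<sigma> v \<Longrightarrow> ty (v + rot u) (rot u) = ty v u"
  and ty_minus: "u \<in> units \<Longrightarrow> \<not> \<sigma> v \<Longrightarrow> ty (v + rot (rot u)) (rot (rot u)) = ty v u"
  using ty_step[of u v] by (simp_all add: new_dir_def)

lemma ty_cls:
  assumes "u \<in> units"
  shows "cls (v - fst (ty v u)) = 1 \<Longrightarrow> \<sigma> v = hd (snd (ty v u))"
    and "cls (v - fst (ty v u)) = 2 \<Longrightarrow> \<sigma> v = (\<not> hd (snd (ty v u)))"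
  using ty_sign[OF assms, of v] ty_len[OF assms, of v]
  by (cases "snd (ty v u)"; auto)+

text \<open>Whatever the base point of \<open>t\<close>, one of the vertices has relative class 1
  and another has relative class 2, where the type forces opposite signs.\<close>

lemma not_all_same:
  assumes u: "u0 \<in> units" "u1 \<in> units" "u2 \<in> units"
    and ty: "ty v0 u0 = t" "ty v1 u1 = t" "ty v2 u2 = t"
    and cls: "cls v0 \<noteq> cls v1" "cls v1 \<noteq> cls v2" "cls v2 \<noteq> cls v0"
  shows "\<not> (\<sigma> v0 = s \<and> \<sigma> v1 = s \<and> \<sigma> v2 = s)"
proof -
  define c where "c = (\<lambda>v. cls (v - fst t))"
  have neq: "c v \<noteq> c w" if "cls v \<noteq> cls w" for v w
    using that cls_add[of "v - fst t" "fst t"] cls_add[of "w - fst t" "fst t"] by (auto simp: c_def)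
  have r: "c v = 0 \<or> c v = 1 \<or> c v = 2" for v using cls_range by (simp add: c_def)
  have s: "c v = 1 \<Longrightarrow> \<sigma> v = hd (snd t)" "c v = 2 \<Longrightarrow> \<sigma> v = (\<not> hd (snd t))"
    if "u \<in> units" "ty v u = t" for v u
    using ty_cls[OF that(1), of v] that by (auto simp: c_def)
  show ?thesis
    using neq[OF cls(1)] neq[OF cls(2)] neq[OF cls(3)] r[of v0] r[of v1] r[of v2]
      s[OF u(1) ty(1)] s[OF u(2) ty(2)] s[OF u(3) ty(3)]
    by (elim disjE) auto
qed

text \<open>The three passages at a vertex of the triangle with three negative corners leave no sign for
  the two neighbouring vertices of that passage which does not touch the triangle.\<close>

lemma no_negative_triangle:
  assumes u: "u \<in> units" and neg: "\<not> \<sigma> v" "\<not> \<sigma> (v + rot u)" "\<not> \<sigma> (v - u)"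
  shows False
proof -
  define w where "w = rot u"
  define p where "p = v + w"
  define q where "q = v - u"
  have w: "w \<in> units" using u by (simp add: w_def)
  have rw: "rot (rot w) = u" by (simp add: w_def)
  have ruw: "rot u = w" by (simp add: w_def)
  have rr: "rot w = - u - w" using rot_rot[of u] by (simp add: w_def)
  have s: "\<not> \<sigma> v" "\<not> \<sigma> p" "\<not> \<sigma> q" using neg by (auto simp: p_def q_def w_def)
  have U: "rot w \<in> units" using w by simp
  \<comment> \<open>\<open>A\<close> and \<open>B\<close> are the types of the sides from
    \<open>v\<close> to \<open>p\<close> and from \<open>p\<close> to \<open>q\<close>;
    \<open>F\<close> is the type of the third passage at \<open>p\<close>.\<close>
  define A where "A = ty p w"
  define B where "B = ty p u"
  define F where "F = ty p (rot w)"
  have A0: "ty v (rot w) = A"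
    using ty_minus[OF U s(1)] by (simp add: A_def rw p_def ruw)
  have B2: "ty q (rot w) = B"
    using ty_minus[OF u s(2)] by (simp add: B_def ruw) (simp add: p_def q_def rr algebra_simps)
  define y where "y = p + u"
  define z where "z = p - rot w"
  have Ay: "ty y u = A"
    using ty_minus[OF w s(2)] by (simp add: A_def y_def rw)
  have cl: "cls p = (cls v + 1) mod 3" "cls q = (cls v - 1) mod 3" "cls y = (cls v + 2) mod 3"
    "cls z = cls v" "cls (p - u) = cls v"
    using u w U by (simp_all add: p_def q_def y_def z_def cls_add cls_diff mod_simps add.commute)
  have d: "cls v \<noteq> cls p" "cls p \<noteq> cls y" "cls y \<noteq> cls v" "cls p \<noteq> cls q" "cls q \<noteq> cls v"
    "cls p \<noteq> cls z" "cls z \<noteq> cls y" "cls z \<noteq> cls q"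
    using cls_range[of v] unfolding cl by auto
  \<comment> \<open>Type \<open>A\<close> visits \<open>v\<close>, \<open>p\<close> and
    \<open>y\<close>, which have three different classes.\<close>
  have yp: "\<sigma> y"
    using not_all_same[OF U w u A0 A_def[symmetric] Ay d(1-3), of False] s by auto
  define z' where "z' = p - u"
  define y' where "y' = p + w"
  have Az: "ty z w = A"
    using ty_plus[OF u yp] Ay by (simp add: ruw y_def z_def rr algebra_simps)
  have z'p: "\<sigma> z'"
  proof (rule ccontr)
    assume neg': "\<not> \<sigma> z'"
    have "ty z' w = B"
      using ty_minus[OF w neg'] by (simp add: B_def z'_def rw)
    from not_all_same[OF u U w B_def[symmetric] B2 this, of False] show False
      using s neg' d cl by (simp add: z'_def)
  qed
  have Bz': "ty z' (rot w) = B"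
    using ty_plus[OF U z'p] by (simp add: B_def z'_def rw)
  have Fy': "ty y' w = F"
    using ty_minus[OF U s(2)] by (simp add: F_def y'_def)
  have y'z': "y' + rot w = z'" by (simp add: y'_def z'_def rr)
  have "cls y' = (cls p + 1) mod 3" using w by (simp add: y'_def cls_add)
  then have cy': "cls y' = cls q" using cl(1,2) cls_range[of v] by auto
  have FB: "F = B" if "\<sigma> y'"
    using ty_plus[OF w that] Fy' Bz' by (simp add: y'z')
  \<comment> \<open>\<open>z\<close> and \<open>y'\<close> are the neighbours of \<open>p\<close> on
    the third passage. A positive \<open>z\<close> gives \<open>F = A\<close>, a negative one gives
    \<open>F\<close> a negative vertex of the class of \<open>v\<close>. Either way
    \<open>y'\<close> has to be positive, which yields \<open>F = B\<close> and leaves three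
    negative vertices of different classes on one type.\<close>
  show False
  proof (cases "\<sigma> z")
    case True
    have "ty p (rot w) = A" using ty_plus[OF w True] Az by (simp add: z_def)
    then have FA: "F = A" by (simp add: F_def)
    have "\<sigma> y'"
      using not_all_same[OF U w w A0 A_def[symmetric] Fy'[unfolded FA], of False] s d cy' by auto
    then have "A = B" using FB FA by simp
    with not_all_same[OF U w U A0 A_def[symmetric] B2[folded \<open>A = B\<close>], of False] s d show False
      by auto
  next
    case False
    have Fz: "ty z u = F"
      using ty_minus[OF u False] by (simp add: F_def z_def ruw)
    have "\<sigma> y'"
      using not_all_same[OF u U w Fz F_def[symmetric] Fy', of False] s False d cy' by auto
    then have "F = B" by (rule FB)
    with not_all_same[OF u U U Fz F_def[symmetric], of q False] B2 s False d show False
      by auto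
  qed
qed

text \<open>A dart is a contact of two passages of different types at a negative vertex; its opposite is the
  same contact at the other end of the common edge. \<open>label\<close> records whether the third passage at the
  vertex differs in type from the passage along whose side we walk.\<close>

definition darts :: "(point \<times> point) set" where
  "darts = {(v, u). u \<in> units \<and> \<not> \<sigma> v \<and> ty v (rot (rot u)) \<noteq> ty v u}"

definition opposite :: "point \<times> point \<Rightarrow> point \<times> point" where
  "opposite d = (let v = fst d; u = snd d in
     if \<not> \<sigma> (v + rot u) then (v + rot u, rot u) else (v - u, rot (rot u)))"

text \<open>The region walked along is that of the passage \<open>rot (rot u)\<close>. At the far
  vertex its next contact is with the third passage if that has another type; otherwise the region
  extends over the third passage and the contact comes behind it.\<close>

definition face_succ :: "point \<times> point \<Rightarrow> point \<times> point" where
  "face_succ d = (let v = fst (opposite d); u = snd (opposite d) in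
     if ty v (rot u) \<noteq> ty (fst d) (rot (rot (snd d))) then (v, rot u) else (v, rot (rot u)))"

definition face_pred :: "point \<times> point \<Rightarrow> point \<times> point" where
  "face_pred d = (let v = fst d; u = snd d in
     opposite (v, if ty v (rot u) \<noteq> ty v (rot (rot u)) then rot (rot u) else rot u))"

definition label :: "point \<times> point \<Rightarrow> bool" where
  "label d \<longleftrightarrow> ty (fst d) (rot (snd d)) \<noteq> ty (fst d) (rot (rot (snd d)))"

text \<open>The flag of the search: the vertex lies outside the coset selected by the region walked
  along.\<close>

definition off_grid :: "point \<times> point \<Rightarrow> bool" where
  "off_grid d \<longleftrightarrow> cls (fst d - fst (ty (fst d) (rot (rot (snd d))))) \<noteq> 0"

text \<open>If the other two corners of the triangle were both positive, one curve would run along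
  all three sides and there would be no contact; both negative is excluded by
  \<open>no_negative_triangle\<close>. So exactly one is negative, and the two sides meeting at the
  positive corner share their type.\<close>

lemma opposite_cases:
  assumes "(v, u) \<in> darts"
  shows "\<not> \<sigma> (v + rot u) \<and> \<sigma> (v - u) \<and> opposite (v, u) = (v + rot u, rot u) \<and>
      ty (v + rot u) (rot u) = ty v (rot (rot u)) \<and> ty (v + rot u) u = ty v u \<or>
    \<sigma> (v + rot u) \<and> \<not> \<sigma> (v - u) \<and> opposite (v, u) = (v - u, rot (rot u)) \<and>
      ty (v - u) (rot (rot u)) = ty v (rot (rot u)) \<and> ty (v - u) (rot u) = ty v u"
proof -
  have u: "u \<in> units" "rot u \<in> units" "rot (rot u) \<in> units"
    and neg: "\<not> \<sigma> v" and neq: "ty v (rot (rot u)) \<noteq> ty v u"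
    using assms by (auto simp: darts_def)
  have pq: "v + rot u + rot (rot u) = v - u" by (simp add: rot_rot)
  have A: "ty (v + rot u) (rot u) = ty v (rot (rot u))"
    using ty_minus[OF u(3) neg] by simp
  show ?thesis
  proof (cases "\<sigma> (v + rot u)")
    case False
    then have q: "\<sigma> (v - u)" using no_negative_triangle[OF u(1) neg] by blast
    have "ty (v - u) (rot (rot u)) = ty (v + rot u) u"
      using ty_minus[OF u(1) False] by (simp add: pq)
    moreover have "ty v u = ty (v - u) (rot (rot u))"
      using ty_plus[OF u(3) q] by simp
    ultimately show ?thesis using False q A by (simp add: opposite_def)
  next
    case True
    have A': "ty (v - u) (rot (rot u)) = ty v (rot (rot u))"
      using ty_plus[OF u(2) True] A by (simp add: pq)
    have q: "\<not> \<sigma> (v - u)"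
    proof
      assume "\<sigma> (v - u)"
      from ty_plus[OF u(3) this] A' neq show False by simp
    qed
    have "ty v u = ty (v - u) (rot u)"
      using ty_minus[OF u(2) q] by simp
    then show ?thesis using True q A' by (simp add: opposite_def)
  qed
qed

lemma opposite_spec:
  assumes "(v, u) \<in> darts" "opposite (v, u) = (v', u')"
  shows "u' \<in> units" "\<not> \<sigma> v'" "ty v' u' = ty v (rot (rot u))" "ty v' (rot (rot u')) = ty v u"
    "opposite (v', u') = (v, u)" "(v', u') \<in> darts"
proof -
  have u: "u \<in> units" and neg: "\<not> \<sigma> v" and neq: "ty v (rot (rot u)) \<noteq> ty v u"
    using assms by (auto simp: darts_def)
  have pq: "v + rot u + rot (rot u) = v - u" by (simp add: rot_rot)
  show *: "u' \<in> units" "\<not> \<sigma> v'" "ty v' u' = ty v (rot (rot u))" "ty v' (rot (rot u')) = ty v u"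
    using opposite_cases[OF assms(1)] assms(2) u by auto
  then show "(v', u') \<in> darts" using neq by (auto simp: darts_def)
  show "opposite (v', u') = (v, u)"
    using opposite_cases[OF assms(1)] assms(2) neg by (auto simp: opposite_def pq)
qed

lemma opposite_in: "d \<in> darts \<Longrightarrow> opposite d \<in> darts"
  using opposite_spec(6)[of "fst d" "snd d"] by (metis prod.collapse)

lemma opposite_opposite: "d \<in> darts \<Longrightarrow> opposite (opposite d) = d"
  using opposite_spec(5)[of "fst d" "snd d"] by (metis prod.collapse)

lemma face_succ_in:
  assumes "d \<in> darts"
  shows "face_succ d \<in> darts"
    and "ty (fst (face_succ d)) (rot (rot (snd (face_succ d)))) = ty (fst d) (rot (rot (snd d)))"
    and "fst (face_succ d) = fst (opposite d)"
proof -
  obtain v u where d: "d = (v, u)" by (cases d)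
  obtain v' u' where o: "opposite (v, u) = (v', u')" by (cases "opposite (v, u)")
  note s = opposite_spec[OF assms[unfolded d] o]
  have "ty v (rot (rot u)) \<noteq> ty v u" using assms by (simp add: d darts_def)
  then show "face_succ d \<in> darts"
    "ty (fst (face_succ d)) (rot (rot (snd (face_succ d)))) = ty (fst d) (rot (rot (snd d)))"
    "fst (face_succ d) = fst (opposite d)"
    using s by (auto simp: d face_succ_def o darts_def)
qed

lemma face_pred_in:
  assumes "d \<in> darts"
  shows "face_pred d \<in> darts" and "face_succ (face_pred d) = d"
proof -
  obtain v u where d: "d = (v, u)" by (cases d)
  define w where "w = (if ty v (rot u) \<noteq> ty v (rot (rot u)) then rot (rot u) else rot u)"
  have w: "(v, w) \<in> darts" "ty v w = ty v (rot (rot u))"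
    using assms by (auto simp: d darts_def w_def)
  have p: "face_pred d = opposite (v, w)" by (simp add: d face_pred_def w_def)
  then show "face_pred d \<in> darts" using opposite_in[OF w(1)] by simp
  obtain v' u' where o: "opposite (v, w) = (v', u')" by (cases "opposite (v, w)")
  show "face_succ (face_pred d) = d"
    using opposite_spec[OF w(1) o] w assms
    unfolding face_succ_def p o by (auto simp: d darts_def) (auto simp: w_def split: if_splits)
qed

lemma face_pred_succ:
  assumes "d \<in> darts"
  shows "face_pred (face_succ d) = d"
proof -
  obtain v u where d: "d = (v, u)" by (cases d)
  obtain v' u' where o: "opposite (v, u) = (v', u')" by (cases "opposite (v, u)")
  note s = opposite_spec[OF assms[unfolded d] o]
  show ?thesis
    using s assms by (auto simp: d face_succ_def face_pred_def o darts_def)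
qed

text \<open>At a negative vertex a type admits class 0 and only one other class, and the two ends of
  an edge differ by one in class.\<close>

lemma off_grid_succ:
  assumes "d \<in> darts"
  shows "off_grid (face_succ d) = (\<not> off_grid d)"
proof -
  obtain v u where d: "d = (v, u)" by (cases d)
  obtain v' u' where o: "opposite (v, u) = (v', u')" by (cases "opposite (v, u)")
  note s = opposite_spec[OF assms[unfolded d] o]
  have u: "u \<in> units" "\<not> \<sigma> v" using assms by (auto simp: d darts_def)
  define t where "t = ty v (rot (rot u))"
  have f: "off_grid d = (cls (v - fst t) \<noteq> 0)" by (simp add: off_grid_def d t_def)
  have f': "off_grid (face_succ d) = (cls (v' - fst t) \<noteq> 0)"
    using face_succ_in[OF assms] by (simp add: off_grid_def d t_def o)
  have r: "rot (rot u) \<in> units" using u by simp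
  have c: "cls (v - fst t) = 1 \<Longrightarrow> \<not> hd (snd t)" "cls (v - fst t) = 2 \<Longrightarrow> hd (snd t)"
    using ty_cls[OF r, of v] u by (auto simp: t_def)
  have c': "cls (v' - fst t) = 1 \<Longrightarrow> \<not> hd (snd t)" "cls (v' - fst t) = 2 \<Longrightarrow> hd (snd t)"
    using ty_cls[OF s(1), of v'] s by (auto simp: t_def)
  have "v' = v + rot u \<or> v' = v - u" using opposite_cases[OF assms[unfolded d]] o by auto
  moreover have "cls (v + rot u - fst t) = (cls (v - fst t) + 1) mod 3"
    "cls (v - u - fst t) = (cls (v - fst t) - 1) mod 3"
    using cls_add[of "v - fst t" "rot u"] cls_diff[of "v - fst t" u] u by (simp_all add: algebra_simps)
  ultimately show ?thesis
    unfolding f f' using c c' cls_range[of "v - fst t"] by (elim disjE) auto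
qed

lemma face_zigzag:
  assumes \<Phi>: "\<And>i. \<Phi> i \<in> darts" "\<And>i. \<Phi> (i + 1) = face_succ (\<Phi> i)"
  shows "zigzag (\<lambda>i. fst (\<Phi> i)) (\<lambda>i. snd (\<Phi> i)) (\<lambda>i. label (\<Phi> i))"
  unfolding zigzag_def
proof (intro allI conjI)
  fix i :: int
  obtain v u where e: "\<Phi> i = (v, u)" by (cases "\<Phi> i")
  have vu: "(v, u) \<in> darts" using \<Phi>(1)[of i] e by simp
  then show "snd (\<Phi> i) \<in> units" by (simp add: e darts_def)
  have "ty v u \<noteq> ty v (rot (rot u))" using vu by (auto simp: darts_def)
  then show "fst (\<Phi> (i + 1)) = fst (\<Phi> i) + rot (snd (\<Phi> i)) \<and>
         snd (\<Phi> (i + 1)) = (if label (\<Phi> (i + 1)) then rot (rot (snd (\<Phi> i))) else snd (\<Phi> i)) \<or>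
         fst (\<Phi> (i + 1)) = fst (\<Phi> i) - snd (\<Phi> i) \<and>
         snd (\<Phi> (i + 1)) = (if label (\<Phi> (i + 1)) then snd (\<Phi> i) else rot (snd (\<Phi> i)))"
    using opposite_cases[OF vu]
    by (auto simp: \<Phi>(2) e face_succ_def label_def Let_def)
qed

lemma orbit:
  assumes "d \<in> darts"
  obtains \<Phi> :: "int \<Rightarrow> point \<times> point"
  where "\<And>i. \<Phi> i \<in> darts" "\<And>i. \<Phi> (i + 1) = face_succ (\<Phi> i)" "\<And>i. \<Phi> (int i) = (face_succ ^^ i) d"
proof
  define \<Phi> where "\<Phi> = (\<lambda>i. if 0 \<le> i then (face_succ ^^ nat i) d else (face_pred ^^ nat (- i)) d)"
  have s: "(face_succ ^^ k) d \<in> darts" and p: "(face_pred ^^ k) d \<in> darts" for k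
    by (induction k) (auto simp: assms face_succ_in face_pred_in)
  show "\<Phi> i \<in> darts" for i by (simp add: \<Phi>_def s p)
  show "\<Phi> (int i) = (face_succ ^^ i) d" for i by (simp add: \<Phi>_def)
  show "\<Phi> (i + 1) = face_succ (\<Phi> i)" for i
  proof -
    consider k where "i = int k" | k where "i = - int (Suc k)"
      by (metis int_cases)
    then show ?thesis
    proof cases
      case (1 k)
      then show ?thesis by (simp add: \<Phi>_def nat_add_distrib)
    next
      case (2 k)
      have "nat (1 + int k) = Suc k" by simp
      then have "\<Phi> i = face_pred ((face_pred ^^ k) d)" by (simp add: \<Phi>_def 2 add.commute)
      then have "face_succ (\<Phi> i) = (face_pred ^^ k) d"
        using face_pred_in(2)[OF p[of k]] by simp
      moreover have "\<Phi> (i + 1) = (face_pred ^^ k) d"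
        by (cases k) (simp_all add: \<Phi>_def 2 nat_add_distrib)
      ultimately show ?thesis by simp
    qed
  qed
qed

lemma face_word:
  assumes d: "d \<in> darts"
  shows "fold_word_ok n (off_grid d) (map (\<lambda>i. label ((face_succ ^^ i) d)) [0..<m])"
proof -
  obtain \<Phi> :: "int \<Rightarrow> point \<times> point"
    where \<Phi>: "\<And>i. \<Phi> i \<in> darts" "\<And>i. \<Phi> (i + 1) = face_succ (\<Phi> i)" "\<And>i. \<Phi> (int i) = (face_succ ^^ i) d"
    using orbit[OF d] by blast
  define t where "t = ty (fst d) (rot (rot (snd d)))"
  have \<Phi>0: "\<Phi> 0 = d" using \<Phi>(3)[of 0] by simp
  have t: "ty (fst (\<Phi> i)) (rot (rot (snd (\<Phi> i)))) = t" for i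
  proof (induction i rule: int_induct[where k = 0])
    case base
    then show ?case by (simp add: \<Phi>0 t_def)
  next
    case (step1 i)
    then show ?case using face_succ_in(2)[OF \<Phi>(1)[of i]] by (simp add: \<Phi>(2))
  next
    case (step2 i)
    then show ?case using face_succ_in(2)[OF \<Phi>(1)[of "i - 1"]] \<Phi>(2)[of "i - 1"] by simp
  qed
  have u: "rot (rot (snd (\<Phi> i))) \<in> units" "\<not> \<sigma> (fst (\<Phi> i))" for i
    using \<Phi>(1)[of i] by (auto simp: darts_def case_prod_beta)
  have len: "length (snd t) = Suc n" using ty_len[OF u(1)[of 0], of "fst (\<Phi> 0)"] by (simp add: t)
  have av: "level_sign (snd t) (fst (\<Phi> i) - fst t) \<noteq> Some True" for i
    using ty_sign[OF u(1)[of i], of "fst (\<Phi> i)"] u(2)[of i] by (simp add: t)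
  have og: "off_grid (\<Phi> i) = (cls (fst (\<Phi> i) - fst t) \<noteq> 0)" for i
    by (simp add: off_grid_def t)
  \<comment> \<open>The first off-grid position of the walk, where the alternating letters
    start.\<close>
  define p :: int where "p = (if off_grid d then 0 else 1)"
  have "off_grid (\<Phi> p)"
    using off_grid_succ[OF d] \<Phi>(2)[of 0] by (simp add: p_def \<Phi>0)
  then have "fold_law n p (\<lambda>i. label (\<Phi> i))"
    using zigzag_law[OF face_zigzag[of \<Phi>, OF \<Phi>(1,2)] len av, of p] og by blast
  from fold_law_word[OF this, of 0 m] show ?thesis
    by (simp add: \<Phi>(3) p_def split: if_splits)
qed

text \<open>With \<open>A\<close> and \<open>B\<close> the types on the two sides and
  \<open>M\<close> the third type at the far vertex, the alternatives are \<open>M = A\<close>,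
  \<open>M = B\<close> and three different types.\<close>

lemma next_vertex:
  assumes "d \<in> darts"
  shows "\<not> label (face_succ d) \<and> label (opposite d) \<and> opposite (face_succ d) = face_pred (opposite d) \<or>
      label (face_succ d) \<and> \<not> label (opposite d) \<and> opposite (face_succ d) = face_pred (opposite d) \<or>
      label (face_succ d) \<and> label (opposite d) \<and>
        (\<exists>z\<in>darts. label z \<and> opposite (face_succ d) = face_pred z \<and> opposite z = face_pred (opposite d))"
proof -
  obtain v u where d: "d = (v, u)" by (cases d)
  obtain v' u' where o: "opposite (v, u) = (v', u')" by (cases "opposite (v, u)")
  note s = opposite_spec[OF assms[unfolded d] o]
  define A where "A = ty v' u'"
  define M where "M = ty v' (rot u')"
  define B where "B = ty v' (rot (rot u'))"
  have AB: "A \<noteq> B" using s(6) by (auto simp: darts_def A_def B_def)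
  have fs: "face_succ d = (if M \<noteq> A then (v', rot u') else (v', rot (rot u')))"
    using s(3) by (simp add: face_succ_def d o M_def A_def)
  have lab: "label (v', u') = (M \<noteq> B)" "label (v', rot u') = (B \<noteq> A)" "label (v', rot (rot u')) = (A \<noteq> M)"
    by (simp_all add: label_def A_def M_def B_def)
  have pred: "face_pred (v', u') = opposite (v', if M \<noteq> B then rot (rot u') else rot u')"
    "face_pred (v', rot (rot u')) = opposite (v', if A \<noteq> M then rot u' else u')"
    by (simp_all add: face_pred_def A_def M_def B_def)
  consider "M = A" | "M = B" | "M \<noteq> A" "M \<noteq> B" by blast
  then show ?thesis
  proof cases
    case 1
    then show ?thesis using AB by (simp add: d o fs[unfolded d] lab pred)
  next
    case 2
    then show ?thesis using AB by (simp add: d o fs[unfolded d] lab pred)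
  next
    case 3
    have "(v', rot (rot u')) \<in> darts"
      using s(1,2) 3 by (auto simp: darts_def M_def B_def)
    moreover have "label (v', rot (rot u'))" using 3 by (simp add: lab)
    moreover have "opposite (face_succ d) = face_pred (v', rot (rot u'))"
      "opposite (v', rot (rot u')) = face_pred (opposite d)"
      using 3 by (auto simp: d o fs[unfolded d] pred)
    moreover have "label (face_succ d)" "label (opposite d)"
      using 3 AB by (auto simp: d o fs[unfolded d] lab)
    ultimately show ?thesis by blast
  qed
qed

text \<open>Just what a descent by one level needs: the coset of the sublattice and the factor that
  defines it.\<close>

definition head :: "point \<Rightarrow> point \<Rightarrow> int \<times> bool" where
  "head v u = (cls (fst (ty v u)), hd (snd (ty v u)))"

text \<open>By \<open>flag_across\<close> both types are on their grids at the same end of the edge,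
  so their base points have the same class. At the other end both force a sign, which is negative,
  so their first signs agree.\<close>

lemma head_eq_across:
  assumes n: "n = 6" and d: "(v, u) \<in> darts"
  shows "head v (rot (rot u)) = head v u"
proof -
  interpret spine darts face_succ face_pred opposite label off_grid
    by unfold_locales
      (use n face_word next_vertex in \<open>auto simp: face_succ_in face_pred_in face_pred_succ opposite_in
         opposite_opposite off_grid_succ\<close>)
  define b where "b = face_succ (opposite (v, u))"
  obtain v' u' where o: "opposite (v, u) = (v', u')" by (cases "opposite (v, u)")
  note s = opposite_spec[OF d o]
  have b: "b \<in> darts" "opposite (v, u) = face_pred b"
    using s(6) by (simp_all add: b_def o face_succ_in face_pred_succ)
  have tyb: "ty (fst b) (rot (rot (snd b))) = ty v u" "fst b = v"
    using face_succ_in(2,3)[OF s(6)] s(4,5) by (simp_all add: b_def o)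
  define a where "a = fst (ty v (rot (rot u)))"
  define a' where "a' = fst (ty v u)"
  have fl: "cls (v - a) \<noteq> 0 \<longleftrightarrow> cls (v - a') \<noteq> 0"
    using flag_across[OF d b] tyb by (simp add: off_grid_def a_def a'_def)
  have f1: "cls (v' - a) \<noteq> 0 \<longleftrightarrow> cls (v - a) = 0"
    using off_grid_succ[OF d] face_succ_in(2,3)[OF d] by (simp add: off_grid_def o a_def)
  have f2: "cls (v' - a') \<noteq> 0 \<longleftrightarrow> cls (v - a') = 0"
    using off_grid_succ[OF s(6)] tyb s(4) by (simp add: off_grid_def b_def[symmetric] o[symmetric] a'_def)
      (auto simp: o)
  have eq: "cls a = cls a'" if "cls (w - a) = 0" "cls (w - a') = 0" for w
  proof -
    have "cls a = cls (w - (w - a))" "cls a' = cls (w - (w - a'))" by simp_all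
    with that show ?thesis unfolding cls_diff by simp
  qed
  have same: "cls a = cls a'" using fl f1 f2 eq[of v] eq[of v'] by blast
  then have same': "cls (w - a) = cls (w - a')" for w by (simp add: cls_diff)
  have u: "u \<in> units" "rot (rot u) \<in> units" "\<not> \<sigma> v" using d by (auto simp: darts_def)
  have r': "rot (rot u') \<in> units" using s(1) by simp
  have "hd (snd (ty v (rot (rot u)))) = hd (snd (ty v u))"
  proof (cases "cls (v - a) = 0")
    case True
    then have "cls (v' - a) = 1 \<or> cls (v' - a) = 2" using f1 cls_range by blast
    then show ?thesis
      using ty_cls[OF s(1), of v'] ty_cls[OF r', of v'] s(2) same'[of v'] unfolding s(3,4) a_def a'_def
      by auto
  next
    case False
    then have "cls (v - a) = 1 \<or> cls (v - a) = 2" using cls_range by blast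
    then show ?thesis
      using ty_cls[OF u(1), of v] ty_cls[OF u(2), of v] u(3) same'[of v] unfolding a_def a'_def
      by auto
  qed
  with same show ?thesis by (simp add: head_def a_def a'_def)
qed

lemma head_eq_negative:
  assumes n: "n = 6" and v: "\<not> \<sigma> v" and u: "u \<in> units" "w \<in> units"
  shows "head v u = head v w"
proof -
  have *: "head v (rot (rot x)) = head v x" if "x \<in> units" for x
    using head_eq_across[OF n, of v x] that v
    by (cases "ty v (rot (rot x)) = ty v x") (auto simp: darts_def head_def)
  have "head v (rot u) = head v u" using *[of "rot u"] u by simp
  moreover have "head v (rot (rot u)) = head v u" using *[of u] u by simp
  ultimately show ?thesis using units_cases[OF u] by auto
qed

end

text \<open>Complex conjugation exchanges the two signs.\<close>

definition mirror :: "point \<Rightarrow> point" where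
  "mirror x = (fst x - snd x, - snd x)"

lemma mirror_mirror [simp]: "mirror (mirror x) = x"
  by (simp add: mirror_def)

lemma mirror_add: "mirror (x + y) = mirror x + mirror y"
  and mirror_diff: "mirror (x - y) = mirror x - mirror y"
  by (simp_all add: mirror_def)

lemma mirror_rot: "mirror (rot x) = rot (rot (mirror x))"
  and mirror_units [simp]: "mirror x \<in> units \<longleftrightarrow> x \<in> units"
  by (cases x; auto simp: mirror_def rot_def units_def)+

lemma cls_mirror [simp]: "cls (mirror x) = cls x"
  unfolding cls_def mirror_def by simp presburger

lemma mirror_scale: "mirror (scale l x) = scale (\<not> l) (mirror x)"
  by (simp add: mirror_def scale_def)

lemma mirror_unscale: "cls x = 0 \<Longrightarrow> unscale (\<not> l) (mirror x) = mirror (unscale l x)"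
  by (metis mirror_scale scale_unscale unscale_scale)

lemma level_sign_mirror: "level_sign (map Not ls) (mirror x) = map_option Not (level_sign ls x)"
proof (induction ls arbitrary: x)
  case (Cons l ls)
  then show ?case using cls_range[of x] by (elim disjE) (simp_all add: mirror_unscale)
qed simp

lemma typed_covering_mirror:
  assumes "typed_covering \<sigma> ty n"
  shows "typed_covering (\<lambda>v. \<not> \<sigma> (mirror v))
    (\<lambda>v u. map_prod mirror (map Not) (ty (mirror v) (mirror u))) n"
proof -
  interpret typed_covering \<sigma> ty n by fact
  have dir: "mirror (new_dir (\<lambda>v. \<not> \<sigma> (mirror v)) v u) = new_dir \<sigma> (mirror v) (mirror u)" for v u
    by (simp add: new_dir_def mirror_rot)
  show ?thesis
  proof
    fix u v assume u: "u \<in> units"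
    let ?t = "ty (mirror v) (mirror u)"
    have "v - mirror (fst ?t) = mirror (mirror v - fst ?t)" by (simp add: mirror_diff)
    then show "level_sign (snd (map_prod mirror (map Not) ?t)) (v - fst (map_prod mirror (map Not) ?t)) \<noteq>
        Some (\<not> \<not> \<sigma> (mirror v))"
      using ty_sign[of "mirror u" "mirror v"] u by (auto simp: level_sign_mirror)
  qed (use ty_step ty_len in \<open>simp_all add: mirror_add dir\<close>)
qed

context typed_covering
begin

lemma head_eq:
  assumes n: "n = 6" and u: "u \<in> units" "w \<in> units"
  shows "head v u = head v w"
proof (cases "\<sigma> v")
  case True
  interpret m: typed_covering "\<lambda>v. \<not> \<sigma> (mirror v)" "\<lambda>v u. map_prod mirror (map Not) (ty (mirror v) (mirror u))" n
    by (rule typed_covering_mirror) unfold_locales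
  have ne: "snd (ty v u) \<noteq> []" if "u \<in> units" for u using ty_len[OF that, of v] by auto
  have "m.head (mirror v) (mirror u) = m.head (mirror v) (mirror w)"
    using True u by (intro m.head_eq_negative[OF n]) auto
  then show ?thesis
    using ne[OF u(1)] ne[OF u(2)] by (simp add: m.head_def head_def hd_map)
next
  case False
  then show ?thesis using head_eq_negative[OF n] u by blast
qed

lemma head_const:
  assumes n: "n = 6" and u: "u \<in> units" "w \<in> units"
  shows "head v u = head v' w"
proof -
  have e: "(1, 0) \<in> units" "(0, 1) \<in> units" by (auto simp: units_def)
  have step: "head (v + x) x = head v x" if x: "x \<in> units" for v x
  proof -
    \<comment> \<open>The passage at \<open>v\<close> that leaves in direction
      \<open>x\<close>.\<close>
    define y where "y = (if \<sigma> v then rot (rot x) else rot x)"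
    have y: "y \<in> units" "new_dir \<sigma> v y = x" using x by (auto simp: y_def new_dir_def)
    have "head (v + x) x = head v y" using ty_step[OF y(1), of v] y(2) by (simp add: head_def)
    then show ?thesis using head_eq[OF n y(1) x] by simp
  qed
  define h where "h = (\<lambda>v. head v (1, 0))"
  have h: "head v x = h v" if "x \<in> units" for v x
    using head_eq[OF n that e(1)] by (simp add: h_def)
  have s1: "h (v + (1, 0)) = h v" and s2: "h (v + (0, 1)) = h v" for v
    using step[OF e(1), of v] step[OF e(2), of v] e by (simp_all add: h)
  have h1: "h (a, b) = h (0, b)" for a b
  proof (induction a rule: int_induct[where k = 0])
    case (step1 i)
    then show ?case using s1[of "(i, b)"] by simp
  next
    case (step2 i)
    then show ?case using s1[of "(i - 1, b)"] by simp
  qed simp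
  have h2: "h (0, b) = h (0, 0)" for b
  proof (induction b rule: int_induct[where k = 0])
    case (step1 i)
    then show ?case using s2[of "(0, i)"] by simp
  next
    case (step2 i)
    then show ?case using s2[of "(0, i - 1)"] by simp
  qed simp
  have "h v = h v'" using h1[of "fst v" "snd v"] h1[of "fst v'" "snd v'"] h2[of "snd v"] h2[of "snd v'"] by simp
  then show ?thesis using h u by simp
qed

end

section \<open>Descent to the sublattice\<close>

lemma level_sign_take: "level_sign (take k ls) x = Some s \<Longrightarrow> level_sign ls x = Some s"
proof (induction ls arbitrary: x k)
  case (Cons l ls)
  then show ?case by (cases k) (auto split: if_splits)
qed simp

lemma typed_covering_take:
  assumes "typed_covering \<sigma> ty n" "m \<le> n"
  shows "typed_covering \<sigma> (\<lambda>v u. (fst (ty v u), take (Suc m) (snd (ty v u)))) m"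
proof -
  interpret typed_covering \<sigma> ty n by fact
  show ?thesis
  proof
    fix u v assume u: "u \<in> units"
    show "level_sign (snd (fst (ty v u), take (Suc m) (snd (ty v u)))) (v - fst (fst (ty v u), take (Suc m) (snd (ty v u))))
        \<noteq> Some (\<not> \<sigma> v)"
      using ty_sign[OF u, of v] level_sign_take[of "Suc m" "snd (ty v u)" "v - fst (ty v u)"] by auto
  qed (use ty_step ty_len assms(2) in auto)
qed

text \<open>Once coset and first sign are common to all types, three consecutive steps from the
  coset are a single step on the sublattice, and every type drops its first sign. The bound on
  \<open>n\<close> provides the seven signs that the search consumes.\<close>

lemma typed_covering_derived:
  assumes "typed_covering \<sigma> ty (Suc n)" "5 \<le> n"
  obtains r l ty' where "\<And>v. cls (v - r) = 1 \<Longrightarrow> \<sigma> v = l" "\<And>v. cls (v - r) = 2 \<Longrightarrow> \<sigma> v = (\<not> l)"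
    "typed_covering (\<lambda>w. \<sigma> (r + scale l w)) ty' n"
proof -
  interpret typed_covering \<sigma> ty "Suc n" by fact
  interpret t6: typed_covering \<sigma> "\<lambda>v u. (fst (ty v u), take 7 (snd (ty v u)))" 6
    using typed_covering_take[OF assms(1), of 6] assms(2) by simp
  define r where "r = fst (ty 0 (1, 0))"
  define l where "l = hd (snd (ty 0 (1, 0)))"
  have e: "(1, 0) \<in> units" by (simp add: units_def)
  have head: "cls (fst (ty v u)) = cls r" "hd (snd (ty v u)) = l" if "u \<in> units" for v u
    using t6.head_const[OF refl that e, of v 0] by (simp_all add: t6.head_def r_def l_def)
  have ls: "snd (ty v u) = l # tl (snd (ty v u))" if "u \<in> units" for v u
    using head(2)[OF that, of v] ty_len[OF that, of v] by (cases "snd (ty v u)") auto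
  have same: "cls (v - fst (ty w u)) = cls (v - r)" if "u \<in> units" for v w u
    using head(1)[OF that, of w] by (simp add: cls_diff)
  have s1: "\<sigma> v = l" if "cls (v - r) = 1" for v
    using ty_cls(1)[OF e, of v] head(2)[OF e, of v] same[OF e, of v v] that by simp
  have s2: "\<sigma> v = (\<not> l)" if "cls (v - r) = 2" for v
    using ty_cls(2)[OF e, of v] head(2)[OF e, of v] same[OF e, of v v] that by simp
  define ty' where "ty' = (\<lambda>w u. let t = ty (r + scale l w) u in (unscale l (fst t - r), tl (snd t)))"
  have "typed_covering (\<lambda>w. \<sigma> (r + scale l w)) ty' n"
  proof
    fix u w assume u: "u \<in> units"
    define v where "v = r + scale l w"
    define k where "k = new_dir \<sigma> v u"
    \<comment> \<open>After \<open>k\<close> the curve turns by \<open>l\<close> at class 1 and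
      oppositely at class 2, so its next three directions are \<open>k\<close>, \<open>k'\<close>,
      \<open>k\<close>.\<close>
    define k' where "k' = (if l then rot k else rot (rot k))"
    have k: "k \<in> units" "k' \<in> units" using u by (simp_all add: k_def k'_def new_dir_def)
    have c: "cls (v - r) = 0" "cls (v + k - r) = 1" "cls (v + k + k' - r) = 2"
      using cls_add[of "v - r" k] cls_add[of "v + k - r" k'] k by (simp_all add: v_def algebra_simps)
    have d1: "new_dir \<sigma> (v + k) k = k'" using s1[OF c(2)] by (simp add: new_dir_def k'_def)
    have d2: "new_dir \<sigma> (v + k + k') k' = k" using s2[OF c(3)] by (simp add: new_dir_def k'_def)
    have "ty (v + k + k' + k) k = ty v u"
      using ty_step[OF k(2), of "v + k + k'"] ty_step[OF k(1), of "v + k"] ty_step[OF u, of v]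
      by (simp add: d1 d2 k_def[symmetric])
    moreover have "v + k + k' + k = r + scale l (w + k)"
      by (cases l) (simp_all add: v_def k'_def scale_add scale_unit rot_rot)
    ultimately have "ty (r + scale l (w + k)) k = ty v u" by (simp only:)
    then have "ty' (w + k) k = ty' w u" by (simp add: ty'_def v_def)
    moreover have "new_dir (\<lambda>w. \<sigma> (r + scale l w)) w u = k" by (simp add: new_dir_def k_def v_def)
    ultimately show "ty' (w + new_dir (\<lambda>w. \<sigma> (r + scale l w)) w u) (new_dir (\<lambda>w. \<sigma> (r + scale l w)) w u) = ty' w u"
      by simp
    define t where "t = ty v u"
    have "cls (v - fst t) = 0" "cls (fst t - r) = 0"
      using same[OF u, of v v] c(1) head(1)[OF u, of v] by (simp_all add: t_def cls_diff)
    moreover have "v - fst t = (v - r) - (fst t - r)" by simp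
    ultimately have "unscale l (v - fst t) = unscale l (v - r) - unscale l (fst t - r)"
      using unscale_diff[of "v - r" "fst t - r" l] c(1) by metis
    then have "unscale l (v - fst t) = w - unscale l (fst t - r)"
      by (simp add: v_def)
    then have "level_sign (snd t) (v - fst t) = level_sign (tl (snd t)) (w - unscale l (fst t - r))"
      using ls[OF u, of v] \<open>cls (v - fst t) = 0\<close> unfolding t_def
      by (metis level_sign.simps(2) zero_neq_one zero_neq_numeral)
    then show "level_sign (snd (ty' w u)) (w - fst (ty' w u)) \<noteq> Some (\<not> \<sigma> (r + scale l w))"
      using ty_sign[OF u, of v] by (simp add: ty'_def Let_def t_def v_def)
    show "length (snd (ty' w u)) = Suc n"
      using ty_len[OF u, of v] by (simp add: ty'_def Let_def v_def)
  qed
  with s1 s2 show ?thesis using that by blast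
qed

text \<open>Every descent fixes one common sign, and the base point found below is pulled back along
  \<open>r + scale l\<close>. Six levels stay in reserve for the search.\<close>

lemma common_type:
  assumes "typed_covering \<sigma> ty (n + 6)"
  shows "\<exists>b ls. length ls = n \<and> (\<forall>v. level_sign ls (v - b) \<noteq> Some (\<not> \<sigma> v))"
  using assms
proof (induction n arbitrary: \<sigma> ty)
  case (Suc n)
  have tc: "typed_covering \<sigma> ty (Suc (n + 6))" using Suc.prems by simp
  obtain r l ty' where s1: "\<And>v. cls (v - r) = 1 \<Longrightarrow> \<sigma> v = l"
    and s2: "\<And>v. cls (v - r) = 2 \<Longrightarrow> \<sigma> v = (\<not> l)"
    and ty': "typed_covering (\<lambda>w. \<sigma> (r + scale l w)) ty' (n + 6)"
    by (rule typed_covering_derived[OF tc]) auto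
  obtain b ls where len: "length ls = n"
    and ls: "\<And>w. level_sign ls (w - b) \<noteq> Some (\<not> \<sigma> (r + scale l w))"
    using Suc.IH[OF ty'] by blast
  have "level_sign (l # ls) (v - (r + scale l b)) \<noteq> Some (\<not> \<sigma> v)" for v
  proof -
    have c: "cls (v - (r + scale l b)) = cls (v - r)"
      using cls_diff[of "v - r" "scale l b"] by (simp add: algebra_simps)
    show ?thesis
    proof (cases "cls (v - r) = 0")
      case True
      define w where "w = unscale l (v - r)"
      have "v = r + scale l w" using scale_unscale[OF True, of l] by (simp add: w_def)
      then show ?thesis using ls[of w] by (simp add: scale_diff[symmetric])
    next
      case False
      then show ?thesis using s1[of v] s2[of v] c cls_range[of "v - r"] by auto
    qed
  qed
  with len show ?case by (intro exI[of _ "r + scale l b"] exI[of _ "l # ls"]) simp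
qed auto

section \<open>Turn sequences of folding curves\<close>

text \<open>The one-dimensional counterpart of \<open>level_sign\<close>: along a curve the class of
  a vertex is the index modulo 3, up to a shift.\<close>

fun seq_sign :: "bool list \<Rightarrow> int \<Rightarrow> bool option" where
  "seq_sign [] k = None"
| "seq_sign (l # ls) k =
     (if k mod 3 = 1 then Some l else if k mod 3 = 2 then Some (\<not> l) else seq_sign ls (k div 3))"

definition follows :: "(int \<Rightarrow> bool) \<Rightarrow> int \<Rightarrow> bool list \<Rightarrow> bool" where
  "follows a s ls \<longleftrightarrow> (\<forall>k. seq_sign ls (k - s) \<noteq> Some (\<not> a k))"

lemma mod3_cases: "(k::int) mod 3 = 0 \<or> k mod 3 = 1 \<or> k mod 3 = 2"
  by presburger

lemma seq_sign_append:
  "seq_sign (xs @ ys) k =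
     (case seq_sign xs k of None \<Rightarrow> seq_sign ys (k div 3 ^ length xs) | Some s \<Rightarrow> Some s)"
proof (induction xs arbitrary: k)
  case (Cons x xs)
  have "k div (3 * 3 ^ length xs) = k div 3 div 3 ^ length xs"
    by (simp add: zdiv_zmult2_eq)
  then show ?case using Cons[of "k div 3"] by (cases "seq_sign xs (k div 3)") simp_all
qed simp

lemma seq_sign_period: "seq_sign ls (k + 3 ^ length ls * m) = seq_sign ls k"
proof (induction ls arbitrary: k)
  case (Cons l ls)
  have "(k + 3 * 3 ^ length ls * m) mod 3 = k mod 3"
    by (simp add: mult.assoc)
  moreover have "(k + 3 * 3 ^ length ls * m) div 3 = k div 3 + 3 ^ length ls * m"
    by (simp add: mult.assoc)
  ultimately show ?case using Cons by simp
qed simp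

lemma seq_sign_None: "seq_sign ls k = None \<longleftrightarrow> 3 ^ length ls dvd k"
proof (induction ls arbitrary: k)
  case (Cons l ls)
  have "3 * 3 ^ length ls dvd k \<longleftrightarrow> k mod 3 = 0 \<and> 3 ^ length ls dvd k div 3"
  proof
    assume "3 * 3 ^ length ls dvd k"
    then obtain c where "k = 3 * (3 ^ length ls * c)" by (auto elim!: dvdE simp: mult.assoc)
    then show "k mod 3 = 0 \<and> 3 ^ length ls dvd k div 3" by simp
  next
    assume *: "k mod 3 = 0 \<and> 3 ^ length ls dvd k div 3"
    then have "3 * 3 ^ length ls dvd 3 * (k div 3)"
      by (metis dvd_refl mult_dvd_mono)
    moreover have "3 * (k div 3) = k" using * mult_div_mod_eq[of 3 k] by simp
    ultimately show "3 * 3 ^ length ls dvd k" by simp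
  qed
  then show ?case using Cons mod3_cases[of k] by auto
qed simp

lemma seq_sign_take: "seq_sign (take n ls) k = Some s \<Longrightarrow> seq_sign ls k = Some s"
  by (metis append_take_drop_id option.simps(5) seq_sign_append)

lemma follows_take: "follows a s ls \<Longrightarrow> follows a s (take n ls)"
  unfolding follows_def using seq_sign_take by blast

lemma follows_reduce:
  assumes "length ls = n"
    and "\<And>k. k \<in> K \<Longrightarrow> seq_sign ls (k - s) \<noteq> Some (\<not> a k)"
  shows "\<exists>s' \<in> {0..<3 ^ n}. \<forall>k\<in>K. seq_sign ls (k - s') \<noteq> Some (\<not> a k)"
proof
  show "s mod 3 ^ n \<in> {0..<3 ^ n}" by simp
  have eq: "k - s mod 3 ^ n = k - s + 3 ^ length ls * (s div 3 ^ n)" for k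
    using assms(1) by (simp add: algebra_simps minus_mod_eq_mult_div[symmetric])
  then show "\<forall>k\<in>K. seq_sign ls (k - s mod 3 ^ n) \<noteq> Some (\<not> a k)"
    unfolding eq seq_sign_period using assms(2) by blast
qed

text \<open>A shift matters only modulo \<open>3 ^ n\<close>, so finitely many pairs of shift and
  list compete. By the pigeonhole principle one of them serves infinitely many windows, and these
  exhaust the integers.\<close>

lemma follows_compact:
  assumes "\<And>N :: nat. \<exists>s ls. length ls = n \<and> Q ls \<and>
    (\<forall>k. \<bar>k\<bar> \<le> int N \<longrightarrow> seq_sign ls (k - s) \<noteq> Some (\<not> a k))"
  shows "\<exists>s ls. length ls = n \<and> Q ls \<and> follows a s ls"
proof -
  define F where "F = {0..<3 ^ n :: int} \<times> {ls :: bool list. length ls = n}"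
  have fin: "finite F"
    unfolding F_def using finite_lists_length_eq[of "UNIV :: bool set" n] by simp
  have "\<exists>x\<in>F. Q (snd x) \<and> (\<forall>k. \<bar>k\<bar> \<le> int N \<longrightarrow> seq_sign (snd x) (k - fst x) \<noteq> Some (\<not> a k))" for N
  proof -
    obtain s ls where ls: "length ls = n" "Q ls"
      "\<And>k. \<bar>k\<bar> \<le> int N \<Longrightarrow> seq_sign ls (k - s) \<noteq> Some (\<not> a k)"
      using assms[of N] by blast
    have "\<exists>s'\<in>{0..<3 ^ n}. \<forall>k\<in>{k. \<bar>k\<bar> \<le> int N}. seq_sign ls (k - s') \<noteq> Some (\<not> a k)"
      by (rule follows_reduce[OF ls(1)]) (use ls(3) in auto)
    then show ?thesis using ls(1,2) by (auto simp: F_def)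
  qed
  then obtain f where f: "\<And>N. f N \<in> F" "\<And>N. Q (snd (f N))"
    "\<And>N k. \<bar>k\<bar> \<le> int N \<Longrightarrow> seq_sign (snd (f N)) (k - fst (f N)) \<noteq> Some (\<not> a k)"
    by metis
  have "finite (range f)" using f(1) fin by (meson finite_subset image_subsetI)
  then obtain N0 where N0: "infinite {N. f N = f N0}"
    using pigeonhole_infinite[of "UNIV :: nat set" f] by auto
  have "seq_sign (snd (f N0)) (k - fst (f N0)) \<noteq> Some (\<not> a k)" for k
  proof -
    obtain N where "f N = f N0" "nat \<bar>k\<bar> < N"
      using N0[unfolded infinite_nat_iff_unbounded, rule_format, of "nat \<bar>k\<bar>"] by auto
    then show ?thesis using f(3)[of k N] by simp
  qed
  then show ?thesis using f(1,2)[of N0]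
    by (intro exI[of _ "fst (f N0)"] exI[of _ "snd (f N0)"]) (auto simp: F_def follows_def)
qed

lemma follows_Cons:
  "follows a s (l # ls) \<longleftrightarrow>
     (\<forall>j. a (s + 3 * j + 1) = l \<and> a (s + 3 * j + 2) = (\<not> l)) \<and> follows (\<lambda>j. a (s + 3 * j)) 0 ls"
    (is "?L \<longleftrightarrow> ?R")
proof
  assume L: ?L
  have "a (s + 3 * j + 1) = l \<and> a (s + 3 * j + 2) = (\<not> l)" for j
    using L[unfolded follows_def, rule_format, of "s + 3 * j + 1"]
      L[unfolded follows_def, rule_format, of "s + 3 * j + 2"] by (simp add: algebra_simps)
  moreover have "follows (\<lambda>j. a (s + 3 * j)) 0 ls"
    unfolding follows_def
  proof
    fix j
    show "seq_sign ls (j - 0) \<noteq> Some (\<not> a (s + 3 * j))"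
      using L[unfolded follows_def, rule_format, of "s + 3 * j"] by simp
  qed
  ultimately show ?R by blast
next
  assume R: ?R
  show ?L
    unfolding follows_def
  proof
    fix k
    define j where "j = (k - s) div 3"
    have "k = s + 3 * j + (k - s) mod 3" by (simp add: j_def)
    then consider "k = s + 3 * j" | "k = s + 3 * j + 1" | "k = s + 3 * j + 2"
      using mod3_cases[of "k - s"] by linarith
    then show "seq_sign (l # ls) (k - s) \<noteq> Some (\<not> a k)"
    proof cases
      case 1
      then show ?thesis using R by (auto simp: follows_def)
    qed (use R in \<open>auto simp: follows_def algebra_simps\<close>)
  qed
qed

lemma follows_shift: "follows (\<lambda>j. a (t + j)) s ls \<longleftrightarrow> follows a (s + t) ls"
proof -
  have "follows a (s + t) ls" if "follows (\<lambda>j. a (t + j)) s ls"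
    unfolding follows_def
  proof
    fix k
    show "seq_sign ls (k - (s + t)) \<noteq> Some (\<not> a k)"
      using that[unfolded follows_def, rule_format, of "k - t"] by (simp add: algebra_simps)
  qed
  moreover have "follows (\<lambda>j. a (t + j)) s ls" if "follows a (s + t) ls"
    unfolding follows_def
  proof
    fix j
    show "seq_sign ls (j - s) \<noteq> Some (\<not> a (t + j))"
      using that[unfolded follows_def, rule_format, of "t + j"] by (simp add: algebra_simps)
  qed
  ultimately show ?thesis by blast
qed

text \<open>The residue class left open by the first sign is recognised because the second sign
  makes the sequence non-constant there, while the other two classes are constant. Hence one sign
  more is assumed than is concluded.\<close>

lemma follows_unique:
  assumes "follows a s ls" "follows a s' ls'" "length ls = Suc n" "length ls' = Suc n"
  shows "take n ls = take n ls'"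
  using assms
proof (induction n arbitrary: a s s' ls ls')
  case (Suc n)
  obtain l m ks where ls: "ls = l # m # ks" using Suc.prems(3) by (metis length_Suc_conv)
  obtain l' m' ks' where ls': "ls' = l' # m' # ks'" using Suc.prems(4) by (metis length_Suc_conv)
  have A: "a (s + 3 * j + 1) = l" "a (s + 3 * j + 2) = (\<not> l)" for j
    using Suc.prems(1) by (simp_all add: ls follows_Cons)
  have A': "a (s' + 3 * j + 1) = l'" "a (s' + 3 * j + 2) = (\<not> l')" for j
    using Suc.prems(2) by (simp_all add: ls' follows_Cons)
  have F: "follows (\<lambda>j. a (s + 3 * j)) 0 (m # ks)" and F': "follows (\<lambda>j. a (s' + 3 * j)) 0 (m' # ks')"
    using Suc.prems(1,2) by (simp_all add: ls ls' follows_Cons)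
  have B: "a (s + 3) = m" "a (s + 6) = (\<not> m)"
    using F[unfolded follows_Cons] by (auto dest: spec[of _ 0])
  have "(s - s') mod 3 = 0"
  proof (rule ccontr)
    assume "(s - s') mod 3 \<noteq> 0"
    moreover have "s = s' + 3 * ((s - s') div 3) + (s - s') mod 3" by simp
    ultimately consider "s = s' + 3 * ((s - s') div 3) + 1" | "s = s' + 3 * ((s - s') div 3) + 2"
      using mod3_cases[of "s - s'"] by linarith
    then have "a (s + 3) = a (s + 6)"
    proof cases
      case 1
      then have e: "s + 3 = s' + 3 * ((s - s') div 3 + 1) + 1" "s + 6 = s' + 3 * ((s - s') div 3 + 2) + 1"
        by simp_all
      show ?thesis by (simp only: e A')
    next
      case 2
      then have e: "s + 3 = s' + 3 * ((s - s') div 3 + 1) + 2" "s + 6 = s' + 3 * ((s - s') div 3 + 2) + 2"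
        by simp_all
      show ?thesis by (simp only: e A')
    qed
    then show False using B by simp
  qed
  then obtain t where t: "s = s' + 3 * t" by (metis add.commute diff_add_cancel mult_div_mod_eq add.right_neutral)
  have "l = l'" using A(1)[of 0] A'(1)[of t] by (simp add: t)
  moreover have "follows (\<lambda>j. a (s' + 3 * j)) t (m # ks)"
    using F follows_shift[of "\<lambda>j. a (s' + 3 * j)" t 0 "m # ks"] by (simp add: t algebra_simps)
  from Suc.IH[OF this F'] have "take n (m # ks) = take n (m' # ks')"
    using Suc.prems(3,4) by (simp add: ls ls')
  ultimately show ?case by (simp add: ls ls')
qed simp

section \<open>Lattice paths with prescribed turns\<close>

definition path :: "(int \<Rightarrow> bool) \<Rightarrow> (int \<Rightarrow> point) \<Rightarrow> (int \<Rightarrow> point) \<Rightarrow> bool" where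
  "path a v u \<longleftrightarrow> (\<forall>k. u k \<in> units \<and> u (k + 1) = (if a k then rot (u k) else rot (rot (u k))) \<and>
     v (k + 1) = v k + u (k + 1))"

lemma path_cls: "path a v u \<Longrightarrow> cls (v k - b) = (cls (v s - b) + (k - s)) mod 3"
proof (induction k rule: int_induct[where k = s])
  case (step1 i)
  have "v (i + 1) - b = (v i - b) + u (i + 1)" and u: "u (i + 1) \<in> units"
    using step1.prems by (simp_all add: path_def)
  then have "cls (v (i + 1) - b) = (cls (v i - b) + 1) mod 3" by (simp only: cls_add cls_unit)
  then show ?case using step1 by (simp add: mod_simps algebra_simps)
next
  case (step2 i)
  have "v (i - 1 + 1) = v (i - 1) + u (i - 1 + 1)" and u: "u i \<in> units"
    using step2.prems unfolding path_def by blast+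
  then have "v (i - 1) - b = (v i - b) - u i" by simp
  then have "cls (v (i - 1) - b) = (cls (v i - b) - 1) mod 3" using u by (simp only: cls_diff cls_unit)
  then show ?case using step2 by (simp add: mod_simps algebra_simps)
qed simp

lemma path_three:
  assumes "path a v u" "a (k + 1) = l" "a (k + 2) = (\<not> l)"
  shows "u (k + 3) = u (k + 1)" "v (k + 3) = v k + scale l (u (k + 1))" "v (k + 1) = v k + u (k + 1)"
    "u (k + 2) = (if l then rot (u (k + 1)) else rot (rot (u (k + 1))))" "v (k + 2) = v (k + 1) + u (k + 2)"
proof -
  have s: "u (j + 1) = (if a j then rot (u j) else rot (rot (u j)))" "v (j + 1) = v j + u (j + 1)" for j
    using assms(1) by (simp_all add: path_def)
  have e: "k + 1 + 1 = k + 2" "k + 2 + 1 = k + 3" by simp_all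
  show u2: "u (k + 2) = (if l then rot (u (k + 1)) else rot (rot (u (k + 1))))"
    and v2: "v (k + 2) = v (k + 1) + u (k + 2)" and v1: "v (k + 1) = v k + u (k + 1)"
    using s[of "k + 1"] s[of k] assms(2) unfolding e by simp_all
  show u3: "u (k + 3) = u (k + 1)"
    using s(1)[of "k + 2"] assms(3) u2 unfolding e by simp
  show "v (k + 3) = v k + scale l (u (k + 1))"
    using s(2)[of "k + 2"] v2 v1 u2 u3 unfolding e by (simp add: scale_unit rot_rot algebra_simps)
qed

lemma path_derived:
  assumes p: "path a v u" and l: "\<And>j. a (s + 3 * j + 1) = l" "\<And>j. a (s + 3 * j + 2) = (\<not> l)"
    and b: "cls (v s - b) = 0"
  shows "path (\<lambda>j. a (s + 3 * j)) (\<lambda>j. unscale l (v (s + 3 * j) - b)) (\<lambda>j. u (s + 3 * j))"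
    and "v (s + 3 * j) = b + scale l (unscale l (v (s + 3 * j) - b))"
proof -
  have c: "cls (v (s + 3 * j) - b) = 0" for j
    using path_cls[OF p, of "s + 3 * j" b s] b by simp
  show eq: "v (s + 3 * j) = b + scale l (unscale l (v (s + 3 * j) - b))" for j
    using scale_unscale[OF c] by simp
  show "path (\<lambda>j. a (s + 3 * j)) (\<lambda>j. unscale l (v (s + 3 * j) - b)) (\<lambda>j. u (s + 3 * j))"
    unfolding path_def
  proof (intro allI conjI)
    fix j
    note t = path_three[OF p l[of j]]
    have e: "s + 3 * (j + 1) = s + 3 * j + 3" by simp
    show "u (s + 3 * j) \<in> units" using p by (simp add: path_def)
    show "u (s + 3 * (j + 1)) = (if a (s + 3 * j) then rot (u (s + 3 * j)) else rot (rot (u (s + 3 * j))))"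
      using t(1) p unfolding e by (simp add: path_def)
    have "v (s + 3 * (j + 1)) - b = (v (s + 3 * j) - b) + scale l (u (s + 3 * (j + 1)))"
      using t(1,2) unfolding e by simp
    then show "unscale l (v (s + 3 * (j + 1)) - b) = unscale l (v (s + 3 * j) - b) + u (s + 3 * (j + 1))"
      by (metis eq add_diff_cancel_left' scale_add unscale_scale)
  qed
qed

text \<open>Along a path classes become residues of the index, and the vertices of class 0 form a
  path on the sublattice to which the recursion applies.\<close>

lemma follows_of_level_sign:
  assumes "path (\<lambda>k. \<sigma> (v k)) v u" "\<And>x. level_sign ls (x - b) \<noteq> Some (\<not> \<sigma> x)"
  shows "\<exists>s. follows (\<lambda>k. \<sigma> (v k)) s ls"
  using assms
proof (induction ls arbitrary: \<sigma> v u b)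
  case (Cons l ls)
  \<comment> \<open>An index whose vertex has class 0, since the class grows by one per
    step.\<close>
  define s where "s = - cls (v 0 - b)"
  have c: "cls (v (s + k) - b) = k mod 3" for k
    using path_cls[OF Cons.prems(1), of "s + k" b 0] by (simp add: s_def)
  have l: "\<sigma> (v (s + 3 * j + 1)) = l" "\<sigma> (v (s + 3 * j + 2)) = (\<not> l)" for j
    using Cons.prems(2)[of "v (s + 3 * j + 1)"] c[of "3 * j + 1"]
      Cons.prems(2)[of "v (s + 3 * j + 2)"] c[of "3 * j + 2"] by (auto simp: algebra_simps)
  have cs: "cls (v s - b) = 0" using c[of 0] by simp
  define v' where "v' = (\<lambda>j. unscale l (v (s + 3 * j) - b))"
  define \<sigma>' where "\<sigma>' = (\<lambda>w. \<sigma> (b + scale l w))"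
  note D = path_derived[OF Cons.prems(1) l cs]
  have \<sigma>': "\<sigma>' (v' j) = \<sigma> (v (s + 3 * j))" for j
    using D(2)[of j] by (simp add: v'_def \<sigma>'_def)
  have "path (\<lambda>j. \<sigma>' (v' j)) v' (\<lambda>j. u (s + 3 * j))"
    unfolding \<sigma>' using D(1) by (simp add: v'_def)
  moreover have "level_sign ls (w - 0) \<noteq> Some (\<not> \<sigma>' w)" for w
    using Cons.prems(2)[of "b + scale l w"] by (simp add: \<sigma>'_def)
  ultimately obtain s' where "follows (\<lambda>j. \<sigma>' (v' j)) s' ls" using Cons.IH by blast
  then have F: "follows (\<lambda>j. \<sigma> (v (s + 3 * j))) s' ls" by (simp add: \<sigma>')
  have "follows (\<lambda>k. \<sigma> (v k)) (s + 3 * s') (l # ls)"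
    unfolding follows_Cons
  proof (intro conjI allI)
    fix j
    show "\<sigma> (v (s + 3 * s' + 3 * j + 1)) = l" "\<sigma> (v (s + 3 * s' + 3 * j + 2)) = (\<not> l)"
      using l[of "s' + j"] by (simp_all add: algebra_simps)
    show "follows (\<lambda>j. \<sigma> (v (s + 3 * s' + 3 * j))) 0 ls"
      using F follows_shift[of "\<lambda>j. \<sigma> (v (s + 3 * j))" s' 0 ls] by (simp add: algebra_simps)
  qed
  then show ?case by blast
qed (simp add: follows_def)

text \<open>The base point is a vertex at an index left open by the first sign, corrected by the
  base point found on the sublattice.\<close>

lemma level_sign_of_follows:
  assumes "path a v u" "follows a s ls"
  shows "\<exists>b. \<forall>k. level_sign ls (v k - b) \<noteq> Some (\<not> a k)"
  using assms
proof (induction ls arbitrary: a v u s)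
  case (Cons l ls)
  have l: "a (s + 3 * j + 1) = l" "a (s + 3 * j + 2) = (\<not> l)" for j
    using Cons.prems(2) by (simp_all add: follows_Cons)
  define b where "b = v s"
  have cs: "cls (v s - b) = 0" by (simp add: b_def)
  define v' where "v' = (\<lambda>j. unscale l (v (s + 3 * j) - b))"
  note D = path_derived[OF Cons.prems(1) l cs]
  have "follows (\<lambda>j. a (s + 3 * j)) 0 ls" using Cons.prems(2) by (simp add: follows_Cons)
  then obtain b' where b': "\<And>j. level_sign ls (v' j - b') \<noteq> Some (\<not> a (s + 3 * j))"
    using Cons.IH[OF D(1)] unfolding v'_def by blast
  have "level_sign (l # ls) (v k - (b + scale l b')) \<noteq> Some (\<not> a k)" for k
  proof -
    define j where "j = (k - s) div 3"
    have "k = s + 3 * j + (k - s) mod 3" by (simp add: j_def)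
    then consider "k = s + 3 * j" | "k = s + 3 * j + 1" | "k = s + 3 * j + 2"
      using mod3_cases[of "k - s"] by linarith
    moreover have c: "cls (v k - (b + scale l b')) = (k - s) mod 3"
      using path_cls[OF Cons.prems(1), of k "b + scale l b'" s] cls_minus[of "scale l b'"]
      by (simp add: b_def)
    ultimately show ?thesis
    proof cases
      case 1
      have "v k - (b + scale l b') = scale l (v' j - b')"
        using D(2)[of j] 1 by (simp add: v'_def scale_diff algebra_simps)
      then show ?thesis using b'[of j] 1 by simp
    qed (use c l[of j] in \<open>auto simp: algebra_simps\<close>)
  qed
  then show ?case by blast
qed simp

section \<open>Folding words as windows of Toeplitz sequences\<close>

definition sign_of :: "bool \<Rightarrow> int" where
  "sign_of b = (if b then 1 else - 1)"

definition signs :: "(nat \<Rightarrow> int) \<Rightarrow> nat \<Rightarrow> bool list" where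
  "signs \<Lambda> n = map (\<lambda>i. \<Lambda> (Suc i) = 1) [0..<n]"

lemma length_signs [simp]: "length (signs \<Lambda> n) = n"
  by (simp add: signs_def)

lemma signs_Suc: "signs \<Lambda> (Suc n) = signs \<Lambda> n @ [\<Lambda> (Suc n) = 1]"
  by (simp add: signs_def)

lemma take_signs: "m \<le> n \<Longrightarrow> take m (signs \<Lambda> n) = signs \<Lambda> m"
  by (simp add: signs_def take_map)

lemma length_folding_word [simp]: "length (folding_word \<Lambda> n) = 3 ^ n - 1"
proof (induction n)
  case (Suc n)
  have "(1::nat) \<le> 3 ^ n" by simp
  then show ?case using Suc by simp
qed simp

lemma nth_three_blocks:
  shows "j < length T \<Longrightarrow> (T @ x # T @ y # T) ! j = T ! j"
    and "(T @ x # T @ y # T) ! length T = x"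
    and "j < length T \<Longrightarrow> (T @ x # T @ y # T) ! (Suc (length T) + j) = T ! j"
    and "(T @ x # T @ y # T) ! (Suc (length T) + length T) = y"
    and "(T @ x # T @ y # T) ! (Suc (length T) + Suc (length T) + j) = T ! j"
  by (simp_all add: nth_append)

text \<open>Counted from 1, the two separators of level \<open>n + 1\<close> stand at
  \<open>3 ^ n\<close> and \<open>2 * 3 ^ n\<close>, where the first \<open>n\<close> signs force
  nothing; the three blocks between them agree because the forced pattern has period
  \<open>3 ^ n\<close>.\<close>

lemma folding_word_nth:
  assumes "sign_sequence \<Lambda>" "i < 3 ^ n - 1"
  shows "\<exists>b. seq_sign (signs \<Lambda> n) (int i + 1) = Some b \<and> folding_word \<Lambda> n ! i = sign_of b"
  using assms(2)
proof (induction n arbitrary: i)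
  case (Suc n)
  define L :: nat where "L = 3 ^ n"
  have L: "1 \<le> L" "length (folding_word \<Lambda> n) = L - 1" "int L = 3 ^ n" by (simp_all add: L_def)
  have lam: "\<Lambda> (Suc n) = sign_of (\<Lambda> (Suc n) = 1)" "- \<Lambda> (Suc n) = sign_of (\<not> \<Lambda> (Suc n) = 1)"
    using assms(1) by (auto simp: sign_sequence_def sign_of_def)
  have block: "\<exists>b. seq_sign (signs \<Lambda> (Suc n)) (int (j + m * L) + 1) = Some b \<and> folding_word \<Lambda> n ! j = sign_of b"
    if jL: "j < L - 1" for j m
  proof -
    obtain b where b: "seq_sign (signs \<Lambda> n) (int j + 1) = Some b" "folding_word \<Lambda> n ! j = sign_of b"
      using Suc.IH[of j] jL by (auto simp: L_def)
    have "int (j + m * L) + 1 = int j + 1 + 3 ^ length (signs \<Lambda> n) * int m"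
      by (simp add: L_def)
    then have "seq_sign (signs \<Lambda> n) (int (j + m * L) + 1) = Some b"
      using b(1) by (simp only: seq_sign_period)
    then show ?thesis using b(2) by (auto simp: signs_Suc seq_sign_append)
  qed
  have sep: "seq_sign (signs \<Lambda> (Suc n)) (int m * 3 ^ n) =
      seq_sign [\<Lambda> (Suc n) = 1] (int m)" for m
  proof -
    have "seq_sign (signs \<Lambda> n) (int m * 3 ^ n) = None" by (simp add: seq_sign_None)
    then show ?thesis by (simp add: signs_Suc seq_sign_append)
  qed
  have i: "i < 3 * L - 1" using Suc.prems by (simp add: L_def)
  have fw: "folding_word \<Lambda> (Suc n) =
      folding_word \<Lambda> n @ \<Lambda> (Suc n) # folding_word \<Lambda> n @ - \<Lambda> (Suc n) # folding_word \<Lambda> n"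
    by simp
  note nth = nth_three_blocks[where T = "folding_word \<Lambda> n" and x = "\<Lambda> (Suc n)" and y = "- \<Lambda> (Suc n)",
      folded fw, unfolded L(2)]
  have SL: "Suc (L - 1) = L" using L(1) by simp
  consider "i < L - 1" | "i = L - 1" | j where "i = L + j" "j < L - 1" | "i = L + (L - 1)"
    | j where "i = L + L + j" "j < L - 1"
  proof -
    assume *: "i < L - 1 \<Longrightarrow> thesis" "i = L - 1 \<Longrightarrow> thesis" "\<And>j. i = L + j \<Longrightarrow> j < L - 1 \<Longrightarrow> thesis"
      "i = L + (L - 1) \<Longrightarrow> thesis" "\<And>j. i = L + L + j \<Longrightarrow> j < L - 1 \<Longrightarrow> thesis"
    consider "i < L - 1" | "i = L - 1" | "L \<le> i" "i < L + (L - 1)" | "i = L + (L - 1)" | "L + L \<le> i"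
      by linarith
    then show thesis
    proof cases
      case 3
      then show thesis using *(3)[of "i - L"] by linarith
    next
      case 5
      then show thesis using *(5)[of "i - (L + L)"] i by linarith
    qed (use * in blast)+
  qed
  then show ?case
  proof cases
    case 1
    then show ?thesis using block[of i 0] nth(1)[of i] by (simp del: folding_word.simps)
  next
    case 2
    then have "int i + 1 = int 1 * int L" using L(1) by linarith
    then have "int i + 1 = int 1 * 3 ^ n" unfolding L(3) .
    then have "seq_sign (signs \<Lambda> (Suc n)) (int i + 1) = Some (\<Lambda> (Suc n) = 1)"
      by (simp only: sep) simp
    then show ?thesis using lam(1) nth(2) unfolding 2 by auto
  next
    case (3 j)
    then show ?thesis using block[of j 1] nth(3)[of j] by (simp add: SL add.commute del: folding_word.simps)
  next
    case 4
    then have "int i + 1 = int 2 * int L" using L(1) by linarith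
    then have "int i + 1 = int 2 * 3 ^ n" unfolding L(3) .
    then have "seq_sign (signs \<Lambda> (Suc n)) (int i + 1) = Some (\<not> \<Lambda> (Suc n) = 1)"
      by (simp only: sep) simp
    then show ?thesis using lam(2) nth(4) unfolding 4 SL by auto
  next
    case (5 j)
    have "i = j + 2 * L" using 5 by simp
    then show ?thesis using block[of j 2] nth(5)[of j] 5 unfolding SL by (simp add: add.commute)
  qed
qed simp

lemma follows_block:
  assumes "sign_sequence \<Lambda>" "follows a s (signs \<Lambda> n)" "(K - s) mod 3 ^ n = 0"
  shows "map (\<lambda>k. sign_of (a k)) [K + 1..K + 3 ^ n - 1] = folding_word \<Lambda> n"
proof (rule nth_equalityI)
  show "length (map (\<lambda>k. sign_of (a k)) [K + 1..K + 3 ^ n - 1]) = length (folding_word \<Lambda> n)"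
    by (simp add: nat_diff_distrib nat_power_eq)
  fix i assume il: "i < length (map (\<lambda>k. sign_of (a k)) [K + 1..K + 3 ^ n - 1])"
  then have i: "i < 3 ^ n - 1" by (simp add: nat_diff_distrib nat_power_eq)
  then have "int (i + 1) < int (3 ^ n)" by (simp only: of_nat_less_iff)
  then have i': "K + 1 + int i \<le> K + 3 ^ n - 1" by simp
  obtain b where b: "seq_sign (signs \<Lambda> n) (int i + 1) = Some b" "folding_word \<Lambda> n ! i = sign_of b"
    using folding_word_nth[OF assms(1) i] by blast
  have "K + 1 + int i - s = int i + 1 + 3 ^ length (signs \<Lambda> n) * ((K - s) div 3 ^ n)"
    using assms(3) by (simp add: algebra_simps mod_eq_0_iff_dvd)
  then have "seq_sign (signs \<Lambda> n) (K + 1 + int i - s) = Some b"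
    using b(1) by (simp only: seq_sign_period)
  then have "a (K + 1 + int i) = b"
    using assms(2)[unfolded follows_def, rule_format, of "K + 1 + int i"] by auto
  then show "map (\<lambda>k. sign_of (a k)) [K + 1..K + 3 ^ n - 1] ! i = folding_word \<Lambda> n ! i"
    using il b(2) \<open>a (K + 1 + int i) = b\<close> by (simp only: nth_map length_map nth_upto[OF i'])
qed

text \<open>So short a window meets at most one index left open by the first \<open>n\<close> signs.
  It thus lies in T x T with T the folding word of level \<open>n\<close>, and both values of x
  occur in the word of level \<open>n + 1\<close>.\<close>

lemma follows_sublist:
  assumes \<Lambda>: "sign_sequence \<Lambda>" and f: "follows a s (signs \<Lambda> n)" and pq: "q - p < 3 ^ n"
  shows "sublist (map (\<lambda>k. sign_of (a k)) [p..q - 1]) (folding_word \<Lambda> (Suc n))"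
proof (cases "p < q")
  case True
  define L :: int where "L = 3 ^ n"
  have L: "0 < L" by (simp add: L_def)
  \<comment> \<open>The first open index from \<open>p\<close> on.\<close>
  define K where "K = p + (s - p) mod L"
  have "(s - p) mod L = (s - p) - L * ((s - p) div L)" by (simp add: minus_mult_div_eq_mod)
  then have "K - s = L * (- ((s - p) div L))" by (simp add: K_def)
  then have K: "p \<le> K" "K < p + L" "(K - s) mod L = 0"
    using L by (simp_all add: K_def)
  have "p - L < K - L + 1" using K by simp
  obtain K' where K': "(K' - s) mod L = 0" "K' - L < p" "q - 1 < K' + L"
  proof (cases "q - 1 < K")
    case True
    show ?thesis using that[of K] K True L pq by (auto simp: L_def)
  next
    case False
    show ?thesis using that[of K] K pq by (auto simp: L_def)
  qed
  define f where "f = (\<lambda>k. sign_of (a k))"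
  have "K' - L - s = (K' - s) - L" by simp
  then have "(K' - L - s) mod L = 0" using K'(1) by (simp only: minus_mod_self2)
  then have b1: "map f [K' - L + 1..K' - 1] = folding_word \<Lambda> n"
    using follows_block[OF \<Lambda> f, of "K' - L"] by (simp add: L_def f_def)
  have b2: "map f [K' + 1..K' + L - 1] = folding_word \<Lambda> n"
    using follows_block[OF \<Lambda> f, of "K'"] K'(1) by (simp add: L_def f_def)
  have "[K' - L + 1..K' + L - 1] = [K' - L + 1..K' - 1] @ [K'] @ [K' + 1..K' + L - 1]"
    using L upto_split3[of "K' - L + 1" K' "K' + L - 1"] by simp
  then have W: "map f [K' - L + 1..K' + L - 1] = folding_word \<Lambda> n @ [f K'] @ folding_word \<Lambda> n"
    by (simp add: b1 b2)
  have "\<Lambda> (Suc n) = 1 \<or> \<Lambda> (Suc n) = - 1" using \<Lambda> by (auto simp: sign_sequence_def)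
  then have "f K' = \<Lambda> (Suc n) \<or> f K' = - \<Lambda> (Suc n)"
    by (auto simp: f_def sign_of_def)
  then have "sublist (map f [K' - L + 1..K' + L - 1]) (folding_word \<Lambda> (Suc n))"
  proof
    assume "f K' = \<Lambda> (Suc n)"
    then have "folding_word \<Lambda> (Suc n) =
        map f [K' - L + 1..K' + L - 1] @ ([- \<Lambda> (Suc n)] @ folding_word \<Lambda> n)"
      by (simp only: W) simp
    then show ?thesis by (simp only: sublist_append_rightI)
  next
    assume "f K' = - \<Lambda> (Suc n)"
    then have "folding_word \<Lambda> (Suc n) =
        (folding_word \<Lambda> n @ [\<Lambda> (Suc n)]) @ map f [K' - L + 1..K' + L - 1]"
      by (simp only: W) simp
    then show ?thesis by (simp only: sublist_append_leftI)
  qed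
  moreover have "[K' - L + 1..K' + L - 1] = [K' - L + 1..p - 1] @ [p..q - 1] @ [q..K' + L - 1]"
    using K'(2,3) True upto_split1[of "K' - L + 1" p "K' + L - 1"] upto_split2[of p "q - 1" "K' + L - 1"] by simp
  then have "sublist (map f [p..q - 1]) (map f [K' - L + 1..K' + L - 1])"
    by (simp add: sublist_appendI)
  ultimately show ?thesis unfolding f_def by (rule sublist_order.order.trans[rotated])
qed simp

text \<open>The bound on the length of the window guarantees \<open>n \<le> m\<close>, so that the
  word really carries the first \<open>n\<close> signs.\<close>

lemma sublist_follows:
  assumes \<Lambda>: "sign_sequence \<Lambda>" and sub: "sublist (map (\<lambda>k. sign_of (a k)) [p..q]) (folding_word \<Lambda> m)"
    and n: "3 ^ n \<le> q - p + 1"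
  shows "\<exists>s. \<forall>k. p \<le> k \<and> k \<le> q \<longrightarrow> seq_sign (signs \<Lambda> n) (k - s) \<noteq> Some (\<not> a k)"
proof -
  obtain ps ss where e: "folding_word \<Lambda> m = ps @ map (\<lambda>k. sign_of (a k)) [p..q] @ ss"
    using sub by (auto simp: sublist_def)
  have len: "length ps + nat (q - p + 1) + length ss = 3 ^ m - 1"
    using arg_cong[OF e, of length] by simp
  have "(3::nat) ^ n = nat (3 ^ n)" by (simp add: nat_power_eq)
  also have "\<dots> \<le> nat (q - p + 1)" using n by (rule nat_mono)
  also have "\<dots> \<le> 3 ^ m" using len by linarith
  finally have nm: "n \<le> m" by simp
  define s where "s = p - int (length ps) - 1"
  have "seq_sign (signs \<Lambda> n) (k - s) \<noteq> Some (\<not> a k)" if k: "p \<le> k" "k \<le> q" for k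
  proof
    assume A: "seq_sign (signs \<Lambda> n) (k - s) = Some (\<not> a k)"
    define i where "i = length ps + nat (k - p)"
    have i: "i < 3 ^ m - 1" using len k by (auto simp: i_def)
    have "folding_word \<Lambda> m ! i = sign_of (a k)"
      unfolding e i_def using k by (simp add: nth_append nat_less_iff)
    moreover have "int i + 1 = k - s" using k by (simp add: i_def s_def)
    moreover obtain b where "seq_sign (signs \<Lambda> m) (int i + 1) = Some b" "folding_word \<Lambda> m ! i = sign_of b"
      using folding_word_nth[OF \<Lambda> i] by blast
    ultimately have "seq_sign (signs \<Lambda> m) (k - s) = Some (a k)"
      by (auto simp: sign_of_def split: if_splits)
    then show False
      using A seq_sign_take[of n "signs \<Lambda> m" "k - s"] by (simp add: take_signs[OF nm])
  qed
  then show ?thesis by blast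
qed

definition left_turns :: "(int \<Rightarrow> side) \<Rightarrow> int \<Rightarrow> bool" where
  "left_turns c k \<longleftrightarrow> turn (c k) (c (k + 1)) = 1"

lemma turn_left_turns: "turn (c k) (c (k + 1)) = sign_of (left_turns c k)"
  unfolding left_turns_def sign_of_def turn_def by simp

lemma turns_subcurve: "turns (subcurve c p q) = map (\<lambda>k. sign_of (left_turns c k)) [p..q - 1]"
proof (cases "p \<le> q")
  case True
  have "map2 turn (map c [p..q]) (map c [p + 1..q]) = map (\<lambda>k. sign_of (left_turns c k)) [p..q - 1]"
  proof (rule nth_equalityI)
    fix i assume "i < length (map2 turn (map c [p..q]) (map c [p + 1..q]))"
    then have i: "p + 1 + int i \<le> q" by simp
    then have n: "[p..q - 1] ! i = p + int i" "i < length [p..q - 1]" by (simp_all add: nth_upto)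
    then have "map2 turn (map c [p..q]) (map c [p + 1..q]) ! i = turn (c (p + int i)) (c (p + 1 + int i))"
      by simp
    also have "p + 1 + int i = p + int i + 1" by simp
    finally show "map2 turn (map c [p..q]) (map c [p + 1..q]) ! i =
        map (\<lambda>k. sign_of (left_turns c k)) [p..q - 1] ! i"
      using n by (simp only: turn_left_turns nth_map)
  qed simp
  moreover have "tl (map c [p..q]) = map c [p + 1..q]"
    by (simp only: upto_rec1[OF True] list.map list.sel)
  ultimately show ?thesis by (simp add: turns_def subcurve_def)
qed (simp add: turns_def subcurve_def)

text \<open>The pieces exhausting the curve come with sign sequences that are not assumed to be
  compatible. Each window therefore gets a list of \<open>n\<close> signs of its own, and
  compactness selects one for the whole curve.\<close>

lemma folding_curve_follows:
  assumes "complete_folding_tcurve P c"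
  shows "\<exists>s ls. length ls = n \<and> follows (left_turns c) s ls"
proof -
  obtain p q :: "nat \<Rightarrow> int" where fold: "\<And>n. n_folding_tcurve P n (subcurve c (p n) (q n))"
    and mono: "\<And>n. p (Suc n) \<le> p n \<and> q n \<le> q (Suc n)" and un: "(\<Union>n. {p n..q n}) = UNIV"
    using assms unfolding complete_folding_tcurve_def by blast
  have mono': "p m' \<le> p m \<and> q m \<le> q m'" if "m \<le> m'" for m m'
    using that by (induction rule: dec_induct) (use mono order_trans in blast)+
  have "\<exists>s ls. length ls = n \<and> True \<and>
      (\<forall>k. \<bar>k\<bar> \<le> int N \<longrightarrow> seq_sign ls (k - s) \<noteq> Some (\<not> left_turns c k))" for N
  proof -
    have "- int N \<in> (\<Union>n. {p n..q n})" "int N + 1 \<in> (\<Union>n. {p n..q n})" unfolding un by auto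
    then obtain m1 m2 where m12: "p m1 \<le> - int N" "int N + 1 \<le> q m2" by auto
    define m where "m = max n (max m1 m2)"
    have "n \<le> m" "m1 \<le> m" "m2 \<le> m" by (simp_all add: m_def)
    then have m: "n \<le> m" "p m \<le> - int N" "int N \<le> q m - 1"
      using mono'[of m1 m] mono'[of m2 m] m12 by linarith+
    obtain \<Lambda> where \<Lambda>: "sign_sequence \<Lambda>" "turns (subcurve c (p m) (q m)) = folding_word \<Lambda> m"
      using fold[of m] unfolding n_folding_tcurve_def by blast
    define s where "s = p m - 1"
    have "seq_sign (signs \<Lambda> n) (k - s) \<noteq> Some (\<not> left_turns c k)" if k: "\<bar>k\<bar> \<le> int N" for k
    proof
      assume A: "seq_sign (signs \<Lambda> n) (k - s) = Some (\<not> left_turns c k)"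
      have W: "map (\<lambda>k. sign_of (left_turns c k)) [p m..q m - 1] = folding_word \<Lambda> m"
        using \<Lambda>(2) by (simp add: turns_subcurve)
      define i where "i = nat (k - p m)"
      have ki: "k = p m + int i" "i < nat (q m - p m)" using k m by (auto simp: i_def)
      have "length (folding_word \<Lambda> m) = nat (q m - p m)" using arg_cong[OF W, of length] by simp
      then have i: "i < 3 ^ m - 1" using ki by simp
      have "folding_word \<Lambda> m ! i = sign_of (left_turns c k)"
        using ki by (simp add: W[symmetric])
      moreover obtain b where "seq_sign (signs \<Lambda> m) (int i + 1) = Some b" "folding_word \<Lambda> m ! i = sign_of b"
        using folding_word_nth[OF \<Lambda>(1) i] by blast
      moreover have "int i + 1 = k - s" using ki by (simp add: s_def)
      ultimately have "seq_sign (signs \<Lambda> m) (k - s) = Some (left_turns c k)"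
        by (auto simp: sign_of_def split: if_splits)
      then show False
        using A seq_sign_take[of n "signs \<Lambda> m" "k - s"] by (simp add: take_signs[OF m(1)])
    qed
    then show ?thesis by (intro exI[of _ s] exI[of _ "signs \<Lambda> n"]) simp
  qed
  from follows_compact[OF this] show ?thesis by simp
qed

section \<open>The tiling as a lattice\<close>

definition omega :: complex where
  "omega = cis (2 * pi / 3)"

definition eis :: "point \<Rightarrow> complex" where
  "eis x = of_int (fst x) + of_int (snd x) * omega"

lemma omega_Complex: "omega = Complex (- 1 / 2) (sqrt 3 / 2)"
  unfolding omega_def by (simp add: cis.code cos_120 sin_120 complex_eq_iff)

lemma Re_omega [simp]: "Re omega = - 1 / 2" and Im_omega [simp]: "Im omega = sqrt 3 / 2"
  by (simp_all add: omega_Complex)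

lemma omega_sq: "omega * omega = - 1 - omega"
  by (simp add: complex_eq_iff)

lemma cis_pi_third: "cis (pi / 3) = 1 + omega" "cis (- (pi / 3)) = - omega"
  by (simp_all add: complex_eq_iff cos_60 sin_60)

lemma eis_add: "eis (x + y) = eis x + eis y" and eis_diff: "eis (x - y) = eis x - eis y"
  and eis_minus: "eis (- x) = - eis x" and eis_zero [simp]: "eis 0 = 0"
  by (simp_all add: eis_def algebra_simps)

lemma eis_rot: "eis (rot x) = omega * eis x"
proof -
  have "eis (rot x) = of_int (snd x) * (- 1 - omega) + of_int (fst x) * omega"
    by (simp add: eis_def rot_def algebra_simps)
  also have "\<dots> = omega * eis x"
    unfolding omega_sq[symmetric] by (simp add: eis_def algebra_simps)
  finally show ?thesis .
qed

lemma cmod_omega [simp]: "cmod omega = 1"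
  by (simp add: omega_def)

lemma cmod_eis_sq: "(cmod (eis x))\<^sup>2 = of_int ((fst x)\<^sup>2 - fst x * snd x + (snd x)\<^sup>2)"
proof -
  have "(cmod (eis x))\<^sup>2 = (of_int (fst x) - of_int (snd x) / 2)\<^sup>2 + (of_int (snd x) * (sqrt 3 / 2))\<^sup>2"
    by (simp add: cmod_power2 eis_def)
  also have "\<dots> = (of_int (fst x))\<^sup>2 - of_int (fst x) * of_int (snd x) + (of_int (snd x))\<^sup>2"
    by (simp add: power2_diff power_mult_distrib power_divide)
  finally show ?thesis by simp
qed

text \<open>The squared modulus is a positive integer.\<close>

lemma cmod_eis_ge_1: "x \<noteq> 0 \<Longrightarrow> 1 \<le> cmod (eis x)"
proof -
  assume "x \<noteq> 0"
  then have "fst x \<noteq> 0 \<or> snd x \<noteq> 0" by (auto simp: prod_eq_iff)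
  then have "0 < (2 * fst x - snd x)\<^sup>2 + 3 * (snd x)\<^sup>2"
    by (metis add_cancel_left_right add_nonneg_pos add_pos_nonneg mult_eq_0_iff not_less order_less_le power2_less_0 power_zero_numeral sum_power2_gt_zero_iff zero_less_mult_iff zero_less_numeral diff_zero mult_zero_right zero_less_power2 zero_neq_numeral)
  then have "0 < (fst x)\<^sup>2 - fst x * snd x + (snd x)\<^sup>2"
    by (simp add: power2_eq_square algebra_simps)
  then have "1 \<le> (cmod (eis x))\<^sup>2" unfolding cmod_eis_sq by linarith
  then show ?thesis by (metis norm_ge_zero one_le_power one_power2 power2_le_imp_le)
qed

lemma eis_eq_iff [simp]: "eis x = eis y \<longleftrightarrow> x = y"
  using cmod_eis_ge_1[of "x - y"] by (cases "x = y") (auto simp: eis_diff)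

lemma cmod_eis_unit: "u \<in> units \<Longrightarrow> cmod (eis u) = 1"
proof -
  assume "u \<in> units"
  then have "(cmod (eis u))\<^sup>2 = 1" unfolding cmod_eis_sq by (auto simp: units_def)
  then show ?thesis by (metis norm_ge_zero one_power2 power2_eq_imp_eq zero_le_one)
qed

lemma eis_scale: "eis (scale l x) = (if l then 2 + omega else 1 - omega) * eis x"
proof -
  have "eis (scale True x) = 2 * eis x + eis (rot x)" "eis (scale False x) = eis x - eis (rot x)"
    by (simp_all add: scale_unit eis_add eis_diff)
  then show ?thesis by (cases l) (simp_all add: eis_rot algebra_simps)
qed

lemma cmod_eis_scale: "cmod (eis (scale l x)) = sqrt 3 * cmod (eis x)"
proof -
  have "cmod (2 + omega) = sqrt 3" "cmod (1 - omega) = sqrt 3"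
    by (simp_all add: cmod_def power2_eq_square field_simps)
  then show ?thesis by (simp add: eis_scale norm_mult)
qed

text \<open>Choosing \<open>d\<close> also chooses an orientation, namely the directions d,
  d\<omega>, d\<omega>^2; \<open>- d\<close> describes the same tiling with the opposite
  one.\<close>

locale tri_tiling =
  fixes P :: "complex set set" and z0 d :: complex
  assumes d_neq_0: "d \<noteq> 0"
    and P_eq: "P = (\<Union>m n. {{lattice_point z0 d m n, lattice_point z0 d (m + 1) n,
                   lattice_point z0 d m (n + 1)},
                  {lattice_point z0 d (m + 1) (n + 1), lattice_point z0 d (m + 1) n,
                   lattice_point z0 d m (n + 1)}})"
begin

definition pos :: "point \<Rightarrow> complex" where
  "pos x = z0 + d * eis x"

definition side_of :: "point \<Rightarrow> point \<Rightarrow> side" where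
  "side_of v u = (pos (v - u), pos v)"

lemma pos_eq_iff [simp]: "pos x = pos y \<longleftrightarrow> x = y"
  using d_neq_0 by (simp add: pos_def)

lemma pos_add: "pos (x + y) = pos x + d * eis y" and pos_diff: "pos (x - y) = pos x - d * eis y"
  by (simp_all add: pos_def eis_add eis_diff algebra_simps)

text \<open>The change from the basis 1, 1 + \<omega> of the tiling to the basis 1,
  \<omega>.\<close>

lemma lattice_point_pos: "lattice_point z0 d m n = pos (m + n, n)"
  by (simp add: lattice_point_def pos_def eis_def cis_pi_third algebra_simps)

lemma triangles: "P = (\<Union>v. {{pos v, pos (v + (1, 0)), pos (v + (1, 1))},
    {pos (v + (2, 1)), pos (v + (1, 0)), pos (v + (1, 1))}})"
proof -
  have "(\<Union>v. f v) = (\<Union>m n. f (m + n, n))" for f :: "point \<Rightarrow> complex set set"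
  proof (intro equalityI subsetI)
    fix T assume "T \<in> (\<Union>v. f v)"
    then obtain a b where "T \<in> f (a, b)" by auto
    then have "T \<in> f ((a - b) + b, b)" by simp
    then show "T \<in> (\<Union>m n. f (m + n, n))" by blast
  qed blast
  then show ?thesis
    unfolding P_eq lattice_point_pos by (simp add: algebra_simps)
qed

text \<open>The symmetry about \<open>z0\<close> exchanges the two kinds of triangles. It transfers
  everything proved for the orientation of \<open>d\<close> to the opposite one.\<close>

lemma tri_tiling_minus: "tri_tiling P z0 (- d)"
proof
  show "- d \<noteq> 0" using d_neq_0 by simp
  have lp: "lattice_point z0 (- d) m n = lattice_point z0 d (- m) (- n)" for m n
    by (simp add: lattice_point_def algebra_simps)
  have reindex: "(\<Union>m n. f m n) = (\<Union>m n. f (- (m + 1)) (- (n + 1)))"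
    for f :: "int \<Rightarrow> int \<Rightarrow> complex set set"
  proof (intro equalityI subsetI)
    fix T assume "T \<in> (\<Union>m n. f m n)"
    then obtain m n where "T \<in> f m n" by blast
    then have "T \<in> f (- ((- m - 1) + 1)) (- ((- n - 1) + 1))" by simp
    then show "T \<in> (\<Union>m n. f (- (m + 1)) (- (n + 1)))" by blast
  qed blast
  show "P = (\<Union>m n. {{lattice_point z0 (- d) m n, lattice_point z0 (- d) (m + 1) n,
                   lattice_point z0 (- d) m (n + 1)},
                  {lattice_point z0 (- d) (m + 1) (n + 1), lattice_point z0 (- d) (m + 1) n,
                   lattice_point z0 (- d) m (n + 1)}})"
    unfolding lp P_eq by (subst reindex) (simp add: insert_commute)
qed

lemma units_or_minus: "e \<in> units \<or> - e \<in> units \<longleftrightarrow>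
    e \<in> {(1, 0), (0, 1), (- 1, - 1), (- 1, 0), (0, - 1), (1, 1)}"
  by (cases e) (auto simp: units_def)

lemma oriented_sides_eq:
  "oriented_sides P = {(pos v, pos (v + e)) | v e. e \<in> units \<or> - e \<in> units}" (is "_ = ?R")
proof
  define S where "S = ?R"
  have "oriented_sides P \<subseteq> S"
  proof
    fix A assume "A \<in> oriented_sides P"
    then obtain a b t where A: "A = (a, b)" "a \<noteq> b" "t \<in> P" "a \<in> t" "b \<in> t"
      by (auto simp: oriented_sides_def)
    have R: "(pos x, pos y) \<in> S" if "y - x \<in> {(1, 0), (0, 1), (- 1, - 1), (- 1, 0), (0, - 1), (1, 1)}" for x y
    proof -
      show ?thesis
        unfolding S_def using that units_or_minus[of "y - x"] by (intro CollectI exI[of _ x] exI[of _ "y - x"]) simp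
    qed
    from A(3) obtain v where "t = {pos v, pos (v + (1, 0)), pos (v + (1, 1))} \<or>
        t = {pos (v + (2, 1)), pos (v + (1, 0)), pos (v + (1, 1))}"
      unfolding triangles by blast
    then show "A \<in> S"
    proof
      assume "t = {pos v, pos (v + (1, 0)), pos (v + (1, 1))}"
      with A show ?thesis by (cases v) (auto intro!: R)
    next
      assume "t = {pos (v + (2, 1)), pos (v + (1, 0)), pos (v + (1, 1))}"
      with A show ?thesis by (cases v) (auto intro!: R)
    qed
  qed
  then show "oriented_sides P \<subseteq> ?R" unfolding S_def .
  have pos: "\<exists>t\<in>P. pos v \<in> t \<and> pos (v + e) \<in> t" if "e \<in> units" for v e
  proof -
    have T: "{pos w, pos (w + (1, 0)), pos (w + (1, 1))} \<in> P" for w unfolding triangles by blast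
    consider "e = (1, 0)" | "e = (0, 1)" | "e = (- 1, - 1)" using \<open>e \<in> units\<close> by (auto simp: units_def)
    then show ?thesis
    proof cases
      case 1 then show ?thesis using T[of v] by blast
    next
      case 2
      have "v - (1, 0) + (1, 0) = v" "v - (1, 0) + (1, 1) = v + e" by (simp_all add: 2 prod_eq_iff)
      then show ?thesis using T[of "v - (1, 0)"] by (metis insertCI)
    next
      case 3
      have "v + e + (1, 1) = v" by (simp add: 3 prod_eq_iff)
      then show ?thesis using T[of "v + e"] by (metis insertCI)
    qed
  qed
  show "?R \<subseteq> oriented_sides P"
  proof
    fix A assume "A \<in> ?R"
    then obtain v e where A: "A = (pos v, pos (v + e))" and e: "e \<in> units \<or> - e \<in> units" by blast
    have "e \<noteq> 0" using e by (auto simp: units_def zero_prod_def)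
    moreover have "\<exists>t\<in>P. pos v \<in> t \<and> pos (v + e) \<in> t"
      using e pos[of e v] pos[of "- e" "v + e"] by auto
    ultimately show "A \<in> oriented_sides P" by (auto simp: A oriented_sides_def)
  qed
qed

lemma side_of_in: "u \<in> units \<Longrightarrow> side_of v u \<in> oriented_sides P"
  unfolding oriented_sides_eq side_of_def by (intro CollectI exI[of _ "v - u"] exI[of _ u]) simp

lemma dir_side [simp]: "dir (pos v, pos (v + e)) = d * eis e"
  by (simp add: dir_def pos_add)

text \<open>An angle of \<pi>/3 between the segments means that the direction of travel is
  multiplied by \<omega> or \<omega>^2.\<close>

lemma joined_pos:
  "joined (pos v, pos (v + e)) (pos w, pos (w + f)) \<longleftrightarrow> w = v + e \<and> (f = rot e \<or> f = rot (rot e))"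
proof -
  have "eis f = (1 + omega) * (- eis e) \<longleftrightarrow> f = rot (rot e)"
  proof -
    have "(1 + omega) * (- eis e) = eis (rot (rot e))"
      using omega_sq by (simp add: eis_rot algebra_simps) (metis add.commute diff_minus_eq_add minus_add_distrib mult.assoc mult_minus_left mult_1 distrib_right)
    then show ?thesis by simp
  qed
  moreover have "eis f = (- omega) * (- eis e) \<longleftrightarrow> f = rot e"
    using eis_rot[of e] by (metis eis_eq_iff minus_mult_minus)
  moreover have "pos (w + f) - pos w = d * eis f" "pos v - pos (v + e) = - (d * eis e)"
    by (simp_all add: pos_add)
  moreover have "d * eis f = k * - (d * eis e) \<longleftrightarrow> eis f = k * - eis e" for k
    using d_neq_0 by (metis mult.left_commute mult_cancel_left mult_minus_right)
  ultimately show ?thesis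
    unfolding joined_def fst_conv snd_conv cis_pi_third by (simp only: pos_eq_iff) blast
qed

lemma turn_pos:
  assumes "e \<in> units \<or> - e \<in> units"
  shows "turn (pos v, pos (v + e)) (pos w, pos (w + rot e)) = 1"
    "turn (pos v, pos (v + e)) (pos w, pos (w + rot (rot e))) = - 1"
proof -
  define z where "z = d * eis e"
  have "e \<noteq> 0"
  proof
    assume "e = 0"
    with assms show False by (simp add: units_def zero_prod_def)
  qed
  then have "eis e \<noteq> 0" using eis_eq_iff[of e 0] by (simp del: eis_eq_iff)
  then have "z \<noteq> 0" using d_neq_0 by (simp add: z_def)
  then have z: "0 < (cmod z)\<^sup>2" by simp
  have zz: "cnj z * z = of_real ((cmod z)\<^sup>2)"
    by (simp add: complex_norm_square[symmetric] mult.commute)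
  have "cnj z * (d * eis (rot e)) = (cnj z * z) * omega"
    by (simp add: eis_rot z_def)
  then have "cnj z * (d * eis (rot e)) = of_real ((cmod z)\<^sup>2) * omega"
    unfolding zz .
  then show "turn (pos v, pos (v + e)) (pos w, pos (w + rot e)) = 1"
    using z by (simp add: turn_def z_def[symmetric])
  have "cnj z * (d * eis (rot (rot e))) = (cnj z * z) * (omega * omega)"
    by (simp add: eis_rot z_def)
  then have "cnj z * (d * eis (rot (rot e))) = of_real ((cmod z)\<^sup>2) * (omega * omega)"
    unfolding zz .
  then show "turn (pos v, pos (v + e)) (pos w, pos (w + rot (rot e))) = - 1"
    using z by (simp add: turn_def z_def[symmetric] omega_sq not_less)
qed

definition positive_curve :: "(int \<Rightarrow> side) \<Rightarrow> (int \<Rightarrow> point) \<Rightarrow> (int \<Rightarrow> point) \<Rightarrow> bool" where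
  "positive_curve c v u \<longleftrightarrow> path (left_turns c) v u \<and> (\<forall>k. c k = side_of (v k) (u k))"

lemma tcurve_steps:
  assumes "complete_tcurve P c"
  obtains v u where "\<And>k. c k = side_of (v k) (u k)" "\<And>k. u k \<in> units \<or> - u k \<in> units"
    "\<And>k. u (k + 1) = (if left_turns c k then rot (u k) else rot (rot (u k)))"
    "\<And>k. v (k + 1) = v k + u (k + 1)"
proof -
  have "\<exists>x e. c k = side_of x e \<and> (e \<in> units \<or> - e \<in> units)" for k
  proof -
    have "c k \<in> oriented_sides P" using assms by (simp add: complete_tcurve_def)
    then obtain x e where "c k = (pos x, pos (x + e))" "e \<in> units \<or> - e \<in> units"
      unfolding oriented_sides_eq by blast
    then show ?thesis by (intro exI[of _ "x + e"] exI[of _ e]) (simp add: side_of_def)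
  qed
  then obtain v u where c: "\<And>k. c k = side_of (v k) (u k)" "\<And>k. u k \<in> units \<or> - u k \<in> units"
    by metis
  have c': "c k = (pos (v k - u k), pos (v k - u k + u k))" for k
    by (simp add: c side_of_def)
  have j: "v (k + 1) - u (k + 1) = v k \<and> (u (k + 1) = rot (u k) \<or> u (k + 1) = rot (rot (u k)))" for k
  proof -
    have "joined (c k) (c (k + 1))" using assms by (simp add: complete_tcurve_def)
    then show ?thesis unfolding c'[of k] c'[of "k + 1"] joined_pos by simp
  qed
  have "u (k + 1) = (if left_turns c k then rot (u k) else rot (rot (u k)))" for k
    using j[of k] turn_pos[OF c(2)[of k], of "v k - u k" "v (k + 1) - u (k + 1)"]
    unfolding left_turns_def c'[of k] c'[of "k + 1"] by auto
  moreover have "v (k + 1) = v k + u (k + 1)" for k using j[of k] by (metis diff_add_cancel)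
  ultimately show ?thesis using that c by blast
qed

text \<open>Turns multiply the direction by cube roots of unity, so one segment decides the
  orientation of the whole curve.\<close>

lemma tcurve_positive:
  assumes "complete_tcurve P c" "c k0 = side_of x e" "e \<in> units"
  shows "\<exists>v u. positive_curve c v u"
proof -
  obtain v u where c: "\<And>k. c k = side_of (v k) (u k)" "\<And>k. u k \<in> units \<or> - u k \<in> units"
    and s: "\<And>k. u (k + 1) = (if left_turns c k then rot (u k) else rot (rot (u k)))"
    "\<And>k. v (k + 1) = v k + u (k + 1)"
    using tcurve_steps[OF assms(1)] by blast
  have "u k0 = e" using c(1)[of k0] assms(2) by (auto simp: side_of_def prod_eq_iff)
  then have 0: "u k0 \<in> units" using assms(3) by simp
  have st: "u (k + 1) \<in> units \<longleftrightarrow> u k \<in> units" for k using s(1)[of k] by simp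
  have "u k \<in> units" for k
  proof (induction k rule: int_induct[where k = k0])
    case (step2 i)
    then show ?case using st[of "i - 1"] by simp
  qed (use 0 st in auto)
  then show ?thesis using c(1) s unfolding positive_curve_def path_def by blast
qed

end

section \<open>From coverings to signs on the lattice\<close>

lemma turns_snoc: "As \<noteq> [] \<Longrightarrow> turns (As @ [B]) = turns As @ [turn (last As) B]"
proof (induction As)
  case (Cons A As)
  then show ?case by (cases As) (simp_all add: turns_def)
qed simp

lemma turns_Cons: "As \<noteq> [] \<Longrightarrow> turns (B # As) = turn B (hd As) # turns As"
  by (cases As) (simp_all add: turns_def)

lemma set_folding_word: "sign_sequence \<Lambda> \<Longrightarrow> set (folding_word \<Lambda> n) \<subseteq> {- 1, 1}"
  by (induction n) (auto simp: sign_sequence_def)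

text \<open>The base point is chosen anew for each \<open>n\<close>, so no vertex has to stay open
  at all levels.\<close>

definition carries :: "(point \<Rightarrow> bool) \<Rightarrow> (nat \<Rightarrow> int) \<Rightarrow> bool" where
  "carries \<sigma> \<Lambda> \<longleftrightarrow> sign_sequence \<Lambda> \<and> (\<forall>n. \<exists>b. \<forall>x. level_sign (signs \<Lambda> n) (x - b) \<noteq> Some (\<not> \<sigma> x))"

context tri_tiling
begin

text \<open>\<open>curve_associated\<close> asks for a t-curve of the tiling with a whole folding
  word as its turns. Bounded t-curves may revisit sides, so any turns can be appended.\<close>

lemma extend_right:
  assumes "bounded_tcurve P As" "set w \<subseteq> {- 1, 1}"
  shows "\<exists>Bs. bounded_tcurve P (As @ Bs) \<and> turns (As @ Bs) = turns As @ w"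
  using assms
proof (induction w arbitrary: As)
  case Nil
  then show ?case by (intro exI[of _ "[]"]) simp
next
  case (Cons t w)
  have ne: "As \<noteq> []" using Cons.prems(1) by (simp add: bounded_tcurve_def)
  then have "last As \<in> oriented_sides P" using Cons.prems(1) last_in_set unfolding bounded_tcurve_def by blast
  then obtain v e where l: "last As = (pos v, pos (v + e))" and e: "e \<in> units \<or> - e \<in> units"
    unfolding oriented_sides_eq by blast
  define f where "f = (if t = 1 then rot e else rot (rot e))"
  define B where "B = (pos (v + e), pos (v + e + f))"
  have f: "f \<in> units \<or> - f \<in> units" using e by (auto simp: f_def rot_minus[symmetric])
  have "turn (last As) B = t"
    using turn_pos[OF e, of v "v + e"] Cons.prems(2) by (auto simp: l B_def f_def)
  moreover have "joined (last As) B" unfolding l B_def joined_pos by (simp add: f_def)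
  moreover have "B \<in> oriented_sides P" unfolding oriented_sides_eq B_def using f by blast
  ultimately have "bounded_tcurve P (As @ [B])" "turns (As @ [B]) = turns As @ [t]"
    using Cons.prems(1) ne by (auto simp: bounded_tcurve_def successively_append_iff turns_snoc)
  with Cons.IH[of "As @ [B]"] Cons.prems(2)
  obtain Bs where "bounded_tcurve P ((As @ [B]) @ Bs)" "turns ((As @ [B]) @ Bs) = (turns As @ [t]) @ w"
    by auto
  then show ?case by (intro exI[of _ "B # Bs"]) simp
qed

lemma extend_left:
  assumes "bounded_tcurve P As" "set w \<subseteq> {- 1, 1}"
  shows "\<exists>Bs. bounded_tcurve P (Bs @ As) \<and> turns (Bs @ As) = w @ turns As"
  using assms
proof (induction w arbitrary: As rule: rev_induct)
  case Nil
  then show ?case by (intro exI[of _ "[]"]) simp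
next
  case (snoc t w)
  have ne: "As \<noteq> []" using snoc.prems(1) by (simp add: bounded_tcurve_def)
  then have "hd As \<in> oriented_sides P" using snoc.prems(1) hd_in_set unfolding bounded_tcurve_def by blast
  then obtain v e where h: "hd As = (pos v, pos (v + e))" and e: "e \<in> units \<or> - e \<in> units"
    unfolding oriented_sides_eq by blast
  define f where "f = (if t = 1 then rot (rot e) else rot e)"
  define B where "B = (pos (v - f), pos (v - f + f))"
  have f: "f \<in> units \<or> - f \<in> units" using e by (auto simp: f_def rot_minus[symmetric])
  have ef: "e = (if t = 1 then rot f else rot (rot f))" by (simp add: f_def)
  have "turn B (hd As) = t"
    using turn_pos[OF f, of "v - f" v] snoc.prems(2) unfolding h B_def by (subst ef) auto
  moreover have "joined B (hd As)" unfolding h B_def joined_pos by (simp add: f_def)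
  moreover have "B \<in> oriented_sides P" unfolding oriented_sides_eq B_def using f by blast
  ultimately have "bounded_tcurve P (B # As)" "turns (B # As) = t # turns As"
    using snoc.prems(1) ne by (auto simp: bounded_tcurve_def successively_Cons turns_Cons)
  with snoc.IH[of "B # As"] snoc.prems(2)
  obtain Bs where "bounded_tcurve P (Bs @ B # As)" "turns (Bs @ B # As) = w @ t # turns As"
    by auto
  then show ?case by (intro exI[of _ "Bs @ [B]"]) simp
qed

lemma curve_associatedI:
  assumes c: "complete_tcurve P c" and \<Lambda>: "sign_sequence \<Lambda>"
    and f: "\<And>n. \<exists>s. follows (left_turns c) s (signs \<Lambda> n)"
  shows "curve_associated P \<Lambda> c"
  unfolding curve_associated_def
proof (intro allI)
  fix p q
  show "\<exists>n As. bounded_tcurve P As \<and> turns As = folding_word \<Lambda> n \<and> sublist (subcurve c p q) As"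
  proof (cases "p \<le> q")
    case True
    have "successively joined (subcurve c p q)"
      using c by (auto simp: successively_conv_nth subcurve_def complete_tcurve_def algebra_simps)
    then have b: "bounded_tcurve P (subcurve c p q)"
      using c True by (auto simp: bounded_tcurve_def subcurve_def complete_tcurve_def)
    define n where "n = nat (q - p) + 1"
    have "q - p < 3 ^ n"
    proof -
      have "int n < 2 ^ n" by (rule of_nat_less_two_power)
      also have "(2::int) ^ n \<le> 3 ^ n" by (rule power_mono) simp_all
      finally have "int n < 3 ^ n" .
      moreover have "int n = q - p + 1" using True by (simp add: n_def)
      ultimately show ?thesis by linarith
    qed
    moreover obtain s where "follows (left_turns c) s (signs \<Lambda> n)" using f by blast
    ultimately have "sublist (turns (subcurve c p q)) (folding_word \<Lambda> (Suc n))"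
      unfolding turns_subcurve using follows_sublist[OF \<Lambda>] by blast
    then obtain ps ss where e: "folding_word \<Lambda> (Suc n) = ps @ turns (subcurve c p q) @ ss"
      by (auto simp: sublist_def)
    have "set ps \<subseteq> {- 1, 1}" "set ss \<subseteq> {- 1, 1}"
      using set_folding_word[OF \<Lambda>, of "Suc n"] unfolding e by auto
    then obtain Bs where Bs: "bounded_tcurve P (subcurve c p q @ Bs)"
      "turns (subcurve c p q @ Bs) = turns (subcurve c p q) @ ss"
      using extend_right[OF b] by blast
    then obtain As where "bounded_tcurve P (As @ subcurve c p q @ Bs)"
      "turns (As @ subcurve c p q @ Bs) = folding_word \<Lambda> (Suc n)"
      using extend_left[OF Bs(1) \<open>set ps \<subseteq> {- 1, 1}\<close>] e by auto
    then show ?thesis by (metis sublist_appendI)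
  next
    case False
    have "bounded_tcurve P [c 0]" "turns [c 0] = folding_word \<Lambda> 0"
      using c by (simp_all add: bounded_tcurve_def complete_tcurve_def turns_def)
    moreover have "sublist (subcurve c p q) [c 0]" using False by (simp add: subcurve_def)
    ultimately show ?thesis by blast
  qed
qed

lemma curve_associatedD:
  assumes c: "curve_associated P \<Lambda> c" and \<Lambda>: "sign_sequence \<Lambda>"
  shows "\<exists>s. follows (left_turns c) s (signs \<Lambda> n)"
proof -
  have "\<exists>s ls. length ls = n \<and> ls = signs \<Lambda> n \<and>
    (\<forall>k. \<bar>k\<bar> \<le> int N \<longrightarrow> seq_sign ls (k - s) \<noteq> Some (\<not> left_turns c k))" for N
  proof -
    \<comment> \<open>The window is enlarged by \<open>3 ^ n\<close> to meet the length bound of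
      \<open>sublist_follows\<close>.\<close>
    define q where "q = int N + 3 ^ n"
    obtain m As where As: "turns As = folding_word \<Lambda> m" "sublist (subcurve c (- int N) (q + 1)) As"
      using c unfolding curve_associated_def by blast
    then obtain ps ss where As': "As = ps @ subcurve c (- int N) (q + 1) @ ss" by (auto simp: sublist_def)
    define M where "M = subcurve c (- int N) (q + 1)"
    have "(0::int) < 3 ^ n" by simp
    then have "- int N \<le> q + 1" unfolding q_def by linarith
    then have ne: "M \<noteq> []" by (simp add: M_def subcurve_def)
    have right: "\<exists>w. turns (M @ ss) = turns M @ w"
    proof (induction ss rule: rev_induct)
      case (snoc x xs)
      then show ?case using ne turns_snoc[of "M @ xs" x] by auto
    qed auto
    have left: "\<exists>w. turns (ps @ M @ ss) = w @ turns (M @ ss)" for ss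
    proof (induction ps)
      case (Cons x xs)
      then show ?case using ne turns_Cons[of "xs @ M @ ss" x] by auto
    qed auto
    have "sublist (turns M) (turns As)"
      using right left[of ss] unfolding As' M_def[symmetric] by (metis sublist_appendI)
    then have "sublist (map (\<lambda>k. sign_of (left_turns c k)) [- int N..q]) (folding_word \<Lambda> m)"
      by (simp add: As(1) M_def turns_subcurve)
    from sublist_follows[OF \<Lambda> this, of n] obtain s
      where "\<And>k. - int N \<le> k \<Longrightarrow> k \<le> q \<Longrightarrow> seq_sign (signs \<Lambda> n) (k - s) \<noteq> Some (\<not> left_turns c k)"
      by (auto simp: q_def)
    moreover have "int N \<le> q" by (simp add: q_def)
    ultimately show ?thesis by (intro exI[of _ s] exI[of _ "signs \<Lambda> n"]) auto
  qed
  from follows_compact[OF this] show ?thesis by auto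
qed

text \<open>From here on a covering with the orientation of \<open>d\<close> is represented by a
  function on the lattice.\<close>

definition describes :: "(point \<Rightarrow> bool) \<Rightarrow> (int \<Rightarrow> side) set \<Rightarrow> bool" where
  "describes \<sigma> C \<longleftrightarrow>
     (\<forall>c\<in>C. \<exists>v u. positive_curve c v u \<and> (\<forall>k. left_turns c k = \<sigma> (v k))) \<and>
     (\<forall>v u. u \<in> units \<longrightarrow> (\<exists>c\<in>C. \<exists>k. c k = side_of v u))"

lemma units_neg: "u \<in> units \<Longrightarrow> w \<in> units \<Longrightarrow> u \<noteq> - w"
  by (auto simp: units_def)

lemma side_of_eq_iff [simp]: "side_of v u = side_of w x \<longleftrightarrow> v = w \<and> u = x"
  by (auto simp: side_of_def prod_eq_iff)

lemma support_side_of: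
  assumes "u \<in> units" "x \<in> units" "support (side_of v u) = support (side_of w x)"
  shows "v = w \<and> u = x"
proof -
  have "{v - u, v} = {w - x, w}"
    using assms(3) by (auto simp: support_def side_of_def doubleton_eq_iff)
  then consider "v - u = w - x" "v = w" | "v - u = w" "v = w - x"
    by (auto simp: doubleton_eq_iff)
  then show ?thesis
  proof cases
    case 2
    then have "u = - x" by (simp add: eq_neg_iff_add_eq_0 algebra_simps)
    then show ?thesis using units_neg[OF assms(1,2)] by simp
  qed simp
qed

lemma covering_side_unique:
  assumes cov: "covering P C" and c: "c \<in> C" "c' \<in> C" and s: "c k = side_of v u" "c' k' = side_of v u"
    and u: "u \<in> units"
  shows "c = c' \<and> k = k'"
proof -
  have "\<exists>!(c, k). c \<in> C \<and> support (c k) = support (side_of v u)"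
    using cov side_of_in[OF u] unfolding covering_def by blast
  then obtain z where z: "\<forall>y. (case y of (c, k) \<Rightarrow> c \<in> C \<and> support (c k) = support (side_of v u)) \<longrightarrow> y = z"
    by (elim ex1E) blast
  have "(c, k) = z" "(c', k') = z"
    using z[rule_format, of "(c, k)"] z[rule_format, of "(c', k')"] c s by simp_all
  then show ?thesis by auto
qed

text \<open>The three passages at a vertex leave along different sides. If \<open>u\<close> turns
  left it leaves along \<open>rot u\<close>; were \<open>rot u\<close> to turn right it would leave
  along \<open>u\<close>, and both exits of the third passage would be taken.\<close>

lemma covering_describes:
  assumes cov: "covering P C" and pos: "\<And>c. c \<in> C \<Longrightarrow> \<exists>v u. positive_curve c v u"
  shows "\<exists>\<sigma>. describes \<sigma> C"
proof -
  have ex: "\<exists>c\<in>C. \<exists>k. c k = side_of v u" if u: "u \<in> units" for v u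
  proof -
    obtain c k where ck: "c \<in> C" "support (c k) = support (side_of v u)"
      using cov side_of_in[OF u] unfolding covering_def by blast
    obtain v' u' where "positive_curve c v' u'" using pos[OF ck(1)] by blast
    then have "c k = side_of (v' k) (u' k)" "u' k \<in> units"
      by (auto simp: positive_curve_def path_def)
    then show ?thesis using support_side_of[OF _ u, of "u' k" "v' k" v] ck by metis
  qed
  define t where "t = (\<lambda>v u. \<exists>c\<in>C. \<exists>k. c k = side_of v u \<and> left_turns c k)"
  have t: "t v u = left_turns c k" if "c \<in> C" "c k = side_of v u" "u \<in> units" for c k v u
    using that covering_side_unique[OF cov] unfolding t_def by metis
  have nxt: "c (k + 1) = side_of (v + (if t v u then rot u else rot (rot u))) (if t v u then rot u else rot (rot u))"
    if h: "c \<in> C" "c k = side_of v u" "u \<in> units" for c k v u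
  proof -
    obtain v' u' where p: "positive_curve c v' u'" using pos[OF h(1)] by blast
    then have vk: "v' k = v" "u' k = u" using h(2) by (auto simp: positive_curve_def)
    have "c (k + 1) = side_of (v' (k + 1)) (u' (k + 1))" "v' (k + 1) = v' k + u' (k + 1)"
      "u' (k + 1) = (if left_turns c k then rot (u' k) else rot (rot (u' k)))"
      using p by (simp_all add: positive_curve_def path_def)
    then show ?thesis by (simp only: vk t[OF h])
  qed
  have inj: "(if t v u then rot u else rot (rot u)) \<noteq> (if t v w then rot w else rot (rot w))"
    if h: "u \<in> units" "w \<in> units" "u \<noteq> w" for v u w
  proof
    assume eq: "(if t v u then rot u else rot (rot u)) = (if t v w then rot w else rot (rot w))"
    obtain c k where c: "c \<in> C" "c k = side_of v u" using ex[OF h(1)] by blast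
    obtain c' k' where c': "c' \<in> C" "c' k' = side_of v w" using ex[OF h(2)] by blast
    define x where "x = (if t v u then rot u else rot (rot u))"
    have x: "x \<in> units" using h(1) by (simp add: x_def)
    have "c (k + 1) = side_of (v + x) x" "c' (k' + 1) = side_of (v + x) x"
      using nxt[OF c h(1)] nxt[OF c' h(2)] eq by (simp_all add: x_def)
    then have "c = c' \<and> k + 1 = k' + 1"
      by (rule covering_side_unique[OF cov c(1) c'(1) _ _ x])
    then show False using c c' h(3) by simp
  qed
  have "t v (rot u)" if u: "u \<in> units" and "t v u" for v u
  proof (rule ccontr)
    assume n: "\<not> t v (rot u)"
    have "u \<noteq> rot (rot u)" using rot_neq[of "rot (rot u)"] u by auto
    then show False
      using inj[of "rot u" "rot (rot u)" v] inj[of u "rot (rot u)" v] rot_neq[of "rot u"] u that n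
      by (cases "t v (rot (rot u))") auto
  qed
  then have T: "t v u \<Longrightarrow> u \<in> units \<Longrightarrow> t v (rot u)" for v u by blast
  have cyc: "t v u = t v w" if h: "u \<in> units" "w \<in> units" for v u w
  proof -
    have "t v u \<longleftrightarrow> t v (rot u)" "t v (rot u) \<longleftrightarrow> t v (rot (rot u))"
      using T[of v u] T[of v "rot u"] T[of v "rot (rot u)"] h(1) by auto
    then show ?thesis using units_cases[OF h] by auto
  qed
  have "describes (\<lambda>v. t v (1, 0)) C"
    unfolding describes_def
  proof (intro conjI ballI allI impI)
    fix c assume c: "c \<in> C"
    obtain v u where p: "positive_curve c v u" using pos[OF c] by blast
    have "left_turns c k = t (v k) (1, 0)" for k
    proof -
      have "c k = side_of (v k) (u k)" "u k \<in> units" using p by (auto simp: positive_curve_def path_def)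
      moreover have "(1, 0) \<in> units" by (simp add: units_def)
      ultimately show ?thesis using t[OF c, of k "v k" "u k"] cyc[of "u k" "(1, 0)" "v k"] by simp
    qed
    then show "\<exists>v u. positive_curve c v u \<and> (\<forall>k. left_turns c k = t (v k) (1, 0))" using p by blast
  qed (use ex in blast)
  then show ?thesis by blast
qed

text \<open>The type is chosen once per curve, which makes it constant along the curve.\<close>

lemma describes_typed:
  assumes cov: "folding_covering P C" and d: "describes \<sigma> C"
  shows "\<exists>ty. typed_covering \<sigma> ty n"
proof -
  have cov': "covering P C" using cov by (simp add: folding_covering_def)
  have "\<forall>c\<in>C. \<exists>t. length (snd t) = Suc n \<and>
      (\<forall>v u k. c k = side_of v u \<longrightarrow> level_sign (snd t) (v - fst t) \<noteq> Some (\<not> \<sigma> v))"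
  proof
    fix c assume c: "c \<in> C"
    obtain v u where p: "positive_curve c v u" "\<And>k. left_turns c k = \<sigma> (v k)"
      using d c unfolding describes_def by blast
    obtain s ls where ls: "length ls = Suc n" "follows (left_turns c) s ls"
      using folding_curve_follows cov c unfolding folding_covering_def by blast
    obtain b where b: "\<And>k. level_sign ls (v k - b) \<noteq> Some (\<not> left_turns c k)"
      using level_sign_of_follows[OF _ ls(2)] p(1) unfolding positive_curve_def by blast
    have "level_sign ls (w - b) \<noteq> Some (\<not> \<sigma> w)" if "c k = side_of w x" for w x k
    proof -
      have "w = v k" using p(1) that by (simp add: positive_curve_def)
      then show ?thesis using b[of k] p(2)[of k] by simp
    qed
    then show "\<exists>t. length (snd t) = Suc n \<and>
        (\<forall>v u k. c k = side_of v u \<longrightarrow> level_sign (snd t) (v - fst t) \<noteq> Some (\<not> \<sigma> v))"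
      using ls(1) by (intro exI[of _ "(b, ls)"]) simp
  qed
  from bchoice[OF this] obtain tc where tc: "\<And>c. c \<in> C \<Longrightarrow> length (snd (tc c)) = Suc n"
    "\<And>c v u k. c \<in> C \<Longrightarrow> c k = side_of v u \<Longrightarrow> level_sign (snd (tc c)) (v - fst (tc c)) \<noteq> Some (\<not> \<sigma> v)"
    by blast
  define cur where "cur = (\<lambda>v u. SOME c. c \<in> C \<and> (\<exists>k. c k = side_of v u))"
  have cur: "cur v u \<in> C \<and> (\<exists>k. cur v u k = side_of v u)" if "u \<in> units" for v u
  proof -
    have "\<exists>c. c \<in> C \<and> (\<exists>k. c k = side_of v u)" using d that unfolding describes_def by blast
    from someI_ex[OF this] show ?thesis unfolding cur_def .
  qed
  have cur_eq: "cur v u = c" if "c \<in> C" "c k = side_of v u" "u \<in> units" for c k v u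
    using cur[OF that(3), of v] covering_side_unique[OF cov'] that by blast
  have "typed_covering \<sigma> (\<lambda>v u. tc (cur v u)) n"
  proof
    fix u v assume u: "u \<in> units"
    obtain k where k: "cur v u \<in> C" "cur v u k = side_of v u" using cur[OF u] by blast
    obtain v' u' where p: "positive_curve (cur v u) v' u'" "\<And>k. left_turns (cur v u) k = \<sigma> (v' k)"
      using d k(1) unfolding describes_def by blast
    have vk: "v' k = v" "u' k = u" using p(1) k(2) by (auto simp: positive_curve_def)
    have "cur v u (k + 1) = side_of (v' (k + 1)) (u' (k + 1))" "v' (k + 1) = v' k + u' (k + 1)"
      "u' (k + 1) = new_dir \<sigma> (v' k) (u' k)"
      using p by (simp_all add: positive_curve_def path_def new_dir_def)
    then have "cur v u (k + 1) = side_of (v + new_dir \<sigma> v u) (new_dir \<sigma> v u)"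
      by (simp only: vk)
    then have "cur (v + new_dir \<sigma> v u) (new_dir \<sigma> v u) = cur v u"
      using cur_eq[OF k(1)] u by (simp add: new_dir_def)
    then show "tc (cur (v + new_dir \<sigma> v u) (new_dir \<sigma> v u)) = tc (cur v u)" by simp
    show "level_sign (snd (tc (cur v u))) (v - fst (tc (cur v u))) \<noteq> Some (\<not> \<sigma> v)"
      using tc(2)[OF k] .
    show "length (snd (tc (cur v u))) = Suc n" using tc(1)[OF k(1)] .
  qed
  then show ?thesis by blast
qed

lemma describes_path:
  assumes "describes \<sigma> C"
  obtains c v u where "c \<in> C" "positive_curve c v u" "\<And>k. left_turns c k = \<sigma> (v k)"
    "path (\<lambda>k. \<sigma> (v k)) v u" "left_turns c = (\<lambda>k. \<sigma> (v k))"
proof -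
  have "(1, 0) \<in> units" by (simp add: units_def)
  then obtain c where c: "c \<in> C" using assms unfolding describes_def by blast
  then obtain v u where p: "positive_curve c v u" "\<And>k. left_turns c k = \<sigma> (v k)"
    using assms unfolding describes_def by blast
  then have "left_turns c = (\<lambda>k. \<sigma> (v k))" by auto
  then show ?thesis using that c p by (metis positive_curve_def)
qed

text \<open>\<open>common_type\<close> gives a separate list for every \<open>n\<close>. All of them
  are followed by one curve, so \<open>follows_unique\<close> makes them agree up to their last
  signs.\<close>

lemma describes_carries:
  assumes cov: "folding_covering P C" and d: "describes \<sigma> C"
  shows "\<exists>\<Lambda>. carries \<sigma> \<Lambda>"
proof -
  have "\<exists>b ls. length ls = n \<and> (\<forall>x. level_sign ls (x - b) \<noteq> Some (\<not> \<sigma> x))" for n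
    using describes_typed[OF cov d, of "n + 6"] common_type by blast
  then obtain b ls where ls: "\<And>n. length (ls n) = n"
    "\<And>n x. level_sign (ls n) (x - b n) \<noteq> Some (\<not> \<sigma> x)"
    by metis
  obtain c v u where p: "path (\<lambda>k. \<sigma> (v k)) v u"
    using describes_path[OF d] by metis
  have f: "\<exists>s. follows (\<lambda>k. \<sigma> (v k)) s (ls n)" for n
    by (rule follows_of_level_sign[OF p ls(2)])
  have pre: "ls (Suc (Suc i)) ! i = ls (Suc n) ! i" if "i < n" for i n
  proof -
    obtain s s' where s: "follows (\<lambda>k. \<sigma> (v k)) s (ls (Suc (Suc i)))" "follows (\<lambda>k. \<sigma> (v k)) s' (ls (Suc n))"
      using f by blast
    have "take (Suc i) (ls (Suc (Suc i))) = take (Suc i) (take (Suc (Suc i)) (ls (Suc n)))"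
      by (rule follows_unique[OF s(1) follows_take[OF s(2)]]) (use that in \<open>simp_all add: ls\<close>)
    then have "take (Suc i) (ls (Suc (Suc i))) ! i = take (Suc i) (take (Suc (Suc i)) (ls (Suc n))) ! i"
      by simp
    then show ?thesis by simp
  qed
  \<comment> \<open>Entry \<open>i\<close> is taken from the list of length \<open>i + 2\<close>,
    because the last sign of a list is not determined by the curve.\<close>
  define \<Lambda> where "\<Lambda> = (\<lambda>n. case n of 0 \<Rightarrow> 1 | Suc i \<Rightarrow> sign_of (ls (Suc (Suc i)) ! i))"
  have "signs \<Lambda> n = take n (ls (Suc n))" for n
    by (rule nth_equalityI) (auto simp: ls signs_def \<Lambda>_def sign_of_def pre)
  then have "level_sign (signs \<Lambda> n) (x - b (Suc n)) \<noteq> Some (\<not> \<sigma> x)" for n x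
    using level_sign_take[of n "ls (Suc n)" "x - b (Suc n)"] ls(2)[of "Suc n" x] by auto
  moreover have "sign_sequence \<Lambda>"
    unfolding sign_sequence_def \<Lambda>_def by (auto simp: sign_of_def split: nat.split)
  ultimately show ?thesis unfolding carries_def by blast
qed

lemma carries_covering_associated:
  assumes cov: "covering P C" and d: "describes \<sigma> C" and ca: "carries \<sigma> \<Lambda>"
  shows "covering_associated P \<Lambda> C"
  unfolding covering_associated_def
proof
  fix c assume c: "c \<in> C"
  obtain v u where p: "positive_curve c v u" "\<And>k. left_turns c k = \<sigma> (v k)"
    using d c unfolding describes_def by blast
  then have lt: "left_turns c = (\<lambda>k. \<sigma> (v k))" by auto
  show "curve_associated P \<Lambda> c"
  proof (rule curve_associatedI)
    show "complete_tcurve P c" using cov c by (simp add: covering_def)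
    show "sign_sequence \<Lambda>" using ca by (simp add: carries_def)
    show "\<exists>s. follows (left_turns c) s (signs \<Lambda> n)" for n
      using ca follows_of_level_sign p(1) unfolding carries_def positive_curve_def lt by blast
  qed
qed

lemma covering_associated_carries:
  assumes d: "describes \<sigma> C" and ca: "carries \<sigma> \<Lambda>'" and \<Lambda>: "sign_sequence \<Lambda>"
    and as: "covering_associated P \<Lambda> C"
  shows "carries \<sigma> \<Lambda>"
proof -
  obtain c v u where c: "c \<in> C" "left_turns c = (\<lambda>k. \<sigma> (v k))" "path (\<lambda>k. \<sigma> (v k)) v u"
    using describes_path[OF d] by metis
  have "signs \<Lambda> n = signs \<Lambda>' n" for n
  proof -
    obtain s where s: "follows (left_turns c) s (signs \<Lambda> (Suc n))"
      using curve_associatedD[OF _ \<Lambda>] as c(1) unfolding covering_associated_def by blast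
    obtain s' where s': "follows (left_turns c) s' (signs \<Lambda>' (Suc n))"
      using ca follows_of_level_sign[OF c(3)] unfolding carries_def c(2) by blast
    from follows_unique[OF s s', of n] show ?thesis by (simp add: take_signs)
  qed
  then show ?thesis using ca \<Lambda> by (simp add: carries_def)
qed

end

section \<open>Local isomorphism for equal signs\<close>

fun scales :: "bool list \<Rightarrow> point \<Rightarrow> point" where
  "scales [] x = x"
| "scales (l # ls) x = scale l (scales ls x)"

lemma scales_diff: "scales ls (x - y) = scales ls x - scales ls y"
  by (induction ls) (simp_all add: scale_diff)

lemma level_sign_append_scales: "level_sign (ls @ ms) (scales ls x) = level_sign ms x"
  by (induction ls) simp_all

lemma level_sign_None: "level_sign ls x = None \<Longrightarrow> \<exists>w. x = scales ls w"
proof (induction ls arbitrary: x)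
  case (Cons l ls)
  then have c: "cls x = 0" using cls_range[of x] by auto
  then obtain w where "unscale l x = scales ls w" using Cons.IH[of "unscale l x"] Cons.prems by auto
  then have "x = scales (l # ls) w" using scale_unscale[OF c, of l] by simp
  then show ?case by blast
qed simp

lemma level_sign_period: "level_sign ls (x + scales ls w) = level_sign ls x"
proof (induction ls arbitrary: x)
  case (Cons l ls)
  have c: "cls (x + scales (l # ls) w) = cls x" by (simp add: cls_add)
  show ?case
  proof (cases "cls x = 0")
    case True
    have "x + scales (l # ls) w = scale l (unscale l x + scales ls w)"
      using scale_unscale[OF True, of l] by (simp add: scale_add)
    then have "unscale l (x + scales (l # ls) w) = unscale l x + scales ls w" by (metis unscale_scale)
    then show ?thesis using Cons[of "unscale l x"] c by simp
  next
    case False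
    then show ?thesis using c cls_range[of x] by auto
  qed
qed simp

lemma cmod_eis_scales: "cmod (eis (scales ls x)) = sqrt 3 ^ length ls * cmod (eis x)"
  by (induction ls) (simp_all add: cmod_eis_scale)

lemma eis_scales_mult: "\<exists>k. k \<noteq> 0 \<and> cmod k = sqrt 3 ^ length ls \<and> (\<forall>x. eis (scales ls x) = k * eis x)"
proof (induction ls)
  case Nil
  show ?case by (intro exI[of _ 1]) simp
next
  case (Cons l ls)
  then obtain k where k: "k \<noteq> 0" "cmod k = sqrt 3 ^ length ls" "\<And>x. eis (scales ls x) = k * eis x" by blast
  define m where "m = (if l then 2 + omega else 1 - omega)"
  have m: "eis (scale l x) = m * eis x" for x by (simp add: eis_scale m_def)
  have "cmod m = sqrt 3"
    using cmod_eis_scale[of l "(1, 0)"] m[of "(1, 0)"] by (simp add: norm_mult cmod_eis_unit units_def)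
  then show ?case
    using k by (intro exI[of _ "m * k"]) (auto simp: m norm_mult)
qed

lemma lattice_near:
  assumes "c = 0 \<or> c = 1 \<or> c = 2"
  shows "\<exists>w. cls w = c \<and> cmod (eis w - \<zeta>) \<le> 4"
proof -
  define b where "b = \<lfloor>Im \<zeta> / (sqrt 3 / 2)\<rfloor>"
  define a where "a = \<lfloor>Re \<zeta> + of_int b / 2\<rfloor>"
  \<comment> \<open>A shift by 0, 1 or 2 along the real axis, which adjusts the class.\<close>
  define k where "k = (c - (a + b)) mod 3"
  define w where "w = (a + k, b)"
  have "(a + k + b) mod 3 = ((a + b) + (c - (a + b)) mod 3) mod 3"
    by (simp add: k_def algebra_simps)
  also have "\<dots> = c mod 3" by (simp only: mod_add_right_eq) simp
  finally have "cls w = c" using assms by (auto simp: cls_def w_def)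
  have k: "0 \<le> k" "k < 3" by (simp_all add: k_def)
  have "of_int b \<le> Im \<zeta> / (sqrt 3 / 2)" "Im \<zeta> / (sqrt 3 / 2) < of_int b + 1"
    by (simp_all add: b_def)
  then have "of_int b * (sqrt 3 / 2) \<le> Im \<zeta>" "Im \<zeta> < (of_int b + 1) * (sqrt 3 / 2)"
    by (simp_all add: field_simps)
  then have "\<bar>of_int b * (sqrt 3 / 2) - Im \<zeta>\<bar> \<le> sqrt 3 / 2" by (simp add: algebra_simps)
  also have "sqrt 3 / 2 \<le> (1::real)" by (simp add: real_le_lsqrt)
  finally have "\<bar>Im (eis w - \<zeta>)\<bar> \<le> 1" by (simp add: eis_def w_def)
  moreover have "of_int a \<le> Re \<zeta> + of_int b / 2" "Re \<zeta> + of_int b / 2 < of_int a + 1"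
    by (simp_all add: a_def)
  then have "\<bar>Re (eis w - \<zeta>)\<bar> \<le> 3" using k by (simp add: eis_def w_def)
  ultimately have "cmod (eis w - \<zeta>) \<le> 4"
    using cmod_le[of "eis w - \<zeta>"] by linarith
  with \<open>cls w = c\<close> show ?thesis by blast
qed

context tri_tiling
begin

text \<open>The vertices left open by \<open>n\<close> signs form a coset of a lattice with minimal
  distance \<open>cmod d * sqrt 3 ^ n\<close>, so the ball contains at most one of them. Everywhere
  else the signs are periodic, so a translation matching the open cosets only has to be right at
  that one vertex; the next level offers both signs at bounded distance.\<close>

lemma carries_transfer:
  assumes ca: "carries \<sigma> \<Lambda>" "carries \<sigma>' \<Lambda>" and n: "2 * \<rho> < cmod d * sqrt 3 ^ n"
  shows "\<exists>t. cmod (X + d * eis t - Y) \<le> 4 * (cmod d * sqrt 3 ^ n) \<and>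
    (\<forall>v. cmod (pos v - X) \<le> \<rho> \<longrightarrow> \<sigma>' (v + t) = \<sigma> v)"
proof -
  define ls where "ls = signs \<Lambda> n"
  define l where "l = (\<Lambda> (Suc n) = 1)"
  have len: "length ls = n" by (simp add: ls_def)
  obtain b where b: "\<And>x. level_sign (ls @ [l]) (x - b) \<noteq> Some (\<not> \<sigma> x)"
    using ca(1) unfolding carries_def ls_def l_def signs_Suc[symmetric] by blast
  obtain b' where b': "\<And>x. level_sign (ls @ [l]) (x - b') \<noteq> Some (\<not> \<sigma>' x)"
    using ca(2) unfolding carries_def ls_def l_def signs_Suc[symmetric] by blast
  have prefix: "level_sign (ls @ [l]) x = Some s" if "level_sign ls x = Some s" for x s
    using level_sign_take[of n "ls @ [l]" x s] that by (simp add: len)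
  have unique: "w = w'"
    if "cmod (pos (b + scales ls w) - X) \<le> \<rho>" "cmod (pos (b + scales ls w') - X) \<le> \<rho>" for w w'
  proof (rule ccontr)
    assume "w \<noteq> w'"
    then have "1 \<le> cmod (eis (w - w'))" by (intro cmod_eis_ge_1) simp
    then have "cmod d * sqrt 3 ^ n \<le> cmod d * (sqrt 3 ^ n * cmod (eis (w - w')))"
      by (intro mult_left_mono) simp_all
    also have "\<dots> = cmod (d * eis (scales ls (w - w')))"
      by (simp only: norm_mult cmod_eis_scales len)
    also have "d * eis (scales ls (w - w')) = (pos (b + scales ls w) - X) - (pos (b + scales ls w') - X)"
      by (simp add: pos_def eis_add eis_diff scales_diff algebra_simps)
    also have "cmod \<dots> \<le> cmod (pos (b + scales ls w) - X) + cmod (pos (b + scales ls w') - X)"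
      by (rule norm_triangle_ineq4)
    finally show False using that n by linarith
  qed
  \<comment> \<open>If the ball contains no open vertex, \<open>ws\<close> is arbitrary.\<close>
  obtain ws where ws: "\<And>w. cmod (pos (b + scales ls w) - X) \<le> \<rho> \<Longrightarrow> w = ws"
    using unique by blast
  define vs where "vs = b + scales ls ws"
  \<comment> \<open>The class on which the sign of level \<open>n + 1\<close> equals
    \<open>\<sigma> vs\<close>.\<close>
  define c :: int where "c = (if \<sigma> vs = l then 1 else 2)"
  obtain k where k: "k \<noteq> 0" "cmod k = sqrt 3 ^ n" "\<And>x. eis (scales ls x) = k * eis x"
    using eis_scales_mult[of ls] by (auto simp: len)
  define \<zeta> where "\<zeta> = ((Y - X) / d - eis (b' - vs)) / k"
  have "c = 0 \<or> c = 1 \<or> c = 2" by (simp add: c_def)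
  from lattice_near[OF this, of \<zeta>] obtain w where w: "cls w = c" "cmod (eis w - \<zeta>) \<le> 4" by blast
  define t where "t = b' + scales ls w - vs"
  have "X + d * eis t - Y = d * k * (eis w - \<zeta>)"
    using k(1) d_neq_0 by (simp add: t_def eis_add eis_diff k(3) \<zeta>_def field_simps)
  then have "cmod (X + d * eis t - Y) = cmod d * sqrt 3 ^ n * cmod (eis w - \<zeta>)"
    by (simp add: norm_mult k(2))
  also have "\<dots> \<le> cmod d * sqrt 3 ^ n * 4"
    using w(2) by (intro mult_left_mono) simp_all
  finally have near: "cmod (X + d * eis t - Y) \<le> 4 * (cmod d * sqrt 3 ^ n)" by simp
  have "\<sigma>' (v + t) = \<sigma> v" if v: "cmod (pos v - X) \<le> \<rho>" for v
  proof (cases "level_sign ls (v - b)")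
    case None
    then obtain w' where w': "v - b = scales ls w'" using level_sign_None by blast
    then have "v = b + scales ls w'" by (simp add: algebra_simps)
    then have "v = vs" using ws[of w'] v by (simp add: vs_def)
    then have "v + t - b' = scales ls w" by (simp add: t_def)
    then have "level_sign (ls @ [l]) (v + t - b') = Some (\<sigma> v)"
      using w(1) \<open>v = vs\<close> by (auto simp: level_sign_append_scales c_def)
    then show ?thesis using b'[of "v + t"] by auto
  next
    case (Some s)
    have "v + t - b' = (v - b) + scales ls (w - ws)" by (simp add: t_def vs_def scales_diff)
    then have "level_sign ls (v + t - b') = Some s" using Some by (simp only: level_sign_period)
    then have "level_sign (ls @ [l]) (v + t - b') = Some s" by (rule prefix)
    then show ?thesis using prefix[OF Some] b[of v] b'[of "v + t"] by auto
  qed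
  with near show ?thesis by blast
qed

text \<open>What one passage contributes to the drawing, relative to its vertex: the incoming side
  and the arc that follows. Only direction and sign enter.\<close>

definition shape :: "real \<Rightarrow> bool \<Rightarrow> point \<Rightarrow> drawing" where
  "shape \<delta> s u =
     (\<lambda>x. (d * eis u * of_real (x - 1), sgn (d * eis u))) ` {\<delta>..1 - \<delta>} \<union>
     (\<lambda>\<theta>. (d * eis u * (- of_real \<delta> + \<i> * of_real (real_of_int (sign_of s) * \<delta> * tan (pi / 6)) * (1 - cis (sign_of s * \<theta>))),
        sgn (d * eis u) * cis (sign_of s * \<theta>))) ` {0..2 * pi / 3}"

lemma straight_part_side:
  "straight_part \<delta> (side_of v u) = (\<lambda>x. (pos v + d * eis u * of_real (x - 1), sgn (d * eis u))) ` {\<delta>..1 - \<delta>}"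
  unfolding straight_part_def
  by (rule image_cong) (simp_all add: side_of_def dir_def pos_diff algebra_simps)

lemma turn_side:
  assumes "u \<in> units"
  shows "turn (side_of v u) (side_of (v + new_dir \<sigma> v u) (new_dir \<sigma> v u)) = sign_of (\<sigma> v)"
  using turn_pos[of u "v - u" v] assms by (simp add: side_of_def new_dir_def sign_of_def)

lemma corner_arc_side:
  assumes "u \<in> units"
  shows "corner_arc \<delta> (side_of v u) (side_of (v + new_dir \<sigma> v u) (new_dir \<sigma> v u)) =
    (\<lambda>\<theta>. (pos v + d * eis u * (- of_real \<delta> + \<i> * of_real (real_of_int (sign_of (\<sigma> v)) * \<delta> * tan (pi / 6)) * (1 - cis (sign_of (\<sigma> v) * \<theta>))),
        sgn (d * eis u) * cis (sign_of (\<sigma> v) * \<theta>))) ` {0..2 * pi / 3}"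
  unfolding corner_arc_def turn_side[OF assms] Let_def
  by (rule image_cong) (simp_all add: side_of_def dir_def pos_diff algebra_simps)

lemma drawing_iff:
  assumes "describes \<sigma> C"
  shows "(p, \<tau>) \<in> drawing \<delta> C \<longleftrightarrow> (\<exists>v. \<exists>u\<in>units. (p - pos v, \<tau>) \<in> shape \<delta> (\<sigma> v) u)"
proof -
  define piece where "piece = (\<lambda>v u. straight_part \<delta> (side_of v u) \<union>
    corner_arc \<delta> (side_of v u) (side_of (v + new_dir \<sigma> v u) (new_dir \<sigma> v u)))"
  have nxt: "c k = side_of (v k) (u k)" "c (k + 1) = side_of (v k + new_dir \<sigma> (v k) (u k)) (new_dir \<sigma> (v k) (u k))"
      "u k \<in> units"
    if "positive_curve c v u" "\<And>k. left_turns c k = \<sigma> (v k)" for c v u k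
    using that by (simp_all add: positive_curve_def path_def new_dir_def)
  have pc: "(p, \<tau>) \<in> piece v u \<longleftrightarrow> (p - pos v, \<tau>) \<in> shape \<delta> (\<sigma> v) u" if "u \<in> units" for v u
    unfolding piece_def straight_part_side corner_arc_side[OF that] shape_def
    by (auto simp: image_iff algebra_simps)
  have "(p, \<tau>) \<in> drawing \<delta> C \<longleftrightarrow> (\<exists>v. \<exists>u\<in>units. (p, \<tau>) \<in> piece v u)"
  proof
    assume "(p, \<tau>) \<in> drawing \<delta> C"
    then obtain c k where c: "c \<in> C" and m: "(p, \<tau>) \<in> straight_part \<delta> (c k) \<union> corner_arc \<delta> (c k) (c (k + 1))"
      unfolding drawing_def by blast
    obtain v u where vu: "positive_curve c v u" "\<And>k. left_turns c k = \<sigma> (v k)"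
      using assms c unfolding describes_def by blast
    have "(p, \<tau>) \<in> piece (v k) (u k)"
      using m unfolding piece_def nxt(1,2)[OF vu, of k] .
    then show "\<exists>v. \<exists>u\<in>units. (p, \<tau>) \<in> piece v u" using nxt(3)[OF vu] by blast
  next
    assume "\<exists>v. \<exists>u\<in>units. (p, \<tau>) \<in> piece v u"
    then obtain w x where x: "x \<in> units" and m: "(p, \<tau>) \<in> piece w x" by blast
    obtain c k where c: "c \<in> C" "c k = side_of w x" using assms x unfolding describes_def by blast
    obtain v u where vu: "positive_curve c v u" "\<And>k. left_turns c k = \<sigma> (v k)"
      using assms c unfolding describes_def by blast
    have "v k = w" "u k = x" using nxt(1)[OF vu, of k] c(2) by simp_all
    then have "(p, \<tau>) \<in> straight_part \<delta> (c k) \<union> corner_arc \<delta> (c k) (c (k + 1))"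
      using m nxt(1,2)[OF vu, of k] by (simp add: piece_def)
    then show "(p, \<tau>) \<in> drawing \<delta> C" using c(1) unfolding drawing_def by blast
  qed
  then show ?thesis using pc by blast
qed

lemma shape_bound:
  assumes "(p, \<tau>) \<in> shape \<delta> s u" "u \<in> units" "0 < \<delta>" "\<delta> < 1 / 2"
  shows "cmod p \<le> 3 * cmod d"
proof -
  have e: "cmod (eis u) = 1" by (rule cmod_eis_unit[OF assms(2)])
  have t: "0 \<le> tan (pi / 6)" "tan (pi / 6) \<le> (1::real)"
    by (simp_all add: tan_30)
  have "(\<exists>x\<in>{\<delta>..1 - \<delta>}. p = d * eis u * of_real (x - 1)) \<or> (\<exists>\<theta> :: real. p = d * eis u *
      (- of_real \<delta> + \<i> * of_real (real_of_int (sign_of s) * \<delta> * tan (pi / 6)) * (1 - cis (sign_of s * \<theta>))))"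
    using assms(1) unfolding shape_def by (simp only: Un_iff image_iff prod.inject) blast
  then consider x where "p = d * eis u * of_real (x - 1)" "\<delta> \<le> x" "x \<le> 1 - \<delta>"
    | \<theta> :: real where "p = d * eis u *
      (- of_real \<delta> + \<i> * of_real (real_of_int (sign_of s) * \<delta> * tan (pi / 6)) * (1 - cis (sign_of s * \<theta>)))"
    by (elim disjE bexE exE) (simp_all only: atLeastAtMost_iff)
  then show ?thesis
  proof cases
    case 1
    then have "cmod p = cmod d * \<bar>x - 1\<bar>" by (simp only: norm_mult e norm_of_real)
    also have "\<dots> \<le> cmod d * 3" using 1 assms by (intro mult_left_mono) auto
    finally show ?thesis by simp
  next
    case 2
    define K where "K = - of_real \<delta> + \<i> * of_real (real_of_int (sign_of s) * \<delta> * tan (pi / 6)) * (1 - cis (sign_of s * \<theta>))"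
    have "cmod K \<le> cmod (of_real \<delta> :: complex) + cmod (\<i> * of_real (real_of_int (sign_of s) * \<delta> * tan (pi / 6)) * (1 - cis (sign_of s * \<theta>)))"
      unfolding K_def by (metis norm_minus_cancel norm_triangle_ineq)
    also have "\<dots> = \<delta> + \<bar>real_of_int (sign_of s) * \<delta> * tan (pi / 6)\<bar> * cmod (1 - cis (sign_of s * \<theta>))"
      using assms by (simp only: norm_mult norm_of_real norm_ii)
    also have "\<bar>real_of_int (sign_of s) * \<delta> * tan (pi / 6)\<bar> = \<delta> * tan (pi / 6)"
      using assms t by (simp add: sign_of_def abs_mult)
    also have "\<delta> + \<delta> * tan (pi / 6) * cmod (1 - cis (sign_of s * \<theta>)) \<le> \<delta> + \<delta> * 1 * 2"
    proof -
      have "cmod (1 - cis (sign_of s * \<theta>)) \<le> cmod 1 + cmod (cis (sign_of s * \<theta>))"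
        by (rule norm_triangle_ineq4)
      then have "cmod (1 - cis (sign_of s * \<theta>)) \<le> 2" by simp
      then show ?thesis using assms t by (intro add_left_mono mult_mono) simp_all
    qed
    finally have "cmod K \<le> 3" using assms by simp
    then have "cmod d * cmod K \<le> cmod d * 3" by (intro mult_left_mono) simp_all
    then show ?thesis unfolding 2 K_def[symmetric] by (simp add: norm_mult e)
  qed
qed

text \<open>A piece that reaches into the ball belongs to a vertex at most \<open>3 * cmod d\<close>
  further out, by \<open>shape_bound\<close>.\<close>

lemma patch_isoI:
  assumes C: "describes \<sigma> C" and D: "describes \<sigma>' D" and \<delta>: "0 < \<delta>" "\<delta> < 1 / 2"
    and eq: "\<And>v. cmod (pos v - x) \<le> r + 3 * cmod d \<Longrightarrow> \<sigma>' (v + t) = \<sigma> v"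
  shows "patch_iso r (drawing \<delta> C) x (drawing \<delta> D) (x + d * eis t)"
proof -
  have close: "cmod (pos v - x) \<le> r + 3 * cmod d"
    if "(p - pos v, \<tau>) \<in> shape \<delta> s u" "u \<in> units" "cmod (p - x) \<le> r" for p v \<tau> s u
  proof -
    have "cmod (p - pos v) \<le> 3 * cmod d" by (rule shape_bound[OF that(1,2) \<delta>])
    moreover have "cmod (pos v - x) \<le> cmod (p - x) + cmod (p - pos v)"
      by (metis add_diff_cancel_left' diff_add_cancel norm_triangle_ineq4 diff_diff_eq2 add.commute)
    ultimately show ?thesis using that(3) by linarith
  qed
  have iff: "(p, \<tau>) \<in> drawing \<delta> C \<longleftrightarrow> (p + d * eis t, \<tau>) \<in> drawing \<delta> D" if p: "cmod (p - x) \<le> r" for p \<tau>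
  proof
    assume "(p, \<tau>) \<in> drawing \<delta> C"
    then obtain v u where u: "u \<in> units" and m: "(p - pos v, \<tau>) \<in> shape \<delta> (\<sigma> v) u"
      unfolding drawing_iff[OF C] by blast
    have "(p + d * eis t - pos (v + t), \<tau>) \<in> shape \<delta> (\<sigma>' (v + t)) u"
      using m eq[OF close[OF m u p]] by (simp add: pos_add)
    then show "(p + d * eis t, \<tau>) \<in> drawing \<delta> D" unfolding drawing_iff[OF D] using u by blast
  next
    assume "(p + d * eis t, \<tau>) \<in> drawing \<delta> D"
    then obtain v u where u: "u \<in> units" and m: "(p + d * eis t - pos v, \<tau>) \<in> shape \<delta> (\<sigma>' v) u"
      unfolding drawing_iff[OF D] by blast
    have m': "(p - pos (v - t), \<tau>) \<in> shape \<delta> (\<sigma>' v) u"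
      using m by (simp add: pos_diff algebra_simps)
    have "\<sigma>' v = \<sigma> (v - t)" using eq[OF close[OF m' u p]] by simp
    then show "(p, \<tau>) \<in> drawing \<delta> C" unfolding drawing_iff[OF C]
      using u m' by (intro exI[of _ "v - t"] bexI[of _ u]) simp_all
  qed
  show ?thesis
    unfolding patch_iso_def
  proof (intro equalityI subsetI)
    fix y assume "y \<in> (\<lambda>(p, \<tau>). (p + (x + d * eis t - x), \<tau>)) ` patch (drawing \<delta> C) x r"
    then obtain p \<tau> where y: "y = (p + d * eis t, \<tau>)" and p: "(p, \<tau>) \<in> drawing \<delta> C" "p \<in> cball x r"
      by (auto simp: patch_def)
    have "cmod (p - x) \<le> r" using p(2) by (simp add: dist_norm norm_minus_commute)
    then show "y \<in> patch (drawing \<delta> D) (x + d * eis t) r"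
      using iff[of p \<tau>] p y by (simp add: patch_def dist_norm)
  next
    fix y assume "y \<in> patch (drawing \<delta> D) (x + d * eis t) r"
    then obtain q \<tau> where y: "y = (q, \<tau>)" and q: "(q, \<tau>) \<in> drawing \<delta> D" "q \<in> cball (x + d * eis t) r"
      by (auto simp: patch_def)
    define p where "p = q - d * eis t"
    have qp: "q = p + d * eis t" by (simp add: p_def)
    have "cmod (p - x) \<le> r" using q(2) by (simp add: dist_norm norm_minus_commute p_def algebra_simps)
    then have "(p, \<tau>) \<in> patch (drawing \<delta> C) x r"
      using iff[of p \<tau>] q(1) by (simp add: patch_def dist_norm norm_minus_commute qp)
    then show "y \<in> (\<lambda>(p, \<tau>). (p + (x + d * eis t - x), \<tau>)) ` patch (drawing \<delta> C) x r"
      by (force simp: y qp)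
  qed
qed

end

lemma patch_iso_sym: "patch_iso r E x F y \<Longrightarrow> patch_iso r F y E x"
proof -
  assume "patch_iso r E x F y"
  then have "patch F y r = (\<lambda>(p, \<tau>). (p + (y - x), \<tau>)) ` patch E x r" by (simp add: patch_iso_def)
  then have "(\<lambda>(p, \<tau>). (p + (x - y), \<tau>)) ` patch F y r = (\<lambda>z. z) ` patch E x r"
    by (simp only: image_image) (rule image_cong, auto)
  then show ?thesis by (simp add: patch_iso_def)
qed

context tri_tiling
begin

lemma patch_transfer:
  assumes C: "describes \<sigma> C" "carries \<sigma> \<Lambda>" and D: "describes \<sigma>' D" "carries \<sigma>' \<Lambda>"
    and \<delta>: "0 < \<delta>" "\<delta> < 1 / 2" and r: "0 < r"
  shows "\<exists>z. cmod (z - y) \<le> r * 16 + 48 * cmod d \<and> patch_iso r (drawing \<delta> C) x (drawing \<delta> D) z"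
proof -
  define \<rho> where "\<rho> = r + 3 * cmod d"
  have d: "0 < cmod d" using d_neq_0 by simp
  have "1 < sqrt (3::real)" by simp
  then obtain m where m: "2 * \<rho> / cmod d < sqrt 3 ^ m" using real_arch_pow by blast
  \<comment> \<open>The least admissible level keeps \<open>cmod d * sqrt 3 ^ n\<close> at most
    \<open>4 * \<rho>\<close>; with the factor 4 from \<open>lattice_near\<close> this is the origin
    of 16 and 48.\<close>
  define n where "n = (LEAST n. 2 * \<rho> / cmod d < sqrt 3 ^ n)"
  have n: "2 * \<rho> / cmod d < sqrt 3 ^ n" unfolding n_def by (rule LeastI[of "\<lambda>n. 2 * \<rho> / cmod d < sqrt 3 ^ n", OF m])
  have "n \<noteq> 0"
  proof
    assume "n = 0"
    then have "2 * \<rho> < cmod d" using n d by (simp add: field_simps)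
    then show False using r d by (simp add: \<rho>_def)
  qed
  then obtain k where k: "n = Suc k" by (metis not0_implies_Suc)
  then have "\<not> 2 * \<rho> / cmod d < sqrt 3 ^ k" unfolding n_def using not_less_Least by (metis lessI)
  then have "cmod d * sqrt 3 ^ k \<le> 2 * \<rho>" using d by (simp add: field_simps)
  moreover have "cmod d * sqrt 3 ^ n = sqrt 3 * (cmod d * sqrt 3 ^ k)" by (simp add: k)
  moreover have "sqrt 3 \<le> (2::real)" by (simp add: real_le_lsqrt)
  moreover have "0 < \<rho>" using r d by (simp add: \<rho>_def add_pos_nonneg)
  ultimately have up: "cmod d * sqrt 3 ^ n \<le> 2 * (2 * \<rho>)"
    by (metis mult_mono norm_ge_zero zero_le_power mult_nonneg_nonneg real_sqrt_ge_zero zero_le_numeral)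
  have lo: "2 * \<rho> < cmod d * sqrt 3 ^ n" using n d by (simp add: field_simps)
  obtain t where t: "cmod (x + d * eis t - y) \<le> 4 * (cmod d * sqrt 3 ^ n)"
    "\<And>v. cmod (pos v - x) \<le> \<rho> \<Longrightarrow> \<sigma>' (v + t) = \<sigma> v"
    using carries_transfer[OF C(2) D(2) lo] by blast
  have "patch_iso r (drawing \<delta> C) x (drawing \<delta> D) (x + d * eis t)"
    by (rule patch_isoI[OF C(1) D(1) \<delta>]) (use t(2) in \<open>simp add: \<rho>_def\<close>)
  moreover have "cmod (x + d * eis t - y) \<le> r * 16 + 48 * cmod d"
    using t(1) up by (simp add: \<rho>_def)
  ultimately show ?thesis by blast
qed

lemma strong_local_isomorphism:
  assumes C: "describes \<sigma> C" "carries \<sigma> \<Lambda>" and \<delta>: "0 < \<delta>" "\<delta> < 1 / 2"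
  shows "strong_local_isomorphism_property (drawing \<delta> C)"
  unfolding strong_local_isomorphism_property_def
proof (rule exI[of _ 16], intro conjI, simp, rule exI[of _ "48 * cmod d"], intro conjI allI impI)
  show "0 < 48 * cmod d" using d_neq_0 by simp
  fix x y :: complex and r :: real
  assume "0 < r"
  from patch_transfer[OF C C \<delta> this, of y x] show "\<exists>z\<in>cball y (r * 16 + 48 * cmod d). patch_iso r (drawing \<delta> C) z (drawing \<delta> C) x"
    by (auto simp: dist_norm norm_minus_commute intro: patch_iso_sym)
qed

lemma locally_isomorphicI:
  assumes C: "describes \<sigma> C" "carries \<sigma> \<Lambda>" and D: "describes \<sigma>' D" "carries \<sigma>' \<Lambda>"
    and \<delta>: "0 < \<delta>" "\<delta> < 1 / 2"
  shows "locally_isomorphic (drawing \<delta> C) (drawing \<delta> D)"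
  unfolding locally_isomorphic_def
  using patch_transfer[OF C D \<delta>] patch_transfer[OF D C \<delta>] patch_iso_sym by blast

end

section \<open>Orientations\<close>

lemma rotation_direction_swap: "rotation_direction g (b, a) = - rotation_direction g (a, b)"
proof -
  have "Im (cnj (b - g) * (a - g)) = - Im (cnj (a - g) * (b - g))" by (simp add: algebra_simps)
  then have "sgn (Im (cnj (b - g) * (a - g))) = - sgn (Im (cnj (a - g) * (b - g)))" by (simp only: sgn_minus)
  then show ?thesis by (simp add: rotation_direction_def)
qed

lemma rotation_direction_omega:
  assumes "a \<noteq> g" "b - g = omega * (a - g)"
  shows "rotation_direction g (a, b) = 1"
proof -
  have "cnj (a - g) * (b - g) = (a - g) * cnj (a - g) * omega" by (simp add: assms(2))
  also have "\<dots> = of_real ((cmod (a - g))\<^sup>2) * omega" by (simp only: complex_norm_square)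
  finally have "Im (cnj (a - g) * (b - g)) = (cmod (a - g))\<^sup>2 * (sqrt 3 / 2)" by (simp del: complex_cnj_diff)
  moreover have "0 < (cmod (a - g))\<^sup>2 * (sqrt 3 / 2)" using assms(1) by simp
  ultimately show ?thesis unfolding rotation_direction_def fst_conv snd_conv by (simp only: sgn_1_pos)
qed

text \<open>Seen from the centre, each vertex is \<omega> times the preceding one.\<close>

lemma rotation_direction_triangle:
  assumes e: "b - a = D" "c - a = D * (1 + omega)" "D \<noteq> 0" and A: "A \<in> {(a, b), (b, c), (c, a)}"
  shows "rotation_direction (center {a, b, c}) A = 1"
proof -
  have b: "b = a + D" and c: "c = a + D * (1 + omega)" using e by (simp_all add: algebra_simps)
  have "1 + omega \<noteq> 0" "omega \<noteq> 0" by (simp_all add: complex_eq_iff)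
  then have "a \<noteq> b" "a \<noteq> c" "b \<noteq> c" using e(3) by (auto simp: b c)
  then have "center {a, b, c} = (a + b + c) / 3" by (simp add: center_def)
  then have g: "center {a, b, c} = a + D * (2 + omega) / 3"
    by (simp add: b c field_simps)
  have sq: "omega * (2 + omega) = omega - 1" "omega * (1 - omega) = 1 + 2 * omega"
    "omega * (1 + 2 * omega) = - 2 - omega"
    by (simp_all add: complex_eq_iff)
  have x: "a - center {a, b, c} = - (D / 3 * (2 + omega))"
    "b - center {a, b, c} = D / 3 * (1 - omega)" "c - center {a, b, c} = D / 3 * (1 + 2 * omega)"
    unfolding g by (simp_all add: b c field_simps)
  have y: "b - center {a, b, c} = omega * (a - center {a, b, c})"
    "c - center {a, b, c} = omega * (b - center {a, b, c})"
    "a - center {a, b, c} = omega * (c - center {a, b, c})"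
  proof -
    have "omega * - (D / 3 * (2 + omega)) = - (D / 3 * (omega * (2 + omega)))"
      "omega * (D / 3 * (1 - omega)) = D / 3 * (omega * (1 - omega))"
      "omega * (D / 3 * (1 + 2 * omega)) = D / 3 * (omega * (1 + 2 * omega))"
      by (simp_all only: mult.left_commute mult_minus_right)
    then show "b - center {a, b, c} = omega * (a - center {a, b, c})"
      "c - center {a, b, c} = omega * (b - center {a, b, c})"
      "a - center {a, b, c} = omega * (c - center {a, b, c})"
      unfolding x by (simp_all only: sq) (simp_all add: right_diff_distrib distrib_left)
  qed
  have "2 + omega \<noteq> 0" "1 - omega \<noteq> 0" "1 + 2 * omega \<noteq> 0" by (simp_all add: complex_eq_iff)
  then have n: "a - center {a, b, c} \<noteq> 0" "b - center {a, b, c} \<noteq> 0" "c - center {a, b, c} \<noteq> 0"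
    unfolding x using e(3) by simp_all
  show ?thesis using A y n by (auto intro!: rotation_direction_omega simp del: diff_add_cancel)
qed

context tri_tiling
begin

text \<open>The triangles around which the chosen directions run counterclockwise; the remaining
  ones are upward for \<open>- d\<close>.\<close>

definition upward :: "point \<Rightarrow> complex set" where
  "upward v = {pos v, pos (v + (1, 0)), pos (v + (1, 1))}"

lemma upward_side:
  assumes "support (side_of w u) \<subseteq> upward v" "u \<in> units"
  shows "side_of w u \<in> {(pos v, pos (v + (1, 0))), (pos (v + (1, 0)), pos (v + (1, 1))),
    (pos (v + (1, 1)), pos v)}"
proof -
  obtain v1 v2 w1 w2 where "v = (v1, v2)" "w = (w1, w2)" by fastforce
  then show ?thesis using assms by (auto simp: support_def side_of_def upward_def units_def)
qed

lemma rotation_upward: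
  assumes "support (side_of w u) \<subseteq> upward v" "u \<in> units"
  shows "rotation_direction (center (upward v)) (side_of w u) = 1"
  unfolding upward_def
proof (rule rotation_direction_triangle)
  show "d \<noteq> 0" by (rule d_neq_0)
  show "pos (v + (1, 0)) - pos v = d" "pos (v + (1, 1)) - pos v = d * (1 + omega)"
    by (simp_all add: pos_add eis_def)
qed (rule upward_side[OF assms])

lemma pos_minus: "tri_tiling.pos z0 (- d) x = pos (- x)"
  by (simp add: tri_tiling.pos_def[OF tri_tiling_minus] pos_def eis_minus)

lemma side_of_minus: "tri_tiling.side_of z0 (- d) v u = prod.swap (side_of (u - v) u)"
  by (simp add: tri_tiling.side_of_def[OF tri_tiling_minus] side_of_def pos_minus)

lemma support_swap [simp]: "support (prod.swap A) = support A"
  by (auto simp: support_def)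

lemma rotation_swap: "rotation_direction g (prod.swap A) = - rotation_direction g A"
  using rotation_direction_swap[of g "snd A" "fst A"] by (simp add: prod.swap_def)

lemma rotation_downward:
  assumes "support (side_of w u) \<subseteq> tri_tiling.upward z0 (- d) v" "u \<in> units"
  shows "rotation_direction (center (tri_tiling.upward z0 (- d) v)) (side_of w u) = - 1"
proof -
  have "side_of w u = prod.swap (tri_tiling.side_of z0 (- d) (u - w) u)"
    by (simp add: side_of_minus)
  then show ?thesis
    using tri_tiling.rotation_upward[OF tri_tiling_minus _ assms(2), of "u - w" v] assms(1)
    by (simp only: support_swap rotation_swap)
qed

lemma triangles_upward: "P = range upward \<union> range (tri_tiling.upward z0 (- d))"
proof -
  have dn: "tri_tiling.upward z0 (- d) w = {pos (- w), pos (- w - (1, 0)), pos (- w - (1, 1))}" for w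
    unfolding tri_tiling.upward_def[OF tri_tiling_minus] pos_minus
    by (simp only: minus_add_distrib diff_conv_add_uminus)
  have "tri_tiling.upward z0 (- d) (- v - (2, 1)) = {pos (v + (2, 1)), pos (v + (1, 1)), pos (v + (1, 0))}" for v
  proof -
    have "- (- v - (2, 1)) = v + (2, 1)" "v + (2, 1) - (1, 0) = v + (1, 1)" "v + (2, 1) - (1, 1) = v + (1, 0)"
      by (simp_all add: prod_eq_iff)
    then show ?thesis using dn[of "- v - (2, 1)"] by (simp only:)
  qed
  then have "{pos (v + (2, 1)), pos (v + (1, 0)), pos (v + (1, 1))} = tri_tiling.upward z0 (- d) (- v - (2, 1))" for v
    by (simp add: insert_commute)
  then have "P = (\<Union>v. {upward v, tri_tiling.upward z0 (- d) (- v - (2, 1))})"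
    unfolding triangles upward_def by simp
  moreover have "range (tri_tiling.upward z0 (- d)) = range (\<lambda>v. tri_tiling.upward z0 (- d) (- v - (2, 1)))"
  proof (intro equalityI subsetI)
    fix T assume "T \<in> range (tri_tiling.upward z0 (- d))"
    then obtain w where "T = tri_tiling.upward z0 (- d) w" by blast
    then have "T = tri_tiling.upward z0 (- d) (- (- w - (2, 1)) - (2, 1))" by simp
    then show "T \<in> range (\<lambda>v. tri_tiling.upward z0 (- d) (- v - (2, 1)))" by blast
  qed blast
  ultimately show ?thesis by auto
qed

lemma describes_segments:
  assumes "describes \<sigma> C"
  shows "segments C = {side_of v u | v u. u \<in> units}"
proof
  show "segments C \<subseteq> {side_of v u | v u. u \<in> units}"
    using assms unfolding segments_def describes_def positive_curve_def path_def by fastforce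
  show "{side_of v u | v u. u \<in> units} \<subseteq> segments C"
    using assms unfolding segments_def describes_def by (auto, metis rangeI)
qed

lemma describes_property_P:
  assumes "describes \<sigma> C"
  shows "property_P P (segments C)"
  unfolding property_P_def
proof (intro ballI impI)
  fix T A B assume T: "T \<in> P" and A: "A \<in> segments C" "support A \<subseteq> T" and B: "B \<in> segments C" "support B \<subseteq> T"
  obtain v u where a: "A = side_of v u" "u \<in> units" using A(1) unfolding describes_segments[OF assms] by blast
  obtain w x where b: "B = side_of w x" "x \<in> units" using B(1) unfolding describes_segments[OF assms] by blast
  from T consider t where "T = upward t" | t where "T = tri_tiling.upward z0 (- d) t"
    unfolding triangles_upward by blast
  then show "rotation_direction (center T) A = rotation_direction (center T) B"
  proof cases
    case 1
    then show ?thesis using rotation_upward A(2) B(2) a b by metis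
  next
    case 2
    then show ?thesis using rotation_downward A(2) B(2) a b by metis
  qed
qed

lemma segments_unique:
  assumes cov: "covering P C" and A: "A \<in> oriented_sides P"
  shows "\<exists>!B. B \<in> segments C \<and> support B = support A"
proof -
  have "\<exists>!(c, k). c \<in> C \<and> support (c k) = support A"
    using cov A unfolding covering_def by blast
  then obtain z where z: "case z of (c, k) \<Rightarrow> c \<in> C \<and> support (c k) = support A"
    and uz: "\<forall>y. (case y of (c, k) \<Rightarrow> c \<in> C \<and> support (c k) = support A) \<longrightarrow> y = z"
    by (elim ex1E) blast
  obtain c k where zc: "z = (c, k)" by fastforce
  have c: "c \<in> C" "support (c k) = support A" using z by (simp_all add: zc)
  have u: "(c', k') = (c, k)" if "c' \<in> C" "support (c' k') = support A" for c' k'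
    using uz[rule_format, of "(c', k')"] that by (simp add: zc)
  show ?thesis
  proof (rule ex1I[of _ "c k"])
    show "c k \<in> segments C \<and> support (c k) = support A" using c by (auto simp: segments_def)
    fix B assume "B \<in> segments C \<and> support B = support A"
    then obtain c' k' where "c' \<in> C" "B = c' k'" "support (c' k') = support A" by (auto simp: segments_def)
    then show "B = c k" using u[of c' k'] by simp
  qed
qed

lemma segments_in: "covering P C \<Longrightarrow> segments C \<subseteq> oriented_sides P"
  by (auto simp: covering_def complete_tcurve_def segments_def)

lemma oriented_side_cases:
  assumes "A \<in> oriented_sides P"
  obtains v u where "u \<in> units" "A = side_of v u \<or> A = prod.swap (side_of v u)"
proof -
  obtain v e where A: "A = (pos v, pos (v + e))" and e: "e \<in> units \<or> - e \<in> units"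
    using assms unfolding oriented_sides_eq by blast
  from e show ?thesis
  proof
    assume "e \<in> units"
    then show ?thesis using that[of e "v + e"] by (simp add: side_of_def A)
  next
    assume "- e \<in> units"
    then show ?thesis using that[of "- e" v] by (simp add: side_of_def A)
  qed
qed

lemma swap_neq: "u \<in> units \<Longrightarrow> x \<in> units \<Longrightarrow> prod.swap (side_of v u) \<noteq> side_of w x"
proof
  assume u: "u \<in> units" "x \<in> units" and eq: "prod.swap (side_of v u) = side_of w x"
  have e: "v = w - x \<and> v - u = w"
    using eq unfolding side_of_def swap_simp prod.inject pos_eq_iff .
  have "x = w - v" by (simp add: e[THEN conjunct1])
  moreover have "u = v - w" by (simp add: e[THEN conjunct2, symmetric])
  ultimately have "u = - x" by simp
  then show False using units_neg[OF u] by simp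
qed

lemma all_positive_describes:
  assumes cov: "covering P C" and all: "\<And>v u. u \<in> units \<Longrightarrow> side_of v u \<in> segments C"
  shows "\<exists>\<sigma>. describes \<sigma> C"
proof (rule covering_describes[OF cov])
  fix c assume c: "c \<in> C"
  have ct: "complete_tcurve P c" and cs: "c 0 \<in> segments C" using c cov by (auto simp: covering_def segments_def)
  then have "c 0 \<in> oriented_sides P" by (simp add: complete_tcurve_def)
  then obtain v u where u: "u \<in> units" and "c 0 = side_of v u \<or> c 0 = prod.swap (side_of v u)"
    by (rule oriented_side_cases)
  then have "support (c 0) = support (side_of v u)" by auto
  then have "c 0 = side_of v u"
    using segments_unique[OF cov side_of_in[OF u]] cs all[OF u, of v] by blast
  then show "\<exists>v u. positive_curve c v u" using tcurve_positive[OF ct _ u] by blast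
qed

text \<open>(P) makes the sides of a triangle all positive or all negative, and neighbouring
  triangles share a side, so one side decides for the whole plane.\<close>

lemma property_P_orientation:
  assumes cov: "covering P C" and prp: "property_P P (segments C)"
  shows "(\<exists>\<sigma>. describes \<sigma> C) \<or> (\<exists>\<sigma>. tri_tiling.describes z0 (- d) \<sigma> C)"
proof -
  define pe where "pe = (\<lambda>v u. side_of v u \<in> segments C)"
  have neg: "prod.swap (side_of v u) \<in> segments C" if h: "u \<in> units" "\<not> pe v u" for v u
  proof -
    obtain B where B: "B \<in> segments C" "support B = support (side_of v u)"
      using segments_unique[OF cov side_of_in[OF h(1)]] by blast
    obtain w x where x: "x \<in> units" "B = side_of w x \<or> B = prod.swap (side_of w x)"
      using oriented_side_cases[of B] B(1) segments_in[OF cov] by (metis subsetD)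
    then have "support (side_of w x) = support (side_of v u)" using B(2) by auto
    then have "w = v \<and> x = u" by (rule support_side_of[OF x(1) h(1)])
    then show ?thesis using x(2) B(1) h(2) by (auto simp: pe_def)
  qed
  have same: "pe v u = pe w x"
    if T: "T \<in> P" and u: "u \<in> units" and s: "support (side_of v u) \<subseteq> T"
      and x: "x \<in> units" and t: "support (side_of w x) \<subseteq> T" for T v u w x
  proof -
    define \<rho> where "\<rho> = rotation_direction (center T)"
    obtain r where r: "\<rho> (side_of v u) = r" "\<rho> (side_of w x) = r" "r \<noteq> - r"
    proof -
      consider y where "T = upward y" | y where "T = tri_tiling.upward z0 (- d) y"
        using T unfolding triangles_upward by blast
      then show ?thesis
      proof cases
        case 1
        then show ?thesis using that[of 1] rotation_upward u x s t by (simp add: \<rho>_def)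
      next
        case 2
        then show ?thesis using that[of "- 1"] rotation_downward u x s t by (simp add: \<rho>_def)
      qed
    qed
    have "\<rho> A = \<rho> B" if "A \<in> segments C" "B \<in> segments C" "support A \<subseteq> T" "support B \<subseteq> T" for A B
      using prp T that unfolding property_P_def \<rho>_def by blast
    note eq = this
    have sw: "\<rho> (prod.swap (side_of v u)) = - r" "\<rho> (prod.swap (side_of w x)) = - r"
      using r by (simp_all add: \<rho>_def rotation_swap)
    show ?thesis
    proof (rule ccontr)
      assume "pe v u \<noteq> pe w x"
      then consider "pe v u" "\<not> pe w x" | "\<not> pe v u" "pe w x" by blast
      then show False
      proof cases
        case 1
        have "\<rho> (side_of v u) = \<rho> (prod.swap (side_of w x))"
          by (rule eq) (use 1 neg[OF x] s t in \<open>simp_all add: pe_def\<close>)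
        then show False using r sw by simp
      next
        case 2
        have "\<rho> (side_of w x) = \<rho> (prod.swap (side_of v u))"
          by (rule eq) (use 2 neg[OF u] s t in \<open>simp_all add: pe_def\<close>)
        then show False using r sw by simp
      qed
    qed
  qed
  have U: "(1, 0) \<in> units" "(0, 1) \<in> units" "(- 1, - 1) \<in> units" by (simp_all add: units_def)
  have up: "pe (v + (1, 0)) (1, 0) = pe (v + (1, 1)) (0, 1)" "pe (v + (1, 0)) (1, 0) = pe v (- 1, - 1)" for v
  proof -
    have T: "upward v \<in> P" unfolding triangles_upward by blast
    have "v - (- 1, - 1) = v + (1, 1)" "v + (1, 0) - (1, 0) = v" "v + (1, 1) - (0, 1) = v + (1, 0)"
      by (simp_all add: prod_eq_iff)
    then have S: "support (side_of (v + (1, 0)) (1, 0)) \<subseteq> upward v" "support (side_of (v + (1, 1)) (0, 1)) \<subseteq> upward v"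
      "support (side_of v (- 1, - 1)) \<subseteq> upward v"
      by (auto simp: support_def side_of_def upward_def)
    show "pe (v + (1, 0)) (1, 0) = pe (v + (1, 1)) (0, 1)" by (rule same[OF T U(1) S(1) U(2) S(2)])
    show "pe (v + (1, 0)) (1, 0) = pe v (- 1, - 1)" by (rule same[OF T U(1) S(1) U(3) S(3)])
  qed
  have down: "pe v (1, 0) = pe (v - (1, 0)) (0, 1)" "pe v (1, 0) = pe (v - (1, 1)) (- 1, - 1)" for v
  proof -
    define T where "T = tri_tiling.upward z0 (- d) (- v)"
    have "- (- v + (1, 0)) = v - (1, 0)" "- (- v + (1, 1)) = v - (1, 1)" by (simp_all add: prod_eq_iff)
    then have Teq: "T = {pos v, pos (v - (1, 0)), pos (v - (1, 1))}"
      unfolding T_def tri_tiling.upward_def[OF tri_tiling_minus] pos_minus by simp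
    have T: "T \<in> P" unfolding triangles_upward T_def by blast
    have "v - (1, 1) - (- 1, - 1) = v" "v - (1, 0) - (0, 1) = v - (1, 1)"
      by (simp_all add: prod_eq_iff)
    then have S: "support (side_of v (1, 0)) \<subseteq> T" "support (side_of (v - (1, 0)) (0, 1)) \<subseteq> T"
      "support (side_of (v - (1, 1)) (- 1, - 1)) \<subseteq> T"
      by (auto simp: support_def side_of_def Teq)
    show "pe v (1, 0) = pe (v - (1, 0)) (0, 1)" by (rule same[OF T U(1) S(1) U(2) S(2)])
    show "pe v (1, 0) = pe (v - (1, 1)) (- 1, - 1)" by (rule same[OF T U(1) S(1) U(3) S(3)])
  qed
  \<comment> \<open>One downward and one upward triangle with a common side carry the orientation of
    a side to a translate of it.\<close>
  have s1: "pe (v + (1, 1)) (1, 0) = pe v (1, 0)" for v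
  proof -
    have "v + (1, 1) - (1, 0) = v - (1, 0) + (1, 1)" "v - (1, 0) + (1, 0) = v" by (simp_all add: prod_eq_iff)
    then show ?thesis using down(1)[of "v + (1, 1)"] up(1)[of "v - (1, 0)"] by metis
  qed
  have s2: "pe (v + (0, 1)) (1, 0) = pe v (1, 0)" for v
  proof -
    have "v + (0, 1) - (1, 1) = v - (1, 0)" "v - (1, 0) + (1, 0) = v" by (simp_all add: prod_eq_iff)
    then show ?thesis using down(2)[of "v + (0, 1)"] up(2)[of "v - (1, 0)"] by metis
  qed
  have s3: "pe (v + (1, 0)) (1, 0) = pe v (1, 0)" for v
    using s2[of "v + (1, 0)"] s1[of v] by (simp add: add.assoc)
  have c1: "pe (v + (a, 0)) (1, 0) = pe v (1, 0)" for v a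
  proof (induction a rule: int_induct[where k = 0])
    case (step1 i)
    then show ?case using s3[of "v + (i, 0)"] by (simp add: add.assoc)
  next
    case (step2 i)
    then show ?case using s3[of "v + (i - 1, 0)"] by (simp add: add.assoc)
  qed (simp flip: zero_prod_def)
  have c2: "pe (v + (0, a)) (1, 0) = pe v (1, 0)" for v a
  proof (induction a rule: int_induct[where k = 0])
    case (step1 i)
    then show ?case using s2[of "v + (0, i)"] by (simp add: add.assoc)
  next
    case (step2 i)
    then show ?case using s2[of "v + (0, i - 1)"] by (simp add: add.assoc)
  qed (simp flip: zero_prod_def)
  define f where "f = pe 0 (1, 0)"
  have c: "pe v (1, 0) = f" for v
  proof -
    have "v = 0 + (fst v, 0) + (0, snd v)" by (simp add: prod_eq_iff)
    then show ?thesis using c1[of 0 "fst v"] c2[of "0 + (fst v, 0)" "snd v"] by (simp add: f_def)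
  qed
  have const: "pe v u = f" if u: "u \<in> units" for v u
  proof -
    consider "u = (1, 0)" | "u = (0, 1)" | "u = (- 1, - 1)" using u by (auto simp: units_def)
    then show ?thesis
    proof cases
      case 2
      then show ?thesis using down(1)[of "v + (1, 0)"] c by simp
    next
      case 3
      then show ?thesis using up(2)[of v] c by simp
    qed (simp add: c)
  qed
  show ?thesis
  proof (cases f)
    case True
    then show ?thesis using all_positive_describes[OF cov] const by (auto simp: pe_def)
  next
    case False
    have "\<exists>\<sigma>. tri_tiling.describes z0 (- d) \<sigma> C"
      by (rule tri_tiling.all_positive_describes[OF tri_tiling_minus cov])
        (use neg const False in \<open>simp add: side_of_minus\<close>)
    then show ?thesis by blast
  qed
qed

lemma coherent_segments:
  assumes "covering P C" "property_P P (segments C)"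
  shows "segments C \<in> coherent_orientations P"
  unfolding coherent_orientations_def using assms segments_in segments_unique by blast

lemma opposite_segments:
  assumes "describes \<sigma> C" "tri_tiling.describes z0 (- d) \<sigma>' D"
  shows "segments C \<noteq> segments D"
proof
  assume eq: "segments C = segments D"
  have u: "(1, 0) \<in> units" by (simp add: units_def)
  have "tri_tiling.side_of z0 (- d) 0 (1, 0) \<in> segments D"
    unfolding tri_tiling.describes_segments[OF tri_tiling_minus assms(2)] using u by blast
  then have "prod.swap (side_of ((1, 0) - 0) (1, 0)) \<in> segments C" unfolding eq side_of_minus .
  then show False unfolding describes_segments[OF assms(1)] using swap_neq[OF u] by blast
qed

end

section \<open>Patches determine the signs\<close>

lemma patch_isoD:
  assumes "patch_iso r E x F y" "(p, \<tau>) \<in> E" "cmod (p - x) \<le> r"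
  shows "(p + (y - x), \<tau>) \<in> F"
proof -
  have "(p, \<tau>) \<in> patch E x r" using assms(2,3) by (simp add: patch_def dist_norm norm_minus_commute)
  then have "(\<lambda>(p, \<tau>). (p + (y - x), \<tau>)) (p, \<tau>) \<in> patch F y r"
    using assms(1) unfolding patch_iso_def by blast
  then show ?thesis by (simp add: patch_def)
qed

text \<open>For each of the directions \<open>d\<close>, \<open>d\<omega>\<close>, \<open>d\<omega>\<^sup>2\<close>, exactly one point of the three passages at a vertex
  has the opposite tangent, namely the midpoint of an arc; \<open>tip\<close> is its offset from the vertex, up to
  sign, in units of that direction.\<close>

definition tip :: "real \<Rightarrow> complex" where
  "tip \<delta> = \<i> * of_real (\<delta> * tan (pi / 6))"

text \<open>1 + 2\<omega> is i times the square root of 3, and tan (\<pi>/6) is the inverse of that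
  root.\<close>

lemma tip_omega: "tip \<delta> * (1 + 2 * omega) = - of_real \<delta>"
  by (simp add: tip_def complex_eq_iff tan_30)

lemma cmod_tip: "0 < \<delta> \<Longrightarrow> \<delta> < 1 / 2 \<Longrightarrow> cmod (tip \<delta>) < 1 / 3"
proof -
  assume d: "0 < \<delta>" "\<delta> < 1 / 2"
  have "3 / 2 < sqrt (3::real)" by (rule real_less_rsqrt) (simp add: power2_eq_square)
  then have "\<delta> < sqrt 3 / 3" using d by linarith
  then have "\<delta> * tan (pi / 6) < 1 / 3" by (simp add: tan_30 field_simps)
  moreover have "cmod (tip \<delta>) = \<bar>\<delta> * tan (pi / 6)\<bar>"
    unfolding tip_def by (simp only: norm_mult norm_ii norm_of_real mult_1)
  moreover have "0 \<le> \<delta> * tan (pi / 6)" using d by (simp add: tan_30)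
  ultimately show ?thesis by simp
qed

text \<open>A lattice point on the imaginary axis has an even second coordinate, and the bounds on
  \<open>k\<close> and \<open>\<delta>\<close> make it smaller than 2 in absolute value.\<close>

lemma eis_tip:
  assumes "eis w = tip \<delta> * of_int k" "\<bar>k\<bar> \<le> 4" "0 < \<delta>" "\<delta> < 1 / 2"
  shows "k = 0"
proof (rule ccontr)
  assume k: "k \<noteq> 0"
  have re: "of_int (fst w) - of_int (snd w) / 2 = (0 :: real)"
    and im: "of_int (snd w) * (sqrt 3 / 2) = \<delta> * (sqrt 3 / 3) * of_int k"
    using arg_cong[OF assms(1), of Re] arg_cong[OF assms(1), of Im]
    by (simp_all add: eis_def tip_def tan_30 real_sqrt_divide field_simps)
  have "snd w = 2 * fst w" using re by linarith
  have "sqrt 3 * (3 * of_int (snd w)) = sqrt 3 * (2 * \<delta> * of_int k)" using im by (simp add: field_simps)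
  then have s: "3 * of_int (snd w) = 2 * \<delta> * of_int k" by simp
  then have "\<bar>3 * real_of_int (snd w)\<bar> = 2 * \<delta> * \<bar>of_int k\<bar>" using assms(3) by (simp add: abs_mult)
  also have "\<dots> \<le> 2 * \<delta> * 4" using assms(2,3) by (intro mult_left_mono) auto
  finally have "\<bar>snd w\<bar> < 2" using assms(4) by simp
  then have "snd w = 0" using \<open>snd w = 2 * fst w\<close> by presburger
  then show False using s assms(3) k by simp
qed

context tri_tiling
begin

lemma sgn_d_eis: "u \<in> units \<Longrightarrow> sgn (d * eis u) = sgn d * eis u"
  using cmod_eis_unit[of u] by (simp add: sgn_mult sgn_eq[of "eis u"])

text \<open>Along an arc the tangent sweeps 2\<pi>/3 from one of the three directions to another, so
  the opposite of a direction is met only halfway; straight parts never show it.\<close>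

lemma shape_tip:
  assumes "(q, - sgn (d * eis u)) \<in> shape \<delta> s w" "u \<in> units" "w \<in> units"
  shows "q = - d * eis u * tip \<delta> * of_int (sign_of s)"
proof -
  have sd: "sgn d \<noteq> 0" using d_neq_0 by (simp add: sgn_zero_iff)
  have ew: "eis w \<noteq> 0" using cmod_eis_unit[OF assms(3)] by auto
  from assms(1) consider "sgn (d * eis w) = - sgn (d * eis u)"
    | \<theta> :: real where "0 \<le> \<theta>" "\<theta> \<le> 2 * pi / 3"
      "q = d * eis w * (- of_real \<delta> + \<i> * of_real (real_of_int (sign_of s) * \<delta> * tan (pi / 6)) * (1 - cis (sign_of s * \<theta>)))"
      "sgn (d * eis w) * cis (sign_of s * \<theta>) = - sgn (d * eis u)"
    unfolding shape_def Un_iff image_iff prod.inject Bex_def atLeastAtMost_iff by metis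
  then show ?thesis
  proof cases
    case 1
    then have "sgn d * (eis w + eis u) = 0" by (simp add: sgn_d_eis assms distrib_left)
    then have "eis u = eis (- w)" using sd by (simp add: eis_minus eq_neg_iff_add_eq_0 add.commute)
    then show ?thesis using units_neg[OF assms(2,3)] by simp
  next
    case (2 \<theta>)
    have c: "eis w * cis (sign_of s * \<theta>) = - eis u"
    proof -
      have "sgn d * (eis w * cis (sign_of s * \<theta>)) = sgn d * - eis u"
        using 2(4) unfolding sgn_d_eis[OF assms(2)] sgn_d_eis[OF assms(3)] mult.assoc by (simp only: mult_minus_right)
      then show ?thesis using sd by (simp only: mult_cancel_left) simp
    qed
    \<comment> \<open>The tangent turns by at most 2\<pi>/3, so an arc entered in direction
      \<open>u\<close> never reaches the opposite tangent.\<close>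
    have re: "Re (cis (sign_of s * \<theta>)) \<noteq> - 1"
    proof -
      have "cos (2 * pi / 3) \<le> cos \<theta>" using 2(1,2) by (intro cos_monotone_0_pi_le) auto
      then show ?thesis by (auto simp: sign_of_def cos_120)
    qed
    have im: "0 \<le> sin \<theta>" using 2(1,2) by (intro sin_ge_zero) auto
    from units_cases[OF assms(3,2)] consider "u = w" | "u = rot w" | "u = rot (rot w)" by blast
    then show ?thesis
    proof cases
      case 1
      then have "cis (sign_of s * \<theta>) = - 1" using c ew by (metis mult_cancel_left mult_minus1_right)
      then show ?thesis using re by simp
    next
      case u: 2
      then have cis: "cis (sign_of s * \<theta>) = - omega"
        using c ew by (metis mult_cancel_left eis_rot mult.commute mult_minus_right)
      then have "Im (cis (sign_of s * \<theta>)) = - sqrt 3 / 2" by simp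
      then have s: "\<not> s" using im by (auto simp: sign_of_def)
      have q: "q = d * eis w * (- of_real \<delta> - tip \<delta> * (1 + omega))"
        unfolding 2(3) cis using s by (simp add: sign_of_def tip_def)
      have "- of_real \<delta> - tip \<delta> * (1 + omega) = omega * tip \<delta>"
        unfolding tip_omega[symmetric] by (simp add: algebra_simps)
      then show ?thesis unfolding q using s by (simp add: u eis_rot sign_of_def)
    next
      case u: 3
      have eu: "eis u = (- 1 - omega) * eis w"
        unfolding u eis_rot omega_sq[symmetric] by simp
      have "eis w * cis (sign_of s * \<theta>) = eis w * (1 + omega)"
        unfolding c eu by (simp add: algebra_simps)
      then have cis: "cis (sign_of s * \<theta>) = 1 + omega" using ew by simp
      then have i: "Im (cis (sign_of s * \<theta>)) = sqrt 3 / 2" by simp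
      have s: "s"
      proof (rule ccontr)
        assume "\<not> s"
        then have "- sin \<theta> = sqrt 3 / 2" using i by (simp add: sign_of_def)
        moreover have "0 < sqrt (3 :: real)" by simp
        ultimately show False using im by linarith
      qed
      have q: "q = d * eis w * (- of_real \<delta> - tip \<delta> * omega)"
        unfolding 2(3) cis using s by (simp add: sign_of_def tip_def)
      have "- of_real \<delta> - tip \<delta> * omega = - (- 1 - omega) * tip \<delta>"
        unfolding tip_omega[symmetric] by (simp add: algebra_simps)
      then have "q = d * eis w * (- (- 1 - omega) * tip \<delta>)" unfolding q by simp
      also have "\<dots> = - d * eis u * tip \<delta> * of_int (sign_of s)"
        using s unfolding eu by (simp add: sign_of_def algebra_simps)
      finally show ?thesis .
    qed
  qed
qed

lemma tip_in_shape:
  assumes "u \<in> units"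
  shows "\<exists>w\<in>units. (- d * eis u * tip \<delta> * of_int (sign_of s), - sgn (d * eis u)) \<in> shape \<delta> s w"
proof -
  \<comment> \<open>The passage whose tangent, turned by \<pi>/3, is opposite to
    \<open>u\<close>.\<close>
  define w where "w = (if s then rot u else rot (rot u))"
  have w: "w \<in> units" using assms by (simp add: w_def)
  have cis: "cis (sign_of s * (pi / 3)) = (if s then 1 + omega else - omega)"
    using cis_pi_third by (simp add: sign_of_def)
  have eu: "eis u = (if s then - 1 - omega else omega) * eis w"
  proof (cases s)
    case True
    then have "eis u = eis (rot (rot w))" by (simp add: w_def)
    also have "\<dots> = (- 1 - omega) * eis w" by (simp add: eis_rot flip: omega_sq)
    finally show ?thesis using True by simp
  next
    case False
    then have "eis u = eis (rot w)" by (simp add: w_def)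
    then show ?thesis using False by (simp add: eis_rot)
  qed
  have tau: "sgn (d * eis w) * cis (sign_of s * (pi / 3)) = - sgn (d * eis u)"
  proof -
    have "eis w * (if s then 1 + omega else - omega) = - eis u"
      unfolding eu by (simp add: algebra_simps)
    then show ?thesis unfolding sgn_d_eis[OF assms] sgn_d_eis[OF w] cis mult.assoc
      by (simp only: mult_minus_right)
  qed
  have "- of_real \<delta> + \<i> * of_real (real_of_int (sign_of s) * \<delta> * tan (pi / 6)) * (1 - cis (sign_of s * (pi / 3)))
     = tip \<delta> * (1 + 2 * omega) + of_int (sign_of s) * tip \<delta> * (1 - cis (sign_of s * (pi / 3)))"
    unfolding tip_omega by (simp add: tip_def)
  also have "\<dots> = - (if s then - 1 - omega else omega) * tip \<delta> * of_int (sign_of s)"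
    unfolding cis by (simp add: sign_of_def algebra_simps)
  finally have pos: "d * eis w * (- of_real \<delta> + \<i> * of_real (real_of_int (sign_of s) * \<delta> * tan (pi / 6)) * (1 - cis (sign_of s * (pi / 3))))
     = - d * eis u * tip \<delta> * of_int (sign_of s)"
    unfolding eu by simp
  have "(- d * eis u * tip \<delta> * of_int (sign_of s), - sgn (d * eis u)) \<in> shape \<delta> s w"
    unfolding shape_def
    by (rule UnI2, rule image_eqI[of _ _ "pi / 3"]) (simp_all only: pos tau, simp)
  then show ?thesis using w by blast
qed

lemma drawing_tip:
  assumes "describes \<sigma> C" "u \<in> units"
  shows "(p, - sgn (d * eis u)) \<in> drawing \<delta> C \<longleftrightarrow>
    (\<exists>v. p = pos v - d * eis u * tip \<delta> * of_int (sign_of (\<sigma> v)))"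
proof
  assume "(p, - sgn (d * eis u)) \<in> drawing \<delta> C"
  then obtain v w where "w \<in> units" "(p - pos v, - sgn (d * eis u)) \<in> shape \<delta> (\<sigma> v) w"
    unfolding drawing_iff[OF assms(1)] by blast
  then have "p - pos v = - d * eis u * tip \<delta> * of_int (sign_of (\<sigma> v))" using shape_tip assms(2) by blast
  then show "\<exists>v. p = pos v - d * eis u * tip \<delta> * of_int (sign_of (\<sigma> v))"
    by (intro exI[of _ v]) (simp add: algebra_simps)
next
  assume "\<exists>v. p = pos v - d * eis u * tip \<delta> * of_int (sign_of (\<sigma> v))"
  then obtain v where v: "p = pos v - d * eis u * tip \<delta> * of_int (sign_of (\<sigma> v))" by blast
  show "(p, - sgn (d * eis u)) \<in> drawing \<delta> C"
    unfolding drawing_iff[OF assms(1)] using tip_in_shape[OF assms(2), of \<delta> "\<sigma> v"]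
    by (intro exI[of _ v]) (simp add: v)
qed

text \<open>Tips lie within a third of a side of their vertices, so tips this close belong to one
  vertex. Their offsets are perpendicular to \<open>u\<close>, so a displacement along
  \<open>u\<close> vanishes: a tangent opposite to \<open>u\<close> never fills an interval of that
  direction.\<close>

lemma tips_apart:
  assumes "pos v' - d * eis u * tip \<delta> * of_int (sign_of s') = pos v - d * eis u * tip \<delta> * of_int (sign_of s) + d * eis u * of_real \<epsilon>"
    and u: "u \<in> units" and \<delta>: "0 < \<delta>" "\<delta> < 1 / 2" and e: "\<bar>\<epsilon>\<bar> \<le> 1 / 3"
  shows "\<epsilon> = 0"
proof -
  define K where "K = of_real \<epsilon> + tip \<delta> * of_int (sign_of s' - sign_of s)"
  have "pos v' = pos v + (d * eis u * of_real \<epsilon> + d * eis u * tip \<delta> * of_int (sign_of s') - d * eis u * tip \<delta> * of_int (sign_of s))"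
    using assms(1) by (simp only: diff_eq_eq) (simp only: algebra_simps)
  also have "\<dots> = pos v + d * (eis u * K)"
    unfolding K_def of_int_diff by (simp only: algebra_simps)
  finally have "d * eis (v' - v) = d * (eis u * K)" by (simp add: pos_def eis_diff algebra_simps)
  then have eq: "eis (v' - v) = eis u * K" using d_neq_0 by simp
  have "cmod K \<le> \<bar>\<epsilon>\<bar> + cmod (tip \<delta>) * cmod (of_int (sign_of s' - sign_of s))"
    unfolding K_def by (metis norm_triangle_ineq norm_mult norm_of_real)
  also have "\<dots> \<le> \<bar>\<epsilon>\<bar> + cmod (tip \<delta>) * 2"
    by (intro add_left_mono mult_left_mono) (simp_all add: sign_of_def)
  also have "\<dots> < 1" using e cmod_tip[OF \<delta>] by linarith
  finally have "cmod (eis (v' - v)) < 1" by (simp add: eq norm_mult cmod_eis_unit[OF u])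
  then have "v' - v = 0" using cmod_eis_ge_1[of "v' - v"] by fastforce
  then have "eis u * K = 0" using eq by simp
  then have "K = 0" using cmod_eis_unit[OF u] by auto
  moreover have "Re K = \<epsilon>" by (simp add: K_def tip_def)
  ultimately show ?thesis by simp
qed

text \<open>A straight part of \<open>C\<close> shows its tangent along an interval, whereas in
  \<open>D\<close> this tangent occurs at tips only.\<close>

lemma opposite_not_isomorphic:
  assumes C: "describes \<sigma> C" and D: "tri_tiling.describes z0 (- d) \<sigma>' D"
    and \<delta>: "0 < \<delta>" "\<delta> < 1 / 2"
  shows "\<not> locally_isomorphic (drawing \<delta> C) (drawing \<delta> D)"
proof
  assume "locally_isomorphic (drawing \<delta> C) (drawing \<delta> D)"
  then obtain y where y: "patch_iso (cmod d) (drawing \<delta> C) (pos 0) (drawing \<delta> D) y"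
    using d_neq_0 unfolding locally_isomorphic_def by (metis zero_less_norm_iff)
  have u: "(1, 0) \<in> units" by (simp add: units_def)
  have e: "eis (1, 0) = 1" by (simp add: eis_def)
  have pt: "\<exists>v. pos 0 + d * of_real (x - 1) + (y - pos 0) =
      tri_tiling.pos z0 (- d) v - - d * eis (1, 0) * tip \<delta> * of_int (sign_of (\<sigma>' v))"
    if x: "\<delta> \<le> x" "x \<le> 1 - \<delta>" for x
  proof -
    have "(d * eis (1, 0) * of_real (x - 1), sgn (d * eis (1, 0))) \<in> shape \<delta> (\<sigma> 0) (1, 0)"
      unfolding shape_def using x by (intro UnI1 image_eqI[of _ _ x]) simp_all
    then have "(pos 0 + d * of_real (x - 1), sgn (d * eis (1, 0))) \<in> drawing \<delta> C"
      unfolding drawing_iff[OF C] using u by (intro exI[of _ 0] bexI[of _ "(1, 0)"]) (simp_all add: e)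
    moreover have "cmod (pos 0 + d * of_real (x - 1) - pos 0) \<le> cmod d"
    proof -
      have "cmod (pos 0 + d * of_real (x - 1) - pos 0) = cmod d * \<bar>x - 1\<bar>"
        by (simp only: add_diff_cancel_left' norm_mult norm_of_real)
      also have "\<dots> \<le> cmod d * 1" using x \<delta> by (intro mult_left_mono) auto
      finally show ?thesis by simp
    qed
    ultimately have "(pos 0 + d * of_real (x - 1) + (y - pos 0), sgn (d * eis (1, 0))) \<in> drawing \<delta> D"
      by (rule patch_isoD[OF y])
    moreover have sg: "sgn (d * eis (1, 0)) = - sgn (- d * eis (1, 0))" by (simp add: sgn_minus)
    ultimately show ?thesis
      unfolding sg tri_tiling.drawing_tip[OF tri_tiling_minus D u] by blast
  qed
  \<comment> \<open>Both \<open>\<delta>\<close> and \<open>\<delta> + \<epsilon>\<close> are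
    parameters of the straight part, and \<open>\<epsilon>\<close> is small enough for
    \<open>tips_apart\<close>.\<close>
  define \<epsilon> where "\<epsilon> = min (1 - 2 * \<delta>) (1 / 3)"
  have \<epsilon>: "0 < \<epsilon>" "\<epsilon> \<le> 1 / 3" "\<epsilon> \<le> 1 - 2 * \<delta>"
    unfolding \<epsilon>_def using \<delta> by (simp, simp only: min.cobounded2, simp only: min.cobounded1)
  obtain v where v: "pos 0 + d * of_real (\<delta> - 1) + (y - pos 0) =
      tri_tiling.pos z0 (- d) v - - d * eis (1, 0) * tip \<delta> * of_int (sign_of (\<sigma>' v))"
    using pt[of \<delta>] \<delta> by auto
  obtain v' where v': "pos 0 + d * of_real (\<delta> + \<epsilon> - 1) + (y - pos 0) =
      tri_tiling.pos z0 (- d) v' - - d * eis (1, 0) * tip \<delta> * of_int (sign_of (\<sigma>' v'))"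
    using pt[of "\<delta> + \<epsilon>"] \<epsilon> by auto
  have "- \<epsilon> = 0"
  proof (rule tri_tiling.tips_apart[OF tri_tiling_minus _ u \<delta>])
    show "tri_tiling.pos z0 (- d) v' - - d * eis (1, 0) * tip \<delta> * of_int (sign_of (\<sigma>' v')) =
      tri_tiling.pos z0 (- d) v - - d * eis (1, 0) * tip \<delta> * of_int (sign_of (\<sigma>' v)) + - d * eis (1, 0) * of_real (- \<epsilon>)"
      unfolding v[symmetric] v'[symmetric] by (simp add: e algebra_simps)
    show "\<bar>- \<epsilon>\<bar> \<le> 1 / 3" using \<epsilon> by simp
  qed
  then show False using \<epsilon> by simp
qed

text \<open>Tips go to tips, but the translation might differ from a lattice vector by a difference
  of tip offsets. By \<open>eis_tip\<close> this difference is the same at all vertices of the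
  patch. It is nonnegative at positive vertices and nonpositive at negative ones, so it vanishes
  because both signs are present.\<close>

lemma patch_iso_shift:
  assumes C: "describes \<sigma> C" "carries \<sigma> \<Lambda>" and D: "describes \<sigma>' D" and \<delta>: "0 < \<delta>" "\<delta> < 1 / 2"
    and iso: "patch_iso r (drawing \<delta> C) x (drawing \<delta> D) y" and r: "5 * cmod d \<le> r"
  shows "\<exists>t. \<forall>v. cmod (pos v - x) \<le> r - cmod d \<longrightarrow> \<sigma>' (v + t) = \<sigma> v"
proof -
  have u: "(1, 0) \<in> units" and e: "eis (1, 0) = 1" by (simp_all add: units_def eis_def)
  have img: "\<exists>v'. y - x = d * eis (v' - v) + d * tip \<delta> * of_int (sign_of (\<sigma> v) - sign_of (\<sigma>' v'))"
    if v: "cmod (pos v - x) \<le> r - cmod d" for v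
  proof -
    define p where "p = pos v - d * eis (1, 0) * tip \<delta> * of_int (sign_of (\<sigma> v))"
    have "(p, - sgn (d * eis (1, 0))) \<in> drawing \<delta> C"
      unfolding drawing_tip[OF C(1) u] p_def by blast
    moreover have "cmod (p - x) \<le> r"
    proof -
      have "cmod (p - x) \<le> cmod (pos v - x) + cmod (d * eis (1, 0) * tip \<delta> * of_int (sign_of (\<sigma> v)))"
        unfolding p_def using norm_triangle_ineq4[of "pos v - x" "d * eis (1, 0) * tip \<delta> * of_int (sign_of (\<sigma> v))"]
        by (simp only: diff_diff_eq add.commute)
      also have "cmod (d * eis (1, 0) * tip \<delta> * of_int (sign_of (\<sigma> v))) = cmod d * cmod (tip \<delta>)"
        by (simp add: norm_mult e sign_of_def)
      also have "\<dots> \<le> cmod d * 1" using cmod_tip[OF \<delta>] by (intro mult_left_mono) auto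
      finally show ?thesis using v by simp
    qed
    ultimately have "(p + (y - x), - sgn (d * eis (1, 0))) \<in> drawing \<delta> D" by (rule patch_isoD[OF iso])
    then obtain v' where "p + (y - x) = pos v' - d * eis (1, 0) * tip \<delta> * of_int (sign_of (\<sigma>' v'))"
      unfolding drawing_tip[OF D u] by blast
    then have "y - x = d * eis (v' - v) + d * tip \<delta> * of_int (sign_of (\<sigma> v) - sign_of (\<sigma>' v'))"
      by (simp add: p_def e pos_def eis_diff algebra_simps)
    then show ?thesis by blast
  qed
  define l where "l = (\<Lambda> 1 = 1)"
  have "signs \<Lambda> 1 = [l]" by (simp add: signs_def l_def)
  then obtain b where b: "\<And>x. level_sign [l] (x - b) \<noteq> Some (\<not> \<sigma> x)"
    using C(2) unfolding carries_def by metis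
  \<comment> \<open>The first level alone provides either sign within \<open>4 * cmod d\<close> of
    \<open>x\<close>; hence the radius of at least \<open>5 * cmod d\<close>.\<close>
  have near: "\<exists>v. cmod (pos v - x) \<le> r - cmod d \<and> \<sigma> v = s" for s
  proof -
    define c where "c = (if s = l then 1 else 2 :: int)"
    have "c = 0 \<or> c = 1 \<or> c = 2" by (simp add: c_def)
    from lattice_near[OF this, of "(x - pos b) / d"]
    obtain w where w: "cls w = c" "cmod (eis w - (x - pos b) / d) \<le> 4" by blast
    have "pos (b + w) - x = d * (eis w - (x - pos b) / d)"
      using d_neq_0 by (simp add: pos_add field_simps)
    then have "cmod (pos (b + w) - x) \<le> cmod d * 4"
      using w(2) by (simp add: norm_mult mult_left_mono)
    moreover have "\<sigma> (b + w) = s" using b[of "b + w"] w(1) by (auto simp: c_def split: if_splits)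
    ultimately show ?thesis using r by (intro exI[of _ "b + w"]) auto
  qed
  obtain v1 v2 where v1: "cmod (pos v1 - x) \<le> r - cmod d" "\<sigma> v1" and v2: "cmod (pos v2 - x) \<le> r - cmod d" "\<not> \<sigma> v2"
    using near[of True] near[of False] by auto
  obtain w1 where w1: "y - x = d * eis (w1 - v1) + d * tip \<delta> * of_int (sign_of (\<sigma> v1) - sign_of (\<sigma>' w1))"
    using img[OF v1(1)] by blast
  obtain w2 where w2: "y - x = d * eis (w2 - v2) + d * tip \<delta> * of_int (sign_of (\<sigma> v2) - sign_of (\<sigma>' w2))"
    using img[OF v2(1)] by blast
  have cancel: "k' = k \<and> t = t'"
    if "d * eis t + d * tip \<delta> * of_int k = d * eis t' + d * tip \<delta> * of_int k'" "\<bar>k' - k\<bar> \<le> 4" for t t' k k'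
  proof -
    have "d * eis (t - t') = d * (tip \<delta> * of_int (k' - k))"
      using that(1) by (simp add: eis_diff algebra_simps)
    then have eq: "eis (t - t') = tip \<delta> * of_int (k' - k)" using d_neq_0 by simp
    then have "k' - k = 0" by (rule eis_tip[OF _ that(2) \<delta>])
    then have "eis (t - t') = 0" using eq by simp
    then show ?thesis using \<open>k' - k = 0\<close> eis_eq_iff[of t t'] by (simp add: eis_diff)
  qed
  have "sign_of (\<sigma> v2) - sign_of (\<sigma>' w2) = sign_of (\<sigma> v1) - sign_of (\<sigma>' w1)"
  proof -
    have "\<bar>sign_of (\<sigma> v1) - sign_of (\<sigma>' w1) - (sign_of (\<sigma> v2) - sign_of (\<sigma>' w2))\<bar> \<le> 4"
      by (simp add: sign_of_def)
    from cancel[OF w1[unfolded w2] this] show ?thesis by simp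
  qed
  then have s1: "sign_of (\<sigma> v1) - sign_of (\<sigma>' w1) = 0"
    using v1(2) v2(2) by (simp add: sign_of_def split: if_splits)
  define t where "t = w1 - v1"
  have t: "y - x = d * eis t + d * tip \<delta> * of_int 0" using w1 unfolding s1 t_def .
  have "\<sigma>' (v + t) = \<sigma> v" if v: "cmod (pos v - x) \<le> r - cmod d" for v
  proof -
    obtain v' where v': "y - x = d * eis (v' - v) + d * tip \<delta> * of_int (sign_of (\<sigma> v) - sign_of (\<sigma>' v'))"
      using img[OF v] by blast
    have "0 = sign_of (\<sigma> v) - sign_of (\<sigma>' v') \<and> v' - v = t"
      by (rule cancel) (use v' t in \<open>simp, simp add: sign_of_def\<close>)
    then show ?thesis by (auto simp: sign_of_def split: if_splits)
  qed
  then show ?thesis by blast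
qed

lemma describes_path_through:
  assumes "describes \<sigma> C" "w \<in> units"
  obtains v u k where "path (\<lambda>k. \<sigma> (v k)) v u" "v k = x" "u k = w"
proof -
  obtain c k where c: "c \<in> C" "c k = side_of x w" using assms unfolding describes_def by blast
  obtain v u where p: "positive_curve c v u" "\<And>k. left_turns c k = \<sigma> (v k)"
    using assms(1) c(1) unfolding describes_def by blast
  have "left_turns c = (\<lambda>k. \<sigma> (v k))" using p(2) by auto
  then have "path (\<lambda>k. \<sigma> (v k)) v u" "v k = x" "u k = w"
    using p(1) c(2) by (auto simp: positive_curve_def)
  then show ?thesis by (rule that)
qed

end

text \<open>In both directions, agreement of the vertices gives agreement of the turns, which
  determines the next step. The turns therefore need to be compared only where the vertices already
  match.\<close>

lemma path_agree:
  assumes p: "path a v u" and p': "path a' v' u'" and 0: "v' k0 = v 0 + t" "u' k0 = u 0"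
    and eq: "\<And>k. \<bar>k\<bar> \<le> int N \<Longrightarrow> v' (k0 + k) = v k + t \<Longrightarrow> a' (k0 + k) = a k"
    and k: "\<bar>k\<bar> \<le> int N"
  shows "v' (k0 + k) = v k + t \<and> u' (k0 + k) = u k"
proof -
  define G where "G = (\<lambda>k. v' (k0 + k) = v k + t \<and> u' (k0 + k) = u k)"
  have s: "u (j + 1) = (if a j then rot (u j) else rot (rot (u j)))" "v (j + 1) = v j + u (j + 1)"
    "u' (j + 1) = (if a' j then rot (u' j) else rot (rot (u' j)))" "v' (j + 1) = v' j + u' (j + 1)" for j
    using p p' by (simp_all add: path_def)
  have "G (int n) \<and> G (- int n)" if "n \<le> N" for n
    using that
  proof (induction n)
    case (Suc n)
    then have IH: "G (int n)" "G (- int n)" by simp_all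
    have "a' (k0 + int n) = a (int n)" using IH(1) Suc.prems by (intro eq) (simp_all add: G_def)
    then have "G (int n + 1)"
      using IH(1) s(1,2)[of "int n"] s(3,4)[of "k0 + int n"] unfolding G_def
      by (simp add: add.assoc)
    moreover define j where "j = - int n - 1"
    have j: "j + 1 = - int n" "k0 + j + 1 = k0 + - int n" by (simp_all add: j_def)
    have "v (- int n) = v j + u (- int n)" "v' (k0 + - int n) = v' (k0 + j) + u' (k0 + - int n)"
      using s(2)[of j] s(4)[of "k0 + j"] unfolding j by simp_all
    then have vj: "v' (k0 + j) = v j + t" using IH(2) unfolding G_def by (metis add.commute add_left_cancel add.left_commute)
    have "a' (k0 + j) = a j" using Suc.prems by (intro eq vj) (simp add: j_def)
    then have "u' (k0 + j) = u j"
      using IH(2) s(1)[of j] s(3)[of "k0 + j"] unfolding G_def j by (metis rot_rot_rot)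
    then have "G j" using vj by (simp add: G_def)
    moreover have "int (Suc n) = int n + 1" "- int (Suc n) = j" by (simp_all add: j_def)
    ultimately show ?case by (simp only: simp_thms)
  qed (simp add: G_def 0)
  from this[of "nat \<bar>k\<bar>"] have "G \<bar>k\<bar>" "G (- \<bar>k\<bar>)" using k by simp_all
  then have "G k" by (cases "0 \<le> k") simp_all
  then show ?thesis by (simp add: G_def)
qed

context tri_tiling
begin

text \<open>Windows of a curve of \<open>C\<close> reappear on curves of \<open>D\<close>, so this
  curve follows the signs of \<open>\<Lambda>\<close> and of \<open>\<Lambda>'\<close>, and such
  signs are unique.\<close>

lemma isomorphic_carries:
  assumes C: "describes \<sigma> C" "carries \<sigma> \<Lambda>" and D: "describes \<sigma>' D" "carries \<sigma>' \<Lambda>'"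
    and \<delta>: "0 < \<delta>" "\<delta> < 1 / 2" and iso: "locally_isomorphic (drawing \<delta> C) (drawing \<delta> D)"
  shows "carries \<sigma>' \<Lambda>"
proof -
  obtain v u where p: "path (\<lambda>k. \<sigma> (v k)) v u" using describes_path[OF C(1)] by metis
  have window: "\<exists>s ls. length ls = n \<and> ls = signs \<Lambda>' n \<and>
      (\<forall>k. \<bar>k\<bar> \<le> int N \<longrightarrow> seq_sign ls (k - s) \<noteq> Some (\<not> \<sigma> (v k)))" for n N
  proof -
    define R where "R = Max ((\<lambda>k. cmod (pos (v k) - pos 0)) ` {- int N..int N})"
    have R: "cmod (pos (v k) - pos 0) \<le> R" if "\<bar>k\<bar> \<le> int N" for k
    proof -
      have "k \<in> {- int N..int N}" using that by auto
      then show ?thesis unfolding R_def by (intro Max_ge finite_imageI imageI) simp_all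
    qed
    have "0 \<le> R" using R[of 0] norm_ge_zero[of "pos (v 0) - pos 0"] by linarith
    define r where "r = R + 5 * cmod d"
    have "0 < r" using \<open>0 \<le> R\<close> d_neq_0 by (simp add: r_def add_nonneg_pos)
    then obtain y where y: "patch_iso r (drawing \<delta> C) (pos 0) (drawing \<delta> D) y"
      using iso unfolding locally_isomorphic_def by blast
    have "5 * cmod d \<le> r" using \<open>0 \<le> R\<close> by (simp add: r_def)
    from patch_iso_shift[OF C D(1) \<delta> y this] obtain t
      where t: "\<And>x. cmod (pos x - pos 0) \<le> r - cmod d \<Longrightarrow> \<sigma>' (x + t) = \<sigma> x" by blast
    have "u 0 \<in> units" using p by (simp add: path_def)
    then obtain v' u' k0 where p': "path (\<lambda>k. \<sigma>' (v' k)) v' u'" "v' k0 = v 0 + t" "u' k0 = u 0"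
      using describes_path_through[OF D(1)] by metis
    have ag: "\<sigma>' (v' (k0 + k)) = \<sigma> (v k)" if "\<bar>k\<bar> \<le> int N" "v' (k0 + k) = v k + t" for k
    proof -
      have "cmod (pos (v k) - pos 0) \<le> r - cmod d"
        using R[OF that(1)] norm_ge_zero[of d] unfolding r_def by linarith
      then show ?thesis using t[of "v k"] that(2) by simp
    qed
    obtain s where s: "follows (\<lambda>k. \<sigma>' (v' k)) s (signs \<Lambda>' n)"
      using D(2) follows_of_level_sign[OF p'(1)] unfolding carries_def by blast
    have "seq_sign (signs \<Lambda>' n) (k - (s - k0)) \<noteq> Some (\<not> \<sigma> (v k))" if k: "\<bar>k\<bar> \<le> int N" for k
    proof -
      have "\<sigma>' (v' (k0 + k)) = \<sigma> (v k)"
        using path_agree[OF p p' ag k] ag[OF k] by blast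
      moreover have e: "k - (s - k0) = k0 + k - s" by simp
      ultimately show ?thesis using s[unfolded follows_def, rule_format, of "k0 + k"] unfolding e by simp
    qed
    then show ?thesis by (intro exI[of _ "s - k0"] exI[of _ "signs \<Lambda>' n"]) auto
  qed
  have "signs \<Lambda> n = signs \<Lambda>' n" for n
  proof -
    obtain s where s: "follows (\<lambda>k. \<sigma> (v k)) s (signs \<Lambda> (Suc n))"
      using C(2) follows_of_level_sign[OF p] unfolding carries_def by blast
    obtain s' where s': "follows (\<lambda>k. \<sigma> (v k)) s' (signs \<Lambda>' (Suc n))"
      using follows_compact[OF window[of "Suc n"]] by blast
    from follows_unique[OF s s', of n] show ?thesis by (simp add: take_signs)
  qed
  then show ?thesis using C(2) D(2) by (simp add: carries_def)
qed

end

section \<open>Balls filled by a single folding curve\<close>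

definition passes :: "(int \<Rightarrow> point) \<Rightarrow> (int \<Rightarrow> point) \<Rightarrow> point \<Rightarrow> point \<Rightarrow> bool" where
  "passes v u x w \<longleftrightarrow> (\<exists>k. v k = x \<and> u k = w)"

text \<open>The curve contains all six sides at \<open>x\<close>, three incoming and three
  outgoing.\<close>

definition full :: "(int \<Rightarrow> point) \<Rightarrow> (int \<Rightarrow> point) \<Rightarrow> point \<Rightarrow> bool" where
  "full v u x \<longleftrightarrow> (\<forall>w\<in>units. passes v u x w \<and> passes v u (x + w) w)"

text \<open>Besides the six spokes at \<open>x\<close>, the six sides of the hexagon around
  it.\<close>

definition wheel :: "(int \<Rightarrow> point) \<Rightarrow> (int \<Rightarrow> point) \<Rightarrow> point \<Rightarrow> bool" where
  "wheel v u x \<longleftrightarrow> full v u x \<and>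
     (\<forall>w\<in>units. passes v u (x - w) (rot w) \<and> passes v u (x - w) (rot (rot w)))"

definition full_ball :: "(int \<Rightarrow> point) \<Rightarrow> (int \<Rightarrow> point) \<Rightarrow> point \<Rightarrow> real \<Rightarrow> bool" where
  "full_ball v u y \<rho> \<longleftrightarrow> (\<forall>x. cmod (eis (x - y)) < \<rho> \<longrightarrow> full v u x)"

abbreviation mid :: "bool \<Rightarrow> point \<Rightarrow> point" where
  "mid l w \<equiv> (if l then rot w else rot (rot w))"

text \<open>A segment of the derived curve stands for three segments of the original one, listed
  here from the last to the first.\<close>

definition inflates :: "bool \<Rightarrow> point \<Rightarrow> (int \<Rightarrow> point) \<Rightarrow> (int \<Rightarrow> point) \<Rightarrow> (int \<Rightarrow> point) \<Rightarrow> (int \<Rightarrow> point) \<Rightarrow> bool" where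
  "inflates l b v' u' v u \<longleftrightarrow> (\<forall>y w. passes v' u' y w \<longrightarrow>
     passes v u (b + scale l y) w \<and> passes v u (b + scale l y - w) (mid l w) \<and>
     passes v u (b + scale l y - w - mid l w) w)"

lemma follows_inflates:
  assumes p: "path a v u" and f: "follows a s (l # ls)"
  obtains a' v' u' b where "path a' v' u'" "follows a' 0 ls" "inflates l b v' u' v u"
proof -
  have l: "a (s + 3 * j + 1) = l" "a (s + 3 * j + 2) = (\<not> l)" for j
    using f by (simp_all add: follows_Cons)
  have c: "cls (v s - v s) = 0" by simp
  define v' where "v' = (\<lambda>j. unscale l (v (s + 3 * j) - v s))"
  define u' where "u' = (\<lambda>j. u (s + 3 * j))"
  note D = path_derived[OF p l c]
  have "inflates l (v s) v' u' v u"
    unfolding inflates_def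
  proof (intro allI impI)
    fix y w assume "passes v' u' y w"
    then obtain j where j: "v' j = y" "u' j = w" unfolding passes_def by blast
    define k where "k = s + 3 * (j - 1)"
    have e: "k + 3 = s + 3 * j" by (simp add: k_def)
    note t = path_three[OF p l[of "j - 1", folded k_def]]
    have Y: "v (k + 3) = v s + scale l y" "u (k + 3) = w"
      using D(2)[of j] j unfolding e v'_def u'_def by simp_all
    have "k + 2 + 1 = k + 3" by simp
    then have "v (k + 3) = v (k + 2) + u (k + 3)" using p unfolding path_def by metis
    then have "v (k + 2) = v s + scale l y - w" using Y by simp
    moreover have "u (k + 2) = mid l w" "u (k + 1) = w" using t(1,4) Y(2) by simp_all
    moreover have "v (k + 1) = v (k + 2) - u (k + 2)" using t(5) by simp
    ultimately show "passes v u (v s + scale l y) w \<and> passes v u (v s + scale l y - w) (mid l w) \<and>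
      passes v u (v s + scale l y - w - mid l w) w"
      using Y unfolding passes_def by metis
  qed
  moreover have "path (\<lambda>j. a (s + 3 * j)) v' u'" using D(1) unfolding v'_def u'_def .
  moreover have "follows (\<lambda>j. a (s + 3 * j)) 0 ls" using f by (simp add: follows_Cons)
  ultimately show ?thesis using that by blast
qed

lemma scale_mid: "scale l w = w + mid l w + w"
  by (cases l) (simp_all add: scale_unit rot_rot algebra_simps)

lemma mid_units: "w \<in> units \<Longrightarrow> \<exists>x\<in>units. mid l x = w"
  by (rule bexI[of _ "mid (\<not> l) w"]) simp_all

text \<open>Of the three parts of each inflated side at \<open>y\<close>, the one at the centre is a
  spoke and the middle one belongs to the rim.\<close>

lemma full_scale:
  assumes i: "inflates l b v' u' v u" and f: "full v' u' y"
  shows "wheel v u (b + scale l y)"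
proof -
  have 1: "passes v u (b + scale l y) w" "passes v u (b + scale l y - w) (mid l w)"
    "passes v u (b + scale l y + w) w" "passes v u (b + scale l y + w + mid l w) (mid l w)"
    if w: "w \<in> units" for w
  proof -
    have "passes v' u' y w" "passes v' u' (y + w) w" using f w by (simp_all add: full_def)
    then have "passes v u (b + scale l y) w" "passes v u (b + scale l y - w) (mid l w)"
      "passes v u (b + scale l (y + w) - w - mid l w) w" "passes v u (b + scale l (y + w) - w) (mid l w)"
      using i unfolding inflates_def by blast+
    moreover have "b + scale l (y + w) - w = b + scale l y + w + mid l w"
      by (simp add: scale_add scale_mid[of l w])
    moreover have "b + scale l y + w + mid l w - mid l w = b + scale l y + w" by simp
    ultimately show "passes v u (b + scale l y) w" "passes v u (b + scale l y - w) (mid l w)"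
    "passes v u (b + scale l y + w) w" "passes v u (b + scale l y + w + mid l w) (mid l w)" by metis+
  qed
  have "passes v u (b + scale l y - w) (mid (\<not> l) w)" if w: "w \<in> units" for w
  proof -
    define x where "x = mid l w"
    have x: "x \<in> units" using w by (simp add: x_def)
    have "mid l x = mid (\<not> l) w" by (simp add: x_def)
    moreover have "x + mid l x = - w"
      unfolding \<open>mid l x = mid (\<not> l) w\<close> by (cases l) (simp_all add: x_def rot_rot)
    then have "b + scale l y + x + mid l x = b + scale l y - w" by (simp add: add.assoc)
    ultimately show ?thesis using 1(4)[OF x] by metis
  qed
  then have "passes v u (b + scale l y - w) (rot w)" "passes v u (b + scale l y - w) (rot (rot w))"
    if "w \<in> units" for w using 1(2)[OF that] that by (cases l; simp)+
  then show ?thesis unfolding wheel_def full_def using 1 by blast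
qed

text \<open>Here \<open>x\<close> is the first inner vertex of three inflated sides, which start at
  the sublattice vertices \<open>x - w\<close>; \<open>full_two\<close> treats the second inner
  vertex.\<close>

lemma full_one:
  assumes i: "inflates l b v' u' v u"
    and f: "\<And>w. w \<in> units \<Longrightarrow> \<exists>y. x - w = b + scale l y \<and> passes v' u' (y + w) w"
  shows "full v u x"
proof -
  have 1: "passes v u x w" "passes v u (x + mid l w) (mid l w)" if w: "w \<in> units" for w
  proof -
    obtain y where y: "x - w = b + scale l y" "passes v' u' (y + w) w" using f[OF w] by blast
    have "passes v u (b + scale l (y + w) - w - mid l w) w" "passes v u (b + scale l (y + w) - w) (mid l w)"
      using i y(2) unfolding inflates_def by blast+
    moreover have "b + scale l (y + w) - w = x + mid l w"
      using y(1) by (simp add: scale_add scale_mid[of l w]) (simp add: diff_eq_eq ac_simps)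
    ultimately show "passes v u x w" "passes v u (x + mid l w) (mid l w)" by simp_all
  qed
  then show ?thesis using mid_units[of _ l] unfolding full_def by metis
qed

lemma full_two:
  assumes i: "inflates l b v' u' v u"
    and f: "\<And>w. w \<in> units \<Longrightarrow> \<exists>y. x + w = b + scale l y \<and> passes v' u' y w"
  shows "full v u x"
proof -
  have 1: "passes v u x (mid l w)" "passes v u (x + w) w" if w: "w \<in> units" for w
  proof -
    obtain y where y: "x + w = b + scale l y" "passes v' u' y w" using f[OF w] by blast
    have "passes v u (b + scale l y) w" "passes v u (b + scale l y - w) (mid l w)"
      using i y(2) unfolding inflates_def by blast+
    moreover have "b + scale l y - w = x" unfolding y(1)[symmetric] by simp
    ultimately show "passes v u x (mid l w)" "passes v u (x + w) w" using y(1) by simp_all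
  qed
  then show ?thesis using mid_units[of _ l] unfolding full_def by metis
qed

lemma cmod_eis_small:
  assumes "cmod (eis x) < sqrt 3"
  shows "x = 0 \<or> x \<in> units \<or> - x \<in> units"
proof -
  have "(cmod (eis x))\<^sup>2 < (sqrt 3)\<^sup>2" using assms by (intro power_strict_mono) simp_all
  moreover have "(sqrt 3)\<^sup>2 = real_of_int 3" by simp
  ultimately have q: "(fst x)\<^sup>2 - fst x * snd x + (snd x)\<^sup>2 < 3" by (simp only: cmod_eis_sq of_int_less_iff)
  then have "(2 * fst x - snd x)\<^sup>2 + 3 * (snd x)\<^sup>2 < 12" "(2 * snd x - fst x)\<^sup>2 + 3 * (fst x)\<^sup>2 < 12"
    by (simp_all add: power2_eq_square algebra_simps)
  then have "(snd x)\<^sup>2 < 2\<^sup>2" "(fst x)\<^sup>2 < 2\<^sup>2"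
    using zero_le_power2[of "2 * fst x - snd x"] zero_le_power2[of "2 * snd x - fst x"]
    unfolding power2_eq_square[of 2] by linarith+
  then have "\<bar>snd x\<bar> < 2" "\<bar>fst x\<bar> < 2"
    by (metis abs_ge_zero power2_abs power_less_imp_less_base zero_le_numeral)+
  then have "snd x \<in> {- 1, 0, 1}" "fst x \<in> {- 1, 0, 1}" by auto
  then show ?thesis using q by (cases x) (auto simp: units_def zero_prod_def)
qed

text \<open>The ball contains the centre and its six neighbours. The three inflated sides through a
  neighbour all come from spokes or rim sides of the wheel.\<close>

lemma wheel_scale:
  assumes i: "inflates l b v' u' v u" and w: "wheel v' u' y"
  shows "full_ball v u (b + scale l y) (sqrt 3)"
  unfolding full_ball_def
proof (intro allI impI)
  have y: "passes v' u' y g" "passes v' u' (y + g) g" "passes v' u' (y - g) (rot g)" "passes v' u' (y - g) (rot (rot g))"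
    if "g \<in> units" for g
    using w that by (simp_all add: wheel_def full_def)
  fix x assume "cmod (eis (x - (b + scale l y))) < sqrt 3"
  moreover define z where "z = x - (b + scale l y)"
  ultimately have "z = 0 \<or> z \<in> units \<or> - z \<in> units" using cmod_eis_small[of z] by (simp only:)
  moreover have "x = b + scale l y + z" "x = b + scale l y - (- z)" by (simp_all add: z_def)
  ultimately consider "x = b + scale l y" | g where "g \<in> units" "x = b + scale l y + g"
    | g where "g \<in> units" "x = b + scale l y - g" by (metis add.right_neutral)
  then show "full v u x"
  proof cases
    case 1
    then show ?thesis using full_scale[OF i] w by (simp add: wheel_def)
  next
    case (2 g)
    show ?thesis
    proof (rule full_one[OF i])
      fix w assume "w \<in> units"
      from units_cases[OF 2(1) this] consider "w = g" | "w = mid l g" | "w = mid (\<not> l) g"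
        by (cases l) auto
      then show "\<exists>z. x - w = b + scale l z \<and> passes v' u' (z + w) w"
      proof cases
        case 1
        then show ?thesis using y(2)[OF 2(1)] 2(2) by (intro exI[of _ y]) simp
      next
        case w: 2
        have "x - w = b + scale l (y - w)"
          unfolding 2(2) w scale_diff by (cases l) (simp_all add: scale_unit rot_rot rot_diff rot_minus algebra_simps)
        then show ?thesis using y(1)[of w] w 2(1) by (intro exI[of _ "y - w"]) simp
      next
        case w: 3
        have "x - w = b + scale l (y + g)"
          unfolding 2(2) w scale_add by (cases l) (simp_all add: scale_unit rot_rot algebra_simps)
        moreover have "y + g + w = y - mid l g"
          by (cases l) (simp_all add: w rot_rot algebra_simps)
        moreover have "passes v' u' (y - mid l g) w"
          using y(3,4)[of "mid l g"] 2(1) by (cases l) (simp_all add: w)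
        ultimately show ?thesis by metis
      qed
    qed
  next
    case (3 g)
    show ?thesis
    proof (rule full_two[OF i])
      fix w assume "w \<in> units"
      from units_cases[OF 3(1) this] consider "w = g" | "w = mid l g" | "w = mid (\<not> l) g"
        by (cases l) auto
      then show "\<exists>z. x + w = b + scale l z \<and> passes v' u' z w"
      proof cases
        case 1
        then show ?thesis using y(1)[OF 3(1)] 3(2) by (intro exI[of _ y]) simp
      next
        case w: 2
        have "x + w = b + scale l (y + w)"
          unfolding 3(2) w scale_add by (cases l) (simp_all add: scale_unit rot_rot rot_diff rot_minus algebra_simps)
        then show ?thesis using y(2)[of w] w 3(1) by (intro exI[of _ "y + w"]) simp
      next
        case w: 3
        have "x + w = b + scale l (y - g)"
          unfolding 3(2) w scale_diff by (cases l) (simp_all add: scale_unit rot_rot algebra_simps)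
        moreover have "passes v' u' (y - g) w"
          using y(3,4)[OF 3(1)] by (cases l) (simp_all add: w)
        ultimately show ?thesis by blast
      qed
    qed
  qed
qed

text \<open>A vertex off the sublattice is full if three sublattice vertices at distance 1 are full;
  this costs the summand 1.\<close>

lemma full_ball_scale:
  assumes i: "inflates l b v' u' v u" and f: "full_ball v' u' y \<rho>"
  shows "full_ball v u (b + scale l y) (sqrt 3 * \<rho> - 1)"
  unfolding full_ball_def
proof (intro allI impI)
  fix x assume x: "cmod (eis (x - (b + scale l y))) < sqrt 3 * \<rho> - 1"
  have near: "full v' u' z" if "x + g = b + scale l z" "cmod (eis g) \<le> 1" for g z
  proof -
    have "scale l (z - y) = (x - (b + scale l y)) + g"
      using that(1) by (simp add: scale_diff algebra_simps)
    then have "sqrt 3 * cmod (eis (z - y)) = cmod (eis (x - (b + scale l y)) + eis g)"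
      by (metis cmod_eis_scale eis_add)
    also have "\<dots> \<le> cmod (eis (x - (b + scale l y))) + cmod (eis g)" by (rule norm_triangle_ineq)
    also have "\<dots> < sqrt 3 * \<rho>" using x that(2) by linarith
    finally have "cmod (eis (z - y)) < \<rho>" by simp
    then show ?thesis using f unfolding full_ball_def by blast
  qed
  have ex: "\<exists>z. x + g = b + scale l z" if "cls (x + g - b) = 0" for g
    using scale_unscale[OF that, of l] by (intro exI[of _ "unscale l (x + g - b)"]) simp
  from cls_range[of "x - b"] show "full v u x"
  proof (elim disjE)
    assume "cls (x - b) = 0"
    then obtain z where z: "x + 0 = b + scale l z" using ex[of 0] by auto
    then have "full v' u' z" by (rule near) simp
    then show ?thesis using full_scale[OF i, of z] z by (simp add: wheel_def)
  next
    assume c: "cls (x - b) = 1"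
    show ?thesis
    proof (rule full_one[OF i])
      fix w assume w: "w \<in> units"
      have "x + - w - b = (x - b) - w" by simp
      then have "cls (x + - w - b) = 0" using w c by (simp only: cls_diff cls_unit) simp
      then obtain z where z: "x + - w = b + scale l z" using ex by blast
      then have "full v' u' z" by (rule near) (simp add: eis_minus cmod_eis_unit w)
      then show "\<exists>y. x - w = b + scale l y \<and> passes v' u' (y + w) w"
        using z w by (intro exI[of _ z]) (simp add: full_def)
    qed
  next
    assume c: "cls (x - b) = 2"
    show ?thesis
    proof (rule full_two[OF i])
      fix w assume w: "w \<in> units"
      have "x + w - b = (x - b) + w" by simp
      then have "cls (x + w - b) = 0" using w c by (simp only: cls_add cls_unit) simp
      then obtain z where z: "x + w = b + scale l z" using ex by blast
      then have "full v' u' z" by (rule near) (simp add: cmod_eis_unit w)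
      then show "\<exists>y. x + w = b + scale l y \<and> passes v' u' y w"
        using z w by (intro exI[of _ z]) (simp add: full_def)
    qed
  qed
qed

text \<open>Two successive turns opposite to \<open>m\<close> close a triangle, so the path returns
  to \<open>v j\<close> after three and after six steps and passes it three times.\<close>

lemma seven_turns_full:
  assumes p: "path a v u"
    and a: "a j = m" "a (j + 1) = (\<not> m)" "a (j + 2) = (\<not> m)" "a (j + 3) = m" "a (j + 4) = (\<not> m)"
      "a (j + 5) = (\<not> m)" "a (j + 6) = m"
  shows "full v u (v j)"
proof -
  define w where "w = u j"
  define x where "x = mid m w"
  define y where "y = mid (\<not> m) w"
  have w: "w \<in> units" using p by (simp add: w_def path_def)
  have xy: "mid m w = x" "mid (\<not> m) w = y" "mid m x = y" "mid (\<not> m) x = w" "mid m y = w" "mid (\<not> m) y = x"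
    by (auto simp: x_def y_def)
  have s: "u (k + 1) = mid (a k) (u k)" "v (k + 1) = v k + u (k + 1)" for k
    using p by (simp_all add: path_def)
  have e: "j + 1 + 1 = j + 2" "j + 2 + 1 = j + 3" "j + 3 + 1 = j + 4" "j + 4 + 1 = j + 5" "j + 5 + 1 = j + 6" "j + 6 + 1 = j + 7"
    by simp_all
  have u: "u j = w" "u (j + 1) = x" "u (j + 2) = w" "u (j + 3) = y" "u (j + 4) = w" "u (j + 5) = y" "u (j + 6) = x" "u (j + 7) = y"
    using s(1)[of j] s(1)[of "j + 1"] s(1)[of "j + 2"] s(1)[of "j + 3"] s(1)[of "j + 4"] s(1)[of "j + 5"] s(1)[of "j + 6"]
    unfolding e a w_def[symmetric] by (simp_all only: xy)
  have sum: "x + w + y = 0" "w + y + x = 0" by (cases m; simp add: x_def y_def rot_rot)+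
  have v: "v (j + 1) = v j + x" "v (j + 3) = v j" "v (j + 4) = v j + w" "v (j + 6) = v j" "v (j + 7) = v j + y"
  proof -
    show "v (j + 1) = v j + x" using s(2)[of j] u by simp
    have "v (j + 3) = v j + (x + w + y)"
      using s(2)[of j] s(2)[of "j + 1"] s(2)[of "j + 2"] unfolding e u by (simp add: add.assoc)
    then show v3: "v (j + 3) = v j" using sum by simp
    show "v (j + 4) = v j + w" using s(2)[of "j + 3"] v3 unfolding e u by simp
    have "v (j + 6) = v (j + 3) + (w + y + x)"
      using s(2)[of "j + 3"] s(2)[of "j + 4"] s(2)[of "j + 5"] unfolding e u by (simp add: add.assoc)
    then show v6: "v (j + 6) = v j" using sum v3 by simp
    show "v (j + 7) = v j + y" using s(2)[of "j + 6"] v6 unfolding e u by simp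
  qed
  have "passes v u (v j) w" "passes v u (v j) x" "passes v u (v j) y"
    "passes v u (v j + w) w" "passes v u (v j + x) x" "passes v u (v j + y) y"
    unfolding passes_def using u v by blast+
  moreover have "z = w \<or> z = x \<or> z = y" if "z \<in> units" for z
    using units_cases[OF w that] by (cases m) (auto simp: x_def y_def)
  ultimately show ?thesis unfolding full_def by blast
qed

lemma full_vertex:
  assumes p: "path a v u" and f: "follows a s [l, l']"
  shows "\<exists>x. full v u x"
proof -
  have A: "a (s + 3 * j + 1) = l" "a (s + 3 * j + 2) = (\<not> l)" for j
    using f by (simp_all add: follows_Cons)
  have "follows (\<lambda>j. a (s + 3 * j)) 0 [l']" using f unfolding follows_Cons[of a s l] by blast
  then have B: "a (s + 3 * (3 * j + 1)) = l'" "a (s + 3 * (3 * j + 2)) = (\<not> l')" for j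
    unfolding follows_Cons add_0 by blast+
  \<comment> \<open>In the open residue class the entries 2 and 4 are opposite, so entry 3 equals
    one of its neighbours.\<close>
  obtain i where i: "a (s + 3 * i) = a (s + 3 * (i + 1))"
  proof (cases "a (s + 3 * 3) = l'")
    case True
    then show ?thesis using that[of 3] B(1)[of 1] by simp
  next
    case False
    then show ?thesis using that[of 2] B(2)[of 0] by auto
  qed
  define k where "k = s + 3 * i"
  have A': "a (k - 2) = l" "a (k - 1) = (\<not> l)" "a (k + 1) = l" "a (k + 2) = (\<not> l)" "a (k + 4) = l" "a (k + 5) = (\<not> l)"
    "a (k + 3) = a k"
    using A[of "i - 1"] A[of i] A[of "i + 1"] i by (simp_all add: k_def algebra_simps)
  \<comment> \<open>With e the repeated turn, the turns from \<open>k - 2\<close> on are l, not l,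
    e, l, not l, e, l, not l. The pattern of \<open>seven_turns_full\<close> starts at the first or
    second of them.\<close>
  show ?thesis
  proof (cases "a k = l")
    case True
    have "k - 1 + 1 = k" "k - 1 + 2 = k + 1" "k - 1 + 3 = k + 2" "k - 1 + 4 = k + 3" "k - 1 + 5 = k + 4" "k - 1 + 6 = k + 5"
      by simp_all
    then have "full v u (v (k - 1))"
      using A' True by (intro seven_turns_full[OF p, of _ "\<not> l"]) (simp_all only: simp_thms)
    then show ?thesis by blast
  next
    case False
    have "k - 2 + 1 = k - 1" "k - 2 + 2 = k" "k - 2 + 3 = k + 1" "k - 2 + 4 = k + 2" "k - 2 + 5 = k + 3" "k - 2 + 6 = k + 4"
      by simp_all
    then have "full v u (v (k - 2))"
      using A' False by (intro seven_turns_full[OF p, of _ l]) (simp_all only: simp_thms)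
    then show ?thesis by blast
  qed
qed

text \<open>Passing from \<rho> to \<open>sqrt 3 * \<rho> - 1\<close> is a gain only above 1 / (sqrt
  3 - 1), which exceeds 1, so a single full vertex would not start the growth. The wheel leads to
  radius \<open>sqrt 3\<close>, from which every level gains at least 1/4. Of the four additional
  signs two produce a full vertex and two inflate it.\<close>

lemma full_ball_exists:
  assumes "path a v u" "follows a s ls" "length ls = n + 4"
  shows "\<exists>y. full_ball v u y (sqrt 3 + real n / 4)"
  using assms
proof (induction n arbitrary: a v u s ls)
  case 0
  obtain l0 l1 l2 l3 where ls: "ls = [l0, l1, l2, l3]"
    using 0(3) by (auto simp: numeral_eq_Suc length_Suc_conv)
  obtain a1 v1 u1 b1 where 1: "path a1 v1 u1" "follows a1 0 [l1, l2, l3]" "inflates l0 b1 v1 u1 v u"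
    using follows_inflates[OF 0(1) 0(2)[unfolded ls]] by blast
  obtain a2 v2 u2 b2 where 2: "path a2 v2 u2" "follows a2 0 [l2, l3]" "inflates l1 b2 v2 u2 v1 u1"
    using follows_inflates[OF 1(1,2)] by blast
  obtain x where "full v2 u2 x" using full_vertex[OF 2(1,2)] by blast
  from wheel_scale[OF 1(3) full_scale[OF 2(3) this]] show ?case
    by (intro exI[of _ "b1 + scale l0 (b2 + scale l1 x)"]) simp
next
  case (Suc n)
  obtain l ls' where ls: "ls = l # ls'" "length ls' = n + 4"
    using Suc.prems(3) by (cases ls) simp_all
  obtain a' v' u' b where 1: "path a' v' u'" "follows a' 0 ls'" "inflates l b v' u' v u"
    using follows_inflates[OF Suc.prems(1) Suc.prems(2)[unfolded ls]] by blast
  obtain y where "full_ball v' u' y (sqrt 3 + real n / 4)" using Suc.IH[OF 1(1,2) ls(2)] by blast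
  from full_ball_scale[OF 1(3) this]
  have fb: "full_ball v u (b + scale l y) (sqrt 3 * (sqrt 3 + real n / 4) - 1)" .
  define t where "t = sqrt 3 * (real n / 4)"
  have "sqrt 3 \<le> 7 / (4::real)" by (rule real_le_lsqrt) (simp_all add: power2_eq_square)
  then have "sqrt 3 + 1 / 4 \<le> (2::real)" by simp
  moreover have "1 * (real n / 4) \<le> t" unfolding t_def by (intro mult_right_mono) simp_all
  ultimately have "(sqrt 3 + 1 / 4) + 1 * (real n / 4) \<le> 2 + t" by (rule add_mono)
  then have "sqrt 3 + real (Suc n) / 4 \<le> 3 + t - 1" by (simp add: add_divide_distrib)
  also have "3 + t = sqrt 3 * (sqrt 3 + real n / 4)" by (simp add: t_def distrib_left)
  finally have "sqrt 3 + real (Suc n) / 4 \<le> sqrt 3 * (sqrt 3 + real n / 4) - 1" .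
  then show ?case using fb unfolding full_ball_def by (meson less_le_trans)
qed

section \<open>Local isomorphism property and orientation\<close>

context tri_tiling
begin

lemma covering_support_unique:
  assumes cov: "covering P C" and c: "c \<in> C" "c' \<in> C" and s: "support (c k) = support (c' k')"
  shows "c = c'"
proof -
  have "c k \<in> oriented_sides P" using cov c(1) by (simp add: covering_def complete_tcurve_def)
  then have "\<exists>!(b, j). b \<in> C \<and> support (b j) = support (c k)"
    using cov unfolding covering_def by blast
  then obtain z where z: "\<forall>y. (case y of (b, j) \<Rightarrow> b \<in> C \<and> support (b j) = support (c k)) \<longrightarrow> y = z"
    by (elim ex1E) blast
  have "(c, k) = z" "(c', k') = z"
    using z[rule_format, of "(c, k)"] z[rule_format, of "(c', k')"] c s by simp_all
  then show ?thesis by auto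
qed

lemma tcurve_orientation:
  assumes "complete_tcurve P c"
  shows "(\<exists>v u. positive_curve c v u) \<or> (\<exists>v u. tri_tiling.positive_curve z0 (- d) c v u)"
proof -
  have "c 0 \<in> oriented_sides P" using assms by (simp add: complete_tcurve_def)
  then obtain v u where u: "u \<in> units" and "c 0 = side_of v u \<or> c 0 = prod.swap (side_of v u)"
    by (rule oriented_side_cases)
  then show ?thesis
  proof (elim disjE)
    assume "c 0 = side_of v u"
    then show ?thesis using tcurve_positive[OF assms _ u] by blast
  next
    assume "c 0 = prod.swap (side_of v u)"
    then have "c 0 = tri_tiling.side_of z0 (- d) (u - v) u" by (simp add: side_of_minus)
    then show ?thesis using tri_tiling.tcurve_positive[OF tri_tiling_minus assms _ u] by blast
  qed
qed

text \<open>A version of \<open>drawing_iff\<close> for a single curve, needed while the covering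
  may still mix orientations.\<close>

lemma positive_curve_shape:
  assumes p: "positive_curve c v u"
    and m: "(q, \<tau>) \<in> straight_part \<delta> (c k) \<union> corner_arc \<delta> (c k) (c (k + 1))"
  shows "(q - pos (v k), \<tau>) \<in> shape \<delta> (left_turns c k) (u k)"
proof -
  \<comment> \<open>A constant function will do, as only the turn at one vertex matters.\<close>
  define \<sigma> where "\<sigma> = (\<lambda>x :: point. left_turns c k)"
  have u: "u k \<in> units" using p by (simp add: positive_curve_def path_def)
  have e: "c k = side_of (v k) (u k)" "c (k + 1) = side_of (v k + new_dir \<sigma> (v k) (u k)) (new_dir \<sigma> (v k) (u k))"
    using p by (simp_all add: positive_curve_def path_def new_dir_def \<sigma>_def)
  have "\<sigma> (v k) = left_turns c k" by (simp add: \<sigma>_def)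
  then show ?thesis
    using m unfolding e straight_part_side corner_arc_side[OF u] shape_def
    by (auto simp: image_iff algebra_simps)
qed

lemma piece_bound:
  assumes c: "complete_tcurve P c" and \<delta>: "0 < \<delta>" "\<delta> < 1 / 2"
    and m: "(q, \<tau>) \<in> straight_part \<delta> (c k) \<union> corner_arc \<delta> (c k) (c (k + 1))"
  shows "cmod (q - snd (c k)) \<le> 3 * cmod d"
  using tcurve_orientation[OF c]
proof (elim disjE exE)
  fix v u assume p: "positive_curve c v u"
  then have "u k \<in> units" "snd (c k) = pos (v k)"
    by (simp_all add: positive_curve_def path_def side_of_def)
  then show ?thesis using shape_bound[OF positive_curve_shape[OF p m] _ \<delta>] by simp
next
  fix v u assume p: "tri_tiling.positive_curve z0 (- d) c v u"
  then have "u k \<in> units" "snd (c k) = tri_tiling.pos z0 (- d) (v k)"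
    by (simp_all add: tri_tiling.positive_curve_def[OF tri_tiling_minus] path_def
        tri_tiling.side_of_def[OF tri_tiling_minus])
  then show ?thesis
    using tri_tiling.shape_bound[OF tri_tiling_minus tri_tiling.positive_curve_shape[OF tri_tiling_minus p m] _ \<delta>]
    by simp
qed

lemma full_unique:
  assumes cov: "covering P C" and c: "c \<in> C" "c' \<in> C" and p: "positive_curve c v u"
    and x: "full v u x" "snd (c' k) = pos x"
  shows "c' = c"
proof -
  have cs: "c j = side_of (v j) (u j)" for j using p by (simp add: positive_curve_def)
  have "c' k \<in> oriented_sides P" using cov c(2) by (simp add: covering_def complete_tcurve_def)
  then obtain w g where g: "g \<in> units" "c' k = side_of w g \<or> c' k = prod.swap (side_of w g)"
    by (rule oriented_side_cases)
  from g(2) have "w = x \<or> w = x + g"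
  proof (elim disjE)
    assume "c' k = side_of w g"
    then show ?thesis using x(2) by (simp add: side_of_def)
  next
    assume "c' k = prod.swap (side_of w g)"
    then have "pos (w - g) = pos x" using x(2) by (simp add: side_of_def)
    then have "w - g = x" by (simp only: pos_eq_iff)
    then show ?thesis by auto
  qed
  then have "passes v u w g" using x(1) g(1) by (auto simp: full_def)
  then obtain j where "c j = side_of w g" unfolding passes_def cs by blast
  then have "support (c' k) = support (c j)" using g(2) by auto
  then show ?thesis by (rule covering_support_unique[OF cov c(2,1)])
qed

text \<open>Otherwise the side is traversed backwards, and its straight part shows a tangent
  opposite to a positive direction along an interval. The local isomorphism property copies this
  interval close to every point, in particular into a ball filled by \<open>c\<close> alone, where
  the tangent is confined to tips.\<close>

lemma local_isomorphism_positive: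
  assumes cov: "folding_covering P C" and lip: "local_isomorphism_property (drawing \<delta> C)"
    and \<delta>: "0 < \<delta>" "\<delta> < 1 / 2" and c: "c \<in> C" and p: "positive_curve c v u" and x0: "x0 \<in> units"
  shows "side_of w0 x0 \<in> segments C"
proof (rule ccontr)
  assume neg: "side_of w0 x0 \<notin> segments C"
  have cov': "covering P C" and fold: "complete_folding_tcurve P c"
    using cov c by (simp_all add: folding_covering_def)
  have d: "0 < cmod d" using d_neq_0 by simp
  obtain B where B: "B \<in> segments C" "support B = support (side_of w0 x0)"
    using segments_unique[OF cov' side_of_in[OF x0]] by blast
  obtain w x where x: "x \<in> units" "B = side_of w x \<or> B = prod.swap (side_of w x)"
    using oriented_side_cases[of B] B(1) segments_in[OF cov'] by (metis subsetD)
  then have "support (side_of w x) = support (side_of w0 x0)" using B(2) by auto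
  then have "w = w0 \<and> x = x0" by (rule support_side_of[OF x(1) x0])
  then have "B = prod.swap (side_of w0 x0)" using x(2) B(1) neg by auto
  then obtain c' k' where c': "c' \<in> C" "c' k' = (pos w0, pos (w0 - x0))"
    using B(1) by (auto simp: segments_def side_of_def)
  define \<tau> where "\<tau> = - sgn (d * eis x0)"
  have seg: "(pos w0 - d * eis x0 * of_real s, \<tau>) \<in> drawing \<delta> C" if "\<delta> \<le> s" "s \<le> 1 - \<delta>" for s
  proof -
    have "dir (c' k') = - (d * eis x0)" by (simp add: c'(2) dir_def pos_diff)
    then have "(pos w0 - d * eis x0 * of_real s, \<tau>) \<in> straight_part \<delta> (c' k')"
      unfolding straight_part_def using that
      by (intro image_eqI[of _ _ s]) (simp_all add: c'(2) \<tau>_def sgn_minus)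
    then show ?thesis using c'(1) unfolding drawing_def by blast
  qed
  obtain S where S: "\<And>y. \<exists>z\<in>cball y S. patch_iso (cmod d) (drawing \<delta> C) z (drawing \<delta> C) (pos w0)"
    using lip d unfolding local_isomorphism_property_def by meson
  \<comment> \<open>In units of \<open>cmod d\<close>: \<open>S\<close> for the place of the copy, 1
    for the position on the side and 3 for the reach of a piece.\<close>
  define K where "K = S / cmod d + 4"
  obtain n where n: "4 * K < real n" using reals_Archimedean2 by blast
  obtain s ls where "length ls = n + 4" "follows (left_turns c) s ls"
    using folding_curve_follows[OF fold] by blast
  moreover have "path (left_turns c) v u" using p by (simp add: positive_curve_def)
  ultimately obtain y where y: "full_ball v u y (sqrt 3 + real n / 4)"
    using full_ball_exists by blast
  obtain z where z: "z \<in> cball (pos y) S" "patch_iso (cmod d) (drawing \<delta> C) (pos w0) (drawing \<delta> C) z"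
    using S[of "pos y"] patch_iso_sym by blast
  have zy: "cmod (z - pos y) \<le> S" using z(1) by (simp add: dist_norm norm_minus_commute)
  have pt: "\<exists>k. z - d * eis x0 * of_real t = pos (v k) - d * eis x0 * tip \<delta> * of_int (sign_of (left_turns c k))"
    if t: "\<delta> \<le> t" "t \<le> 1 - \<delta>" for t
  proof -
    define q where "q = z - d * eis x0 * of_real t"
    have t1: "cmod (d * eis x0 * of_real t) \<le> cmod d"
    proof -
      have "cmod (d * eis x0 * of_real t) = cmod d * \<bar>t\<bar>" by (simp add: norm_mult cmod_eis_unit[OF x0])
      also have "\<dots> \<le> cmod d * 1" using t \<delta> by (intro mult_left_mono) auto
      finally show ?thesis by simp
    qed
    have "(pos w0 - d * eis x0 * of_real t + (z - pos w0), \<tau>) \<in> drawing \<delta> C"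
      by (rule patch_isoD[OF z(2) seg[OF t]]) (use t1 in simp)
    then have "(q, \<tau>) \<in> drawing \<delta> C" by (simp add: q_def)
    then obtain c1 k where c1: "c1 \<in> C" and m: "(q, \<tau>) \<in> straight_part \<delta> (c1 k) \<union> corner_arc \<delta> (c1 k) (c1 (k + 1))"
      unfolding drawing_def by blast
    have ct: "complete_tcurve P c1" using cov' c1 by (simp add: covering_def)
    then have "c1 k \<in> oriented_sides P" by (simp add: complete_tcurve_def)
    then obtain a where a: "snd (c1 k) = pos a" unfolding oriented_sides_eq by auto
    have "cmod (q - pos a) \<le> 3 * cmod d" using piece_bound[OF ct \<delta> m] unfolding a .
    moreover have "cmod (pos a - pos y) \<le> cmod (q - pos y) + cmod (q - pos a)"
      using norm_triangle_ineq4[of "q - pos y" "q - pos a"] by simp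
    moreover have "q - pos y = (z - pos y) - d * eis x0 * of_real t" by (simp add: q_def)
    then have "cmod (q - pos y) \<le> cmod (z - pos y) + cmod (d * eis x0 * of_real t)"
      by (simp only: norm_triangle_ineq4)
    ultimately have "cmod (pos a - pos y) \<le> S + 4 * cmod d" using zy t1 by linarith
    moreover have "cmod (pos a - pos y) = cmod d * cmod (eis (a - y))"
      by (simp add: pos_def eis_diff norm_mult flip: right_diff_distrib)
    ultimately have "cmod (eis (a - y)) \<le> S / cmod d + 4" using d by (simp add: field_simps)
    also have "\<dots> < real n / 4" using n by (simp add: K_def[symmetric])
    also have "\<dots> \<le> sqrt 3 + real n / 4" by simp
    finally have "full v u a" using y unfolding full_ball_def by blast
    then have "c1 = c" by (rule full_unique[OF cov' c c1 p _ a])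
    have "u k \<in> units" using p by (simp add: positive_curve_def path_def)
    from shape_tip[OF positive_curve_shape[OF p m[unfolded \<open>c1 = c\<close> \<tau>_def]] x0 this]
    have "q = pos (v k) - d * eis x0 * tip \<delta> * of_int (sign_of (left_turns c k))"
      by (simp add: algebra_simps)
    then show ?thesis unfolding q_def by blast
  qed
  define \<epsilon> where "\<epsilon> = min (1 - 2 * \<delta>) (1 / 3)"
  have \<epsilon>: "0 < \<epsilon>" "\<epsilon> \<le> 1 / 3" "\<epsilon> \<le> 1 - 2 * \<delta>"
    unfolding \<epsilon>_def using \<delta> by (simp, simp only: min.cobounded2, simp only: min.cobounded1)
  obtain k where k: "z - d * eis x0 * of_real \<delta> = pos (v k) - d * eis x0 * tip \<delta> * of_int (sign_of (left_turns c k))"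
    using pt[of \<delta>] \<delta> by auto
  obtain j where j: "z - d * eis x0 * of_real (\<delta> + \<epsilon>) = pos (v j) - d * eis x0 * tip \<delta> * of_int (sign_of (left_turns c j))"
    using pt[of "\<delta> + \<epsilon>"] \<epsilon> by auto
  have "- \<epsilon> = 0"
  proof (rule tips_apart[OF _ x0 \<delta>])
    show "pos (v j) - d * eis x0 * tip \<delta> * of_int (sign_of (left_turns c j)) =
      pos (v k) - d * eis x0 * tip \<delta> * of_int (sign_of (left_turns c k)) + d * eis x0 * of_real (- \<epsilon>)"
      unfolding j[symmetric] k[symmetric] by (simp add: algebra_simps)
    show "\<bar>- \<epsilon>\<bar> \<le> 1 / 3" using \<epsilon> by simp
  qed
  then show False using \<epsilon> by simp
qed

lemma local_isomorphism_property_P: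
  assumes cov: "folding_covering P C" and lip: "local_isomorphism_property (drawing \<delta> C)"
    and \<delta>: "0 < \<delta>" "\<delta> < 1 / 2"
  shows "property_P P (segments C)"
proof -
  have cov': "covering P C" using cov by (simp add: folding_covering_def)
  have "(1, 0) \<in> units" by (simp add: units_def)
  from side_of_in[OF this] obtain c where c: "c \<in> C" using cov' unfolding covering_def by blast
  then have "complete_tcurve P c" using cov' by (simp add: covering_def)
  from tcurve_orientation[OF this] show ?thesis
  proof (elim disjE exE)
    fix v u assume "positive_curve c v u"
    from local_isomorphism_positive[OF cov lip \<delta> c this] show ?thesis
      using all_positive_describes[OF cov'] describes_property_P by blast
  next
    fix v u assume "tri_tiling.positive_curve z0 (- d) c v u"
    from tri_tiling.local_isomorphism_positive[OF tri_tiling_minus cov lip \<delta> c this] show ?thesis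
      using tri_tiling.all_positive_describes[OF tri_tiling_minus cov']
        tri_tiling.describes_property_P[OF tri_tiling_minus] by blast
  qed
qed

lemma isomorphic_iff:
  assumes C: "folding_covering P C" "property_P P (segments C)" "describes \<sigma> C"
    and D: "folding_covering P D" "property_P P (segments D)" and \<delta>: "0 < \<delta>" "\<delta> < 1 / 2"
  shows "locally_isomorphic (drawing \<delta> C) (drawing \<delta> D) \<longleftrightarrow>
    (\<exists>\<Lambda>. sign_sequence \<Lambda> \<and> covering_associated P \<Lambda> C \<and> covering_associated P \<Lambda> D) \<and> same_orientation P C D"
    (is "?I \<longleftrightarrow> ?R")
proof
  have cov: "covering P C" "covering P D" using C(1) D(1) by (simp_all add: folding_covering_def)
  obtain \<Lambda> where \<Lambda>: "carries \<sigma> \<Lambda>" using describes_carries[OF C(1,3)] by blast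
  {
    assume I: ?I
    obtain \<sigma>' where \<sigma>': "describes \<sigma>' D"
      using property_P_orientation[OF cov(2) D(2)] opposite_not_isomorphic[OF C(3) _ \<delta>] I by blast
    obtain \<Lambda>' where "carries \<sigma>' \<Lambda>'" using describes_carries[OF D(1) \<sigma>'] by blast
    then have "carries \<sigma>' \<Lambda>" by (rule isomorphic_carries[OF C(3) \<Lambda> \<sigma>' _ \<delta> I])
    then have "covering_associated P \<Lambda> D" by (rule carries_covering_associated[OF cov(2) \<sigma>'])
    moreover have "covering_associated P \<Lambda> C" by (rule carries_covering_associated[OF cov(1) C(3) \<Lambda>])
    moreover have "sign_sequence \<Lambda>" using \<Lambda> by (simp add: carries_def)
    moreover have "segments C = segments D"
      unfolding describes_segments[OF C(3)] describes_segments[OF \<sigma>'] ..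
    then have "same_orientation P C D"
      using coherent_segments[OF cov(1) C(2)] by (auto simp: same_orientation_def)
    ultimately show ?R by blast
  next
    assume R: ?R
    then have "segments C = segments D" by (auto simp: same_orientation_def)
    then obtain \<sigma>' where \<sigma>': "describes \<sigma>' D"
      using property_P_orientation[OF cov(2) D(2)] opposite_segments[OF C(3)] by blast
    obtain \<Lambda>' where \<Lambda>': "carries \<sigma>' \<Lambda>'" using describes_carries[OF D(1) \<sigma>'] by blast
    obtain \<Lambda>0 where a: "sign_sequence \<Lambda>0" "covering_associated P \<Lambda>0 C" "covering_associated P \<Lambda>0 D"
      using R by blast
    have "carries \<sigma> \<Lambda>0" "carries \<sigma>' \<Lambda>0"
      using covering_associated_carries[OF C(3) \<Lambda> a(1,2)] covering_associated_carries[OF \<sigma>' \<Lambda>' a(1,3)] .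
    then show ?I using locally_isomorphicI[OF C(3) _ \<sigma>' _ \<delta>] by blast
  }
qed

text \<open>By the symmetry between \<open>d\<close> and \<open>- d\<close>, a covering with (P) may
  be assumed to be described by signs.\<close>

lemma property_P_cases:
  assumes cov: "folding_covering P C" "property_P P (segments C)"
    and d: "\<And>e. tri_tiling P z0 e \<Longrightarrow> \<exists>\<sigma>. tri_tiling.describes z0 e \<sigma> C \<Longrightarrow> Q"
  shows Q
  using property_P_orientation[of C] cov d[OF tri_tiling_axioms] d[OF tri_tiling_minus]
  unfolding folding_covering_def by blast

end

theorem theorem2p3:
  fixes P :: "complex set set" and \<delta> :: real
  assumes "regular_tiling P" and "0 < \<delta>" and "\<delta> < 1 / 2"
  shows "(\<forall>C. folding_covering P C \<longrightarrow>
            (local_isomorphism_property (drawing \<delta> C) \<longrightarrow> property_P P (segments C)) \<and>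
            (property_P P (segments C) \<longrightarrow> strong_local_isomorphism_property (drawing \<delta> C))) \<and>
         (\<forall>C D. folding_covering P C \<longrightarrow> folding_covering P D \<longrightarrow>
            property_P P (segments C) \<longrightarrow> property_P P (segments D) \<longrightarrow>
            (locally_isomorphic (drawing \<delta> C) (drawing \<delta> D) \<longleftrightarrow>
               (\<exists>\<Lambda>. sign_sequence \<Lambda> \<and> covering_associated P \<Lambda> C \<and> covering_associated P \<Lambda> D) \<and>
               same_orientation P C D))"
proof -
  note \<delta> = assms(2,3)
  obtain z0 d where t: "tri_tiling P z0 d"
    using assms(1) unfolding regular_tiling_def tri_tiling_def by blast
  show ?thesis
  proof (intro conjI allI impI)
    fix C assume C: "folding_covering P C"
    show "property_P P (segments C)" if "local_isomorphism_property (drawing \<delta> C)"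
      by (rule tri_tiling.local_isomorphism_property_P[OF t C that \<delta>])
    assume p: "property_P P (segments C)"
    show "strong_local_isomorphism_property (drawing \<delta> C)"
    proof (rule tri_tiling.property_P_cases[OF t C p])
      fix e assume e: "tri_tiling P z0 e" and "\<exists>\<sigma>. tri_tiling.describes z0 e \<sigma> C"
      then obtain \<sigma> where \<sigma>: "tri_tiling.describes z0 e \<sigma> C" by blast
      obtain \<Lambda> where "carries \<sigma> \<Lambda>" using tri_tiling.describes_carries[OF e C \<sigma>] by blast
      then show ?thesis by (rule tri_tiling.strong_local_isomorphism[OF e \<sigma> _ \<delta>])
    qed
  next
    fix C D assume C: "folding_covering P C" and D: "folding_covering P D"
      and p: "property_P P (segments C)" "property_P P (segments D)"
    show "locally_isomorphic (drawing \<delta> C) (drawing \<delta> D) \<longleftrightarrow>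
               (\<exists>\<Lambda>. sign_sequence \<Lambda> \<and> covering_associated P \<Lambda> C \<and> covering_associated P \<Lambda> D) \<and>
               same_orientation P C D"
    proof (rule tri_tiling.property_P_cases[OF t C p(1)])
      fix e assume e: "tri_tiling P z0 e" and "\<exists>\<sigma>. tri_tiling.describes z0 e \<sigma> C"
      then obtain \<sigma> where \<sigma>: "tri_tiling.describes z0 e \<sigma> C" by blast
      show ?thesis by (rule tri_tiling.isomorphic_iff[OF e C p(1) \<sigma> D p(2) \<delta>])
    qed
  qed
qed

end
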